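(* Suppose $\eta$ is a stationary max-i.d. random field on $\mathbb Z^d$ with exponent measure $\mu$ and let $$\gamma(h)=\int_{[0,+\infty)^2}\mathbb P[\eta(0)\leq y_1,\ \eta(h)\leq y_2]\,\mu_{0,h}(dy_1dy_2),\quad h\in\mathbb Z^d.$$ Let $g:\mathbb R^p\to\mathbb R$ be a measurable function and $t_1,\ldots,t_p\in\mathbb Z^d$ such that $$\mathbb E\big[|g(\eta(t_1),\ldots,\eta(t_p))|^{2+\delta}\big]<\infty\quad\text{for some }\delta>0,$$ and assume that $$\sum_{|h|\geq m}\gamma(h)=o(m^{-d})\ \text{ as } m\to\infty\quad\text{and}\quad\sum_{m=1}^\infty m^{d-1}\sup_{|h|\geq m}\gamma(h)^{\delta/(2+\delta)}<\infty.$$ Then the stationary random field $X$ defined by $$X(t)=g(\eta(t_1+t),\ldots,\eta(t_p+t)),\quad t\in\mathbb Z^d,$$ satisfies the CLT.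
   Context: Max-i.d. fields. Put $T=\mathbb Z^d$ (discrete topology), $\mathbb C(T)$ the space of nonnegative functions on $T$ with the topology of uniform convergence on compact (i.e. finite) sets, $\mathbb C_0(T)=\mathbb C(T)\setminus\{0\}$. $\mu$ is a locally finite Borel measure on $\mathbb C_0(T)$ such that $\mu[\{f\in\mathbb C_0(T):\ \sup_K f>\varepsilon\}]<\infty$ for all compact $K\subset T$ and $\varepsilon>0$. With $\Phi$ a Poisson point process on $\mathbb C_0(T)$ with intensity $\mu$, the max-i.d. random field with exponent measure $\mu$ is $\eta(t)=\max\{\phi(t):\ \phi\in\Phi\}$, $t\in T$ (maximum of the empty set $=0$). For $h\in\mathbb Z^d$, $\mu_{0,h}(A)=\mu[\{f\in\mathbb C_0(T):\ (f(0),f(h))\in A\}]$ for Borel $A\subset[0,+\infty)^2$. Notation. $|h|=\max_{1\le i\le d}|h_i|$ for $h\in\mathbb Z^d$; $|S|$ is the number of elements of $S\subset\mathbb Z^d$; $\partial S$ is the set of $h\in S$ for which there is $h'\notin S$ with $|h-h'|=1$. A random field $X=(X(t))_{t\in\mathbb Z^d}$ is stationary if the law of $(X(t+s))_{t\in\mathbb Z^d}$ does not depend on $s\in\mathbb Z^d$. CLT. A square integrable stationary random field $X$ satisfies the CLT if: (i) the series $\sigma^2=\sum_{t\in\mathbb Z^d}\mathrm{Cov}[X(0),X(t)]$ converges absolutely; (ii) for every sequence $\Lambda_n$ of finite subsets of $\mathbb Z^d$ which increases to $\mathbb Z^d$ and such that $\lim_{n\to\infty}|\partial\Lambda_n|/|\Lambda_n|=0$,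 the sequence $|\Lambda_n|^{-1/2}\sum_{t\in\Lambda_n}(X(t)-\mathbb E[X(t)])$ converges in law to the normal distribution with mean $0$ and variance $\sigma^2$ as $n\to\infty$. The case $\sigma^2=0$ is allowed, the limit then being the Dirac mass at $0$. *)

theory Defs
  imports "HOL-Probability.Probability" "HOL-Library.Landau_Symbols"
begin

section \<open>The lattice\<close>

definition sup_norm :: "int ^ 'd \<Rightarrow> int" where
  "sup_norm h = Max (range (\<lambda>i. \<bar>h $ i\<bar>))"

definition lattice_boundary :: "(int ^ 'd) set \<Rightarrow> (int ^ 'd) set" where
  "lattice_boundary S = {h \<in> S. \<exists>h'. h' \<notin> S \<and> sup_norm (h - h') = 1}"


section \<open>Random fields and the central limit theorem\<close>

definition random_field :: "'w measure \<Rightarrow> ('i \<Rightarrow> 'w \<Rightarrow> real) \<Rightarrow> bool" where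
  "random_field M X \<longleftrightarrow> (\<forall>t. X t \<in> borel_measurable M)"

definition shifted_law :: "'w measure \<Rightarrow> (int ^ 'd \<Rightarrow> 'w \<Rightarrow> real) \<Rightarrow> int ^ 'd \<Rightarrow> (int ^ 'd \<Rightarrow> real) measure" where
  "shifted_law M X s = distr M (Pi\<^sub>M UNIV (\<lambda>_. borel)) (\<lambda>\<omega> t. X (t + s) \<omega>)"

definition stationary_field :: "'w measure \<Rightarrow> (int ^ 'd \<Rightarrow> 'w \<Rightarrow> real) \<Rightarrow> bool" where
  "stationary_field M X \<longleftrightarrow>
     random_field M X \<and> (\<forall>s s'. shifted_law M X s = shifted_law M X s')"

definition covariance :: "'w measure \<Rightarrow> ('w \<Rightarrow> real) \<Rightarrow> ('w \<Rightarrow> real) \<Rightarrow> real" where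
  "covariance M Y Z =
     (\<integral>\<omega>. (Y \<omega> - (\<integral>\<omega>. Y \<omega> \<partial>M)) * (Z \<omega> - (\<integral>\<omega>. Z \<omega> \<partial>M)) \<partial>M)"

text \<open>Second argument: the variance, assumed nonnegative; variance 0 gives the Dirac mass.\<close>

definition normal_law :: "real \<Rightarrow> real \<Rightarrow> real measure" where
  "normal_law m v =
     (if v = 0 then return borel m else density lborel (\<lambda>x. ennreal (normal_density m (sqrt v) x)))"

text \<open>For \<open>\<Lambda> n = {}\<close> the quotients below are 0 by convention; this concerns only finitely many
  \<open>n\<close>, since the \<open>\<Lambda> n\<close> increase to the whole lattice.
  The condition \<open>0 \<le> \<sigma>2\<close> only makes explicit that \<open>\<sigma>2\<close> is a variance.\<close>

definition satisfies_CLT :: "'w measure \<Rightarrow> (int ^ 'd \<Rightarrow> 'w \<Rightarrow> real) \<Rightarrow> bool" where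
  "satisfies_CLT M X \<longleftrightarrow>
     stationary_field M X \<and>
     (\<forall>t. integrable M (\<lambda>\<omega>. (X t \<omega>)\<^sup>2)) \<and>
     (\<lambda>t. \<bar>covariance M (X 0) (X t)\<bar>) summable_on UNIV \<and>
     (let \<sigma>2 = (\<Sum>\<^sub>\<infinity>t. covariance M (X 0) (X t)) in
        0 \<le> \<sigma>2 \<and>
        (\<forall>\<Lambda> :: nat \<Rightarrow> (int ^ 'd) set.
           (\<forall>n. finite (\<Lambda> n)) \<longrightarrow> incseq \<Lambda> \<longrightarrow> (\<Union>n. \<Lambda> n) = UNIV \<longrightarrow>
           (\<lambda>n. real (card (lattice_boundary (\<Lambda> n))) / real (card (\<Lambda> n))) \<longlonglongrightarrow> 0 \<longrightarrow>
           weak_conv_m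
             (\<lambda>n. distr M borel
                (\<lambda>\<omega>. (\<Sum>t\<in>\<Lambda> n. X t \<omega> - (\<integral>\<omega>. X t \<omega> \<partial>M)) / sqrt (real (card (\<Lambda> n)))))
             (normal_law 0 \<sigma>2)))"


section \<open>Max-infinitely divisible fields\<close>

text \<open>On the discrete lattice every function is continuous and the compact sets are the finite ones,
  so the topology of uniform convergence on compact sets is the product topology, which is the
  topology of the function type.\<close>

definition C0 :: "(int ^ 'd \<Rightarrow> real) set" where
  "C0 = {f. \<forall>t. 0 \<le> f t} - {\<lambda>_. 0}"

definition exponent_measure :: "(int ^ 'd \<Rightarrow> real) measure \<Rightarrow> bool" where
  "exponent_measure \<mu> \<longleftrightarrow>
     sets \<mu> = sets (restrict_space borel C0) \<and>
     (\<forall>f\<in>C0. \<exists>U. open U \<and> f \<in> U \<and> emeasure \<mu> (U \<inter> C0) < \<infinity>) \<and>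
     (\<forall>K \<epsilon>. finite K \<longrightarrow> K \<noteq> {} \<longrightarrow> 0 < \<epsilon> \<longrightarrow> emeasure \<mu> {f \<in> C0. \<epsilon> < Max (f ` K)} < \<infinity>)"

text \<open>A point configuration is given by its multiplicity function \<open>c\<close>, which stands for the counting
  measure \<open>\<Sum>f. c f \<cdot> \<delta>\<^sub>f\<close>. Multiplicities are needed because \<open>\<mu>\<close> may have atoms.\<close>

definition num_points :: "('f \<Rightarrow> nat) \<Rightarrow> 'f set \<Rightarrow> ennreal" where
  "num_points c A = (\<Sum>\<^sub>\<infinity>f\<in>A. of_nat (c f))"

definition configuration :: "((int ^ 'd \<Rightarrow> real) \<Rightarrow> nat) \<Rightarrow> bool" where
  "configuration c \<longleftrightarrow>
     {f. 0 < c f} \<subseteq> C0 \<and>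
     (\<forall>K \<epsilon>. finite K \<longrightarrow> K \<noteq> {} \<longrightarrow> 0 < \<epsilon> \<longrightarrow> num_points c {f \<in> C0. \<epsilon> < Max (f ` K)} < \<infinity>)"

text \<open>The law of a count with values in \<open>{0, 1, 2, \<dots>, \<infinity>}\<close>; Poisson with infinite mean
  is the Dirac mass at infinity. The formula also covers mean 0, which the library's Poisson
  distribution excludes.\<close>

definition poisson_distributed :: "'w measure \<Rightarrow> ('w \<Rightarrow> ennreal) \<Rightarrow> ennreal \<Rightarrow> bool" where
  "poisson_distributed M N r \<longleftrightarrow>
     N \<in> borel_measurable M \<and>
     (if r = \<infinity> then (AE \<omega> in M. N \<omega> = \<infinity>)
      else (\<forall>k::nat. measure M {\<omega> \<in> space M. N \<omega> = of_nat k}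
                     = enn2real r ^ k / fact k * exp (- enn2real r)))"

definition poisson_point_process ::
    "'w measure \<Rightarrow> (int ^ 'd \<Rightarrow> real) measure \<Rightarrow> ('w \<Rightarrow> (int ^ 'd \<Rightarrow> real) \<Rightarrow> nat) \<Rightarrow> bool" where
  "poisson_point_process M \<mu> \<Phi> \<longleftrightarrow>
     (\<forall>\<omega>\<in>space M. configuration (\<Phi> \<omega>)) \<and>
     (\<forall>A\<in>sets \<mu>. poisson_distributed M (\<lambda>\<omega>. num_points (\<Phi> \<omega>) A) (emeasure \<mu> A)) \<and>
     (\<forall>(n::nat) A. (\<forall>i<n. A i \<in> sets \<mu>) \<longrightarrow> disjoint_family_on A {..<n} \<longrightarrow>
        prob_space.indep_vars M (\<lambda>_. borel) (\<lambda>i \<omega>. num_points (\<Phi> \<omega>) (A i)) {..<n})"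

text \<open>The supremum is a maximum for every configuration: only finitely many points exceed any
  given positive level at \<open>t\<close>. Inserting 0 sets the maximum of the empty set to 0 and changes
  nothing otherwise.\<close>

definition max_field :: "((int ^ 'd \<Rightarrow> real) \<Rightarrow> nat) \<Rightarrow> int ^ 'd \<Rightarrow> real" where
  "max_field c t = Sup (insert 0 ((\<lambda>f. f t) ` {f. 0 < c f}))"

definition max_id_field ::
    "'w measure \<Rightarrow> (int ^ 'd \<Rightarrow> real) measure \<Rightarrow> (int ^ 'd \<Rightarrow> 'w \<Rightarrow> real) \<Rightarrow> bool" where
  "max_id_field M \<mu> \<eta> \<longleftrightarrow>
     exponent_measure \<mu> \<and>
     (\<exists>\<Phi>. poisson_point_process M \<mu> \<Phi> \<and> (\<forall>\<omega>\<in>space M. \<forall>t. \<eta> t \<omega> = max_field (\<Phi> \<omega>) t))"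


section \<open>The dependence coefficient\<close>

definition bivariate_exponent :: "(int ^ 'd \<Rightarrow> real) measure \<Rightarrow> int ^ 'd \<Rightarrow> (real \<times> real) measure" where
  "bivariate_exponent \<mu> h = distr \<mu> (restrict_space borel ({0..} \<times> {0..})) (\<lambda>f. (f 0, f h))"

definition gamma_coeff ::
    "'w measure \<Rightarrow> (int ^ 'd \<Rightarrow> real) measure \<Rightarrow> (int ^ 'd \<Rightarrow> 'w \<Rightarrow> real) \<Rightarrow> int ^ 'd \<Rightarrow> ennreal" where
  "gamma_coeff M \<mu> \<eta> h =
     (\<integral>\<^sup>+ (y1, y2). emeasure M {\<omega> \<in> space M. \<eta> 0 \<omega> \<le> y1 \<and> \<eta> h \<omega> \<le> y2} \<partial>bivariate_exponent \<mu> h)"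

text \<open>Real powers on \<open>[0, \<infinity>]\<close>, for exponents \<open>a > 0\<close>.\<close>

definition ennreal_powr :: "ennreal \<Rightarrow> real \<Rightarrow> ennreal" where
  "ennreal_powr x a = (if x = \<infinity> then \<infinity> else ennreal (enn2real x powr a))"

end

theory Submission
  imports Defs
begin

text \<open>
  The heart of the proof is the covariance inequality
  \<open>\<bar>Cov (F, G)\<bar> \<le> (\<Sum>s. \<Sum>s'. osc F s * osc G s' * \<gamma> (s' - s))\<close> for bounded functionals \<open>F\<close>, \<open>G\<close> of the
  field, where \<open>osc F s\<close> is the oscillation of \<open>F\<close> in the coordinate \<open>s\<close>. After restriction to finitely many
  sites and levels, \<open>\<eta>\<close> is a union of independently present cells of functions, and the covariance is
  computed by removing the randomness of one cell at a time; a cell contributes at \<open>s\<close> and \<open>s'\<close> only if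
  nothing in the process lies above it at these two sites, which produces \<open>\<gamma>\<close>.

  For bounded \<open>g\<close> the characteristic function of \<open>\<theta> S\<close>, \<open>S\<close> the centred sum over a finite set, then almost
  satisfies the differential equation \<open>\<psi>' = - Var (S) * \<theta> * \<psi>\<close>: because \<open>exp (i \<theta> S)\<close> has oscillation
  of order \<open>\<theta>\<close> in each coordinate, a neighbourhood of fixed size can be split off around every site.
  Unbounded \<open>g\<close> are truncated, the error being controlled by a Davydov type inequality.
\<close>

text \<open>Removing the cell \<open>k\<close> leaves the variance p (1 - p) of its indicator times
  the probability that no other hit cell reaches as high as \<open>k\<close> at \<open>s\<close> or
  at \<open>s'\<close>. The factor 1 - p turns this into the probability that no hit cell at all
  does, which is at most P[\<eta>(s) \<le> f(s), \<eta>(s') \<le> f(s')] for every f in the cell,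
  while p is at most the mass of the cell; the sum over the cells is then at most the integral
  \<gamma>, whatever the grid. A measurable function is only approximated by grid functions in L1,
  where oscillations are not stable. Functionals are therefore Lipschitz functions of bounded window
  values, whose bounds see the approximated function only through its supremum, and clipping
  preserves that. As \<gamma> may be infinite at some lags, it is capped at 1, and lags at the cap
  get the trivial covariance bound. In the differential equation, \<theta> is of order n^(-1/2) for
  n sites: the Taylor remainder and the fluctuation of the local variance then vanish in the limit,
  and the dependence beyond the neighbourhood is made small beforehand by enlarging it.\<close>

section \<open>Covariances of functions of independent indicators\<close>

text \<open>The expectation of \<open>f\<close> at a random subset of \<open>A\<close> that contains
  each \<open>k\<close> independently with probability \<open>p k\<close>. As a finite sum it can be
  split at one element (\<open>bernoulli_mean_insert\<close>), which drives the induction over the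
  indicators.\<close>

definition bernoulli_mean :: "('k \<Rightarrow> real) \<Rightarrow> 'k set \<Rightarrow> ('k set \<Rightarrow> real) \<Rightarrow> real" where
  "bernoulli_mean p A f = (\<Sum>B\<in>Pow A. (\<Prod>k\<in>B. p k) * (\<Prod>k\<in>A - B. 1 - p k) * f B)"

lemma bernoulli_mean_empty [simp]: "bernoulli_mean p {} f = f {}"
  by (simp add: bernoulli_mean_def)

lemma bernoulli_mean_insert:
  assumes "finite A" "a \<notin> A"
  shows "bernoulli_mean p (insert a A) f = bernoulli_mean p A (\<lambda>B. p a * f (insert a B) + (1 - p a) * f B)"
proof -
  have disj: "Pow A \<inter> insert a ` Pow A = {}" and inj: "inj_on (insert a) (Pow A)"
    using assms by (auto simp: inj_on_def)
  have *: "(\<Prod>k\<in>insert a A - B. 1 - p k) = (1 - p a) * (\<Prod>k\<in>A - B. 1 - p k)" if "B \<in> Pow A" for B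
  proof -
    have "insert a A - B = insert a (A - B)" using that assms by auto
    then show ?thesis using assms by simp
  qed
  have **: "(\<Prod>k\<in>insert a B. p k) = p a * (\<Prod>k\<in>B. p k)"
    "insert a A - insert a B = A - B" "A - insert a B = A - B" if "B \<in> Pow A" for B
  proof -
    have "a \<notin> B" "finite B" using that assms finite_subset[of B A] by auto
    then show "(\<Prod>k\<in>insert a B. p k) = p a * (\<Prod>k\<in>B. p k)" "insert a A - insert a B = A - B" "A - insert a B = A - B"
      using assms by auto
  qed
  have "bernoulli_mean p (insert a A) f
      = (\<Sum>B\<in>Pow A. (\<Prod>k\<in>B. p k) * (\<Prod>k\<in>insert a A - B. 1 - p k) * f B)
      + (\<Sum>B\<in>Pow A. (\<Prod>k\<in>insert a B. p k) * (\<Prod>k\<in>insert a A - insert a B. 1 - p k) * f (insert a B))"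
    unfolding bernoulli_mean_def Pow_insert
    using assms disj inj by (subst sum.union_disjoint) (auto simp: sum.reindex)
  also have "\<dots> = bernoulli_mean p A (\<lambda>B. p a * f (insert a B) + (1 - p a) * f B)"
    unfolding bernoulli_mean_def sum.distrib[symmetric]
    by (intro sum.cong refl) (simp add: * ** algebra_simps)
  finally show ?thesis .
qed

lemma bernoulli_mean_add: "bernoulli_mean p A (\<lambda>B. f B + g B) = bernoulli_mean p A f + bernoulli_mean p A g"
  and bernoulli_mean_cmult: "bernoulli_mean p A (\<lambda>B. c * f B) = c * bernoulli_mean p A f"
  by (simp_all add: bernoulli_mean_def algebra_simps sum.distrib sum_distrib_left)

lemma bernoulli_mean_sum: "bernoulli_mean p A (\<lambda>B. \<Sum>i\<in>I. f i B) = (\<Sum>i\<in>I. bernoulli_mean p A (f i))"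
  unfolding bernoulli_mean_def sum_distrib_left by (rule sum.swap)

lemma bernoulli_mean_mono:
  assumes "\<And>k. k \<in> A \<Longrightarrow> 0 \<le> p k \<and> p k \<le> 1" "\<And>B. B \<subseteq> A \<Longrightarrow> f B \<le> g B"
  shows "bernoulli_mean p A f \<le> bernoulli_mean p A g"
  unfolding bernoulli_mean_def using assms
  by (intro sum_mono mult_left_mono mult_nonneg_nonneg prod_nonneg) auto

lemma bernoulli_mean_abs:
  assumes "\<And>k. k \<in> A \<Longrightarrow> 0 \<le> p k \<and> p k \<le> 1"
  shows "\<bar>bernoulli_mean p A f\<bar> \<le> bernoulli_mean p A (\<lambda>B. \<bar>f B\<bar>)"
  using bernoulli_mean_mono[of A p f "\<lambda>B. \<bar>f B\<bar>"] bernoulli_mean_mono[of A p "\<lambda>B. (-1) * f B" "\<lambda>B. \<bar>f B\<bar>"] assms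
  by (simp only: bernoulli_mean_cmult) (auto simp: abs_le_iff)

lemma bernoulli_mean_cong: "(\<And>B. B \<subseteq> A \<Longrightarrow> f B = g B) \<Longrightarrow> bernoulli_mean p A f = bernoulli_mean p A g"
  unfolding bernoulli_mean_def by (intro sum.cong) auto

lemma bernoulli_mean_avoid:
  assumes "finite A"
  shows "bernoulli_mean p A (\<lambda>B. of_bool (B \<inter> U = {})) = (\<Prod>k\<in>A. if k \<in> U then 1 - p k else 1)"
  using assms
proof (induction A)
  case (insert a A)
  have "bernoulli_mean p (insert a A) (\<lambda>B. of_bool (B \<inter> U = {}))
     = bernoulli_mean p A (\<lambda>B. (if a \<in> U then 1 - p a else 1) * of_bool (B \<inter> U = {}))"
    unfolding bernoulli_mean_insert[OF insert(1,2)] by (intro bernoulli_mean_cong) auto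
  then show ?case using insert by (simp add: bernoulli_mean_cmult)
qed simp

text \<open>Law of total covariance: averaging out the indicator of \<open>a\<close> turns \<open>f\<close> into a function that
  satisfies the same kind of bound, with an extra factor \<open>1 - p a\<close> where \<open>a \<in> U k i\<close>.\<close>

lemma bernoulli_mean_covariance:
  fixes c :: "'k \<Rightarrow> 'i \<Rightarrow> real" and d :: "'k \<Rightarrow> 'j \<Rightarrow> real"
  assumes "finite A"
    and "\<And>k. k \<in> A \<Longrightarrow> 0 \<le> p k \<and> p k \<le> 1"
    and "\<And>k i. 0 \<le> c k i" "\<And>k j. 0 \<le> d k j"
    and "\<And>k B. k \<in> A \<Longrightarrow> B \<subseteq> A - {k} \<Longrightarrow>
      \<bar>f (insert k B) - f B\<bar> \<le> (\<Sum>i\<in>I. c k i * of_bool (B \<inter> U k i = {}))"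
    and "\<And>k B. k \<in> A \<Longrightarrow> B \<subseteq> A - {k} \<Longrightarrow>
      \<bar>g (insert k B) - g B\<bar> \<le> (\<Sum>j\<in>J. d k j * of_bool (B \<inter> V k j = {}))"
  shows "\<bar>bernoulli_mean p A (\<lambda>B. f B * g B) - bernoulli_mean p A f * bernoulli_mean p A g\<bar> \<le>
    (\<Sum>k\<in>A. p k * (1 - p k) * (\<Sum>i\<in>I. \<Sum>j\<in>J. c k i * d k j *
       (\<Prod>l\<in>A - {k}. if l \<in> U k i \<union> V k j then 1 - p l else 1)))"
  using assms
proof (induction A arbitrary: f g c d rule: finite_induct)
  case (insert a A)
  define p' where "p' = p a"
  have p': "0 \<le> p'" "p' \<le> 1" using insert.prems(1)[of a] by (auto simp: p'_def)
  have pA: "\<And>k. k \<in> A \<Longrightarrow> 0 \<le> p k \<and> p k \<le> 1" using insert.prems(1) by auto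
  define f' where "f' B = p' * f (insert a B) + (1 - p') * f B" for B
  define g' where "g' B = p' * g (insert a B) + (1 - p') * g B" for B
  \<comment> \<open>Probability that the indicator of \<open>a\<close> keeps the random set away
    from \<open>X\<close>. In \<open>w X * w Y \<le> w (X \<union> Y)\<close> the sides differ only
    if \<open>a\<close> lies in both sets; this is where \<open>U\<close> and \<open>V\<close> merge
    into one product.\<close>
  define w where "w X = (if a \<in> X then 1 - p' else 1)" for X :: "'k set"
  have w: "0 \<le> w X" "w X * w Y \<le> w (X \<union> Y)" for X Y
    using p' by (auto simp: w_def mult_left_le)
  define c' where "c' k i = c k i * w (U k i)" for k i
  define d' where "d' k j = d k j * w (V k j)" for k j
  have c'0: "0 \<le> c' k i" and d'0: "0 \<le> d' k j" for k i j
    using insert.prems(2,3) w by (auto simp: c'_def d'_def)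
  \<comment> \<open>Total covariance, conditioning on all indicators but that of \<open>a\<close>:
    the mean of the conditional covariances plus the covariance of the conditional means
    \<open>f'\<close> and \<open>g'\<close>. For a two-valued variable the former is p (1 - p) times
    the product of the increments.\<close>
  have split: "bernoulli_mean p (insert a A) (\<lambda>B. f B * g B) - bernoulli_mean p (insert a A) f * bernoulli_mean p (insert a A) g
     = p' * (1 - p') * bernoulli_mean p A (\<lambda>B. (f (insert a B) - f B) * (g (insert a B) - g B))
     + (bernoulli_mean p A (\<lambda>B. f' B * g' B) - bernoulli_mean p A f' * bernoulli_mean p A g')"
  proof -
    have "bernoulli_mean p (insert a A) (\<lambda>B. f B * g B) = bernoulli_mean p A (\<lambda>B. p' * (1 - p') *
        ((f (insert a B) - f B) * (g (insert a B) - g B)) + f' B * g' B)"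
      unfolding bernoulli_mean_insert[OF insert(1,2)] f'_def g'_def p'_def
      by (intro bernoulli_mean_cong) (simp add: algebra_simps)
    moreover have "bernoulli_mean p (insert a A) f = bernoulli_mean p A f'" "bernoulli_mean p (insert a A) g = bernoulli_mean p A g'"
      unfolding bernoulli_mean_insert[OF insert(1,2)] f'_def g'_def p'_def by simp_all
    ultimately show ?thesis by (simp add: bernoulli_mean_add bernoulli_mean_cmult)
  qed
  \<comment> \<open>Averaging over \<open>a\<close> commutes with taking the increment at
    \<open>k\<close>. The term for \<open>insert a B\<close> vanishes when \<open>a\<close> lies in
    \<open>W k i\<close>, and what remains is the weight \<open>w (W k i)\<close>. Stated for a
    general \<open>h\<close> because it serves both \<open>f\<close> and \<open>g\<close>.\<close>
  have avg: "\<bar>(p' * h (insert a (insert k B)) + (1 - p') * h (insert k B)) - (p' * h (insert a B) + (1 - p') * h B)\<bar>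
       \<le> (\<Sum>i\<in>I'. e k i * w (W k i) * of_bool (B \<inter> W k i = {}))"
    if *: "\<And>k B. k \<in> insert a A \<Longrightarrow> B \<subseteq> insert a A - {k} \<Longrightarrow>
       \<bar>h (insert k B) - h B\<bar> \<le> (\<Sum>i\<in>I'. e k i * of_bool (B \<inter> W k i = {}))"
      and k: "k \<in> A" and B: "B \<subseteq> A - {k}"
    for h :: "'k set \<Rightarrow> real" and I' :: "'z set" and e W k B
  proof -
    have "\<bar>h (insert k (insert a B)) - h (insert a B)\<bar> \<le> (\<Sum>i\<in>I'. e k i * of_bool (insert a B \<inter> W k i = {}))"
      using k B insert(2) by (intro *) auto
    moreover have "\<bar>h (insert k B) - h B\<bar> \<le> (\<Sum>i\<in>I'. e k i * of_bool (B \<inter> W k i = {}))"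
      using k B insert(2) by (intro *) auto
    moreover have "(p' * h (insert a (insert k B)) + (1 - p') * h (insert k B)) - (p' * h (insert a B) + (1 - p') * h B)
      = p' * (h (insert k (insert a B)) - h (insert a B)) + (1 - p') * (h (insert k B) - h B)"
      by (simp add: algebra_simps insert_commute)
    moreover have "\<bar>p' * (h (insert k (insert a B)) - h (insert a B)) + (1 - p') * (h (insert k B) - h B)\<bar>
      \<le> p' * \<bar>h (insert k (insert a B)) - h (insert a B)\<bar> + (1 - p') * \<bar>h (insert k B) - h B\<bar>"
      using p' by (intro order_trans[OF abs_triangle_ineq]) (simp add: abs_mult)
    ultimately have "\<bar>(p' * h (insert a (insert k B)) + (1 - p') * h (insert k B)) - (p' * h (insert a B) + (1 - p') * h B)\<bar>
      \<le> p' * (\<Sum>i\<in>I'. e k i * of_bool (insert a B \<inter> W k i = {})) + (1 - p') * (\<Sum>i\<in>I'. e k i * of_bool (B \<inter> W k i = {}))"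
      using p' by (smt (verit, best) mult_left_mono)
    also have "\<dots> = (\<Sum>i\<in>I'. e k i * w (W k i) * of_bool (B \<inter> W k i = {}))"
      unfolding sum_distrib_left sum.distrib[symmetric] by (intro sum.cong refl) (auto simp: w_def algebra_simps)
    finally show ?thesis .
  qed
  have IH: "\<bar>bernoulli_mean p A (\<lambda>B. f' B * g' B) - bernoulli_mean p A f' * bernoulli_mean p A g'\<bar> \<le>
    (\<Sum>k\<in>A. p k * (1 - p k) * (\<Sum>i\<in>I. \<Sum>j\<in>J. c' k i * d' k j *
       (\<Prod>l\<in>A - {k}. if l \<in> U k i \<union> V k j then 1 - p l else 1)))"
  proof (rule insert.IH[OF pA c'0 d'0])
    fix k B assume kB: "k \<in> A" "B \<subseteq> A - {k}"
    show "\<bar>f' (insert k B) - f' B\<bar> \<le> (\<Sum>i\<in>I. c' k i * of_bool (B \<inter> U k i = {}))"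
      unfolding f'_def c'_def by (rule avg[OF insert.prems(4) kB])
    show "\<bar>g' (insert k B) - g' B\<bar> \<le> (\<Sum>j\<in>J. d' k j * of_bool (B \<inter> V k j = {}))"
      unfolding g'_def d'_def by (rule avg[OF insert.prems(5) kB])
  qed
  also have "\<dots> \<le> (\<Sum>k\<in>A. p k * (1 - p k) * (\<Sum>i\<in>I. \<Sum>j\<in>J. c k i * d k j *
       (\<Prod>l\<in>insert a A - {k}. if l \<in> U k i \<union> V k j then 1 - p l else 1)))"
  proof (intro sum_mono mult_left_mono)
    fix k i j assume k: "k \<in> A"
    have eq: "insert a A - {k} = insert a (A - {k})" "a \<notin> A - {k}" using k insert(2) by auto
    have P: "0 \<le> (\<Prod>l\<in>A - {k}. if l \<in> U k i \<union> V k j then 1 - p l else 1)"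
      using pA by (intro prod_nonneg) auto
    have "c' k i * d' k j \<le> c k i * d k j * w (U k i \<union> V k j)"
      using mult_left_mono[OF w(2)[of "U k i" "V k j"], of "c k i * d k j"] insert.prems(2,3)
      by (simp add: c'_def d'_def mult_ac)
    from mult_right_mono[OF this P]
    show "c' k i * d' k j * (\<Prod>l\<in>A - {k}. if l \<in> U k i \<union> V k j then 1 - p l else 1)
      \<le> c k i * d k j * (\<Prod>l\<in>insert a A - {k}. if l \<in> U k i \<union> V k j then 1 - p l else 1)"
      unfolding eq(1) using insert(1) eq(2)
      by (subst prod.insert) (auto simp: w_def p'_def mult.assoc)
  qed (use pA in auto)
  finally have 2: "\<bar>bernoulli_mean p A (\<lambda>B. f' B * g' B) - bernoulli_mean p A f' * bernoulli_mean p A g'\<bar> \<le> \<dots>" .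
  \<comment> \<open>The summand for \<open>a\<close> itself: a pair (i, j) contributes only if the
    other indicators avoid both \<open>U a i\<close> and \<open>V a j\<close>, and the probability
    of that is the product over \<open>A\<close>.\<close>
  have "\<bar>bernoulli_mean p A (\<lambda>B. (f (insert a B) - f B) * (g (insert a B) - g B))\<bar>
     \<le> bernoulli_mean p A (\<lambda>B. \<bar>(f (insert a B) - f B) * (g (insert a B) - g B)\<bar>)"
    by (intro bernoulli_mean_abs pA)
  also have "\<dots> \<le> bernoulli_mean p A (\<lambda>B. \<Sum>i\<in>I. \<Sum>j\<in>J. c a i * d a j * of_bool (B \<inter> (U a i \<union> V a j) = {}))"
  proof (intro bernoulli_mean_mono pA)
    fix B assume "B \<subseteq> A"
    then have *: "B \<subseteq> insert a A - {a}" using insert(2) by auto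
    have "\<bar>(f (insert a B) - f B) * (g (insert a B) - g B)\<bar> \<le>
       (\<Sum>i\<in>I. c a i * of_bool (B \<inter> U a i = {})) * (\<Sum>j\<in>J. d a j * of_bool (B \<inter> V a j = {}))"
      unfolding abs_mult using * insert.prems(2,3)
      by (intro mult_mono insert.prems(4,5) sum_nonneg) auto
    also have "\<dots> = (\<Sum>i\<in>I. \<Sum>j\<in>J. c a i * d a j * of_bool (B \<inter> (U a i \<union> V a j) = {}))"
      unfolding sum_product by (intro sum.cong refl) (auto simp: Int_Un_distrib)
    finally show "\<bar>(f (insert a B) - f B) * (g (insert a B) - g B)\<bar> \<le> \<dots>" .
  qed
  also have "\<dots> = (\<Sum>i\<in>I. \<Sum>j\<in>J. c a i * d a j *
       (\<Prod>l\<in>insert a A - {a}. if l \<in> U a i \<union> V a j then 1 - p l else 1))"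
    using insert(1,2) by (simp only: bernoulli_mean_sum bernoulli_mean_cmult bernoulli_mean_avoid) simp
  finally have 1: "p' * (1 - p') * \<bar>bernoulli_mean p A (\<lambda>B. (f (insert a B) - f B) * (g (insert a B) - g B))\<bar>
     \<le> p' * (1 - p') * \<dots>" using p' by (intro mult_left_mono) auto
  have "\<bar>bernoulli_mean p (insert a A) (\<lambda>B. f B * g B) - bernoulli_mean p (insert a A) f * bernoulli_mean p (insert a A) g\<bar>
    \<le> p' * (1 - p') * \<bar>bernoulli_mean p A (\<lambda>B. (f (insert a B) - f B) * (g (insert a B) - g B))\<bar>
     + \<bar>bernoulli_mean p A (\<lambda>B. f' B * g' B) - bernoulli_mean p A f' * bernoulli_mean p A g'\<bar>"
    unfolding split using p' by (intro order_trans[OF abs_triangle_ineq]) (simp add: abs_mult)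
  with 1 2 show ?case
    unfolding sum.insert[OF insert(1,2)] p'_def[symmetric] by linarith
qed simp

section \<open>The Poisson process seen through finitely many cells\<close>

section \<open>Point configurations\<close>

lemma num_points_pos_iff: "0 < num_points c A \<longleftrightarrow> (\<exists>f\<in>A. 0 < c f)"
proof
  assume pos: "0 < num_points c A"
  show "\<exists>f\<in>A. 0 < c f"
  proof (rule ccontr)
    assume "\<not> (\<exists>f\<in>A. 0 < c f)"
    then have "num_points c A = 0" unfolding num_points_def by (intro infsum_0) auto
    with pos show False by simp
  qed
next
  assume "\<exists>f\<in>A. 0 < c f"
  then obtain f where f: "f \<in> A" "0 < c f" by blast
  have "0 < (of_nat (c f) :: ennreal)" using f by simp
  also have "(of_nat (c f) :: ennreal) = (\<Sum>f\<in>{f}. of_nat (c f))" by simp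
  also have "\<dots> \<le> num_points c A"
    unfolding num_points_def nonneg_infsum_complete[OF zero_le]
    using f by (intro SUP_upper) auto
  finally show "0 < num_points c A" .
qed

lemma num_points_finite:
  assumes "num_points c A < \<infinity>" shows "finite {f \<in> A. 0 < c f}"
proof (rule ccontr)
  assume inf: "infinite {f \<in> A. 0 < c f}"
  have "of_nat n \<le> num_points c A" for n
  proof -
    obtain F where F: "F \<subseteq> {f \<in> A. 0 < c f}" "finite F" "card F = n"
      using infinite_arbitrarily_large[OF inf] by blast
    have "(of_nat n :: ennreal) = (\<Sum>f\<in>F. 1)" using F by simp
    also have "\<dots> \<le> (\<Sum>f\<in>F. of_nat (c f))"
    proof (intro sum_mono)
      fix f assume "f \<in> F"
      then have "1 \<le> c f" using F by auto
      then show "1 \<le> (of_nat (c f) :: ennreal)" using of_nat_mono[of 1 "c f"] by simp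
    qed
    also have "\<dots> \<le> num_points c A"
      unfolding num_points_def nonneg_infsum_complete[OF zero_le]
      using F by (intro SUP_upper) auto
    finally show ?thesis .
  qed
  moreover obtain n where "num_points c A < of_nat n"
    using ennreal_Ex_less_of_nat[of "num_points c A"] assms by (auto simp: infinity_ennreal_def)
  ultimately show False using not_less by blast
qed

text \<open>Only finitely many points exceed level 1 at \<open>t\<close>, and all others stay at or
  below it. Without boundedness the real \<open>Sup\<close> in \<open>max_field\<close> would be
  arbitrary.\<close>

lemma configuration_bdd_above:
  assumes "configuration c"
  shows "bdd_above (insert 0 ((\<lambda>f. f t) ` {f. 0 < c f}))"
proof -
  have "num_points c {f \<in> C0. 1 < Max (f ` {t})} < \<infinity>"
    using conjunct2[OF assms[unfolded configuration_def], rule_format, of "{t}" 1] by simp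
  from num_points_finite[OF this] have fin: "finite {f \<in> C0. 1 < f t \<and> 0 < c f}"
    by (simp add: conj_assoc)
  have "(\<lambda>f. f t) ` {f. 0 < c f} \<subseteq> {..1} \<union> (\<lambda>f. f t) ` {f \<in> C0. 1 < f t \<and> 0 < c f}"
  proof (rule image_subsetI)
    fix f assume "f \<in> {f. 0 < c f}"
    moreover from this have "f \<in> C0" using assms by (auto simp: configuration_def)
    ultimately show "f t \<in> {..1} \<union> (\<lambda>f. f t) ` {f \<in> C0. 1 < f t \<and> 0 < c f}"
      by (cases "1 < f t") (auto intro!: imageI)
  qed
  moreover have "bdd_above ({..1} \<union> (\<lambda>f. f t) ` {f \<in> C0. 1 < f t \<and> 0 < c f})"
    using fin by (simp add: bdd_above_Un)
  ultimately show ?thesis unfolding bdd_above_insert by (rule bdd_above_mono[rotated])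
qed

lemma max_field_greater_iff:
  assumes "configuration c" "0 \<le> l"
  shows "l < max_field c t \<longleftrightarrow> (\<exists>f. 0 < c f \<and> l < f t)"
  using assms(2) unfolding max_field_def
  by (subst less_cSup_iff[OF _ configuration_bdd_above[OF assms(1)]]) auto

text \<open>Signatures turn maxima of functions into unions of sets.\<close>

definition signature :: "'s set \<Rightarrow> real set \<Rightarrow> ('s \<Rightarrow> real) \<Rightarrow> ('s \<times> real) set" where
  "signature S D f = {(s, l). s \<in> S \<and> l \<in> D \<and> l < f s}"

text \<open>A class of functions that the sites \<open>S\<close> and the levels \<open>D\<close>
  cannot tell apart. Different signatures give disjoint cells, so that the Poisson counts in them
  are independent.\<close>

definition cell :: "(int ^ 'd) set \<Rightarrow> real set \<Rightarrow> ((int ^ 'd) \<times> real) set \<Rightarrow> (int ^ 'd \<Rightarrow> real) set" where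
  "cell S D a = {f \<in> C0. signature S D f = a}"

lemma cell_disjoint: "a \<noteq> b \<Longrightarrow> cell S D a \<inter> cell S D b = {}"
  by (auto simp: cell_def)

lemma C0_nonneg: "f \<in> C0 \<Longrightarrow> 0 \<le> f t"
  by (simp add: C0_def)

section \<open>Stationary max-infinitely divisible fields\<close>

locale stationary_max_id = prob_space M for M :: "'w measure" +
  fixes \<mu> :: "(int ^ 'd \<Rightarrow> real) measure" and \<eta> :: "int ^ 'd \<Rightarrow> 'w \<Rightarrow> real"
    and \<Phi> :: "'w \<Rightarrow> (int ^ 'd \<Rightarrow> real) \<Rightarrow> nat"
  assumes exponent: "exponent_measure \<mu>"
    and ppp: "poisson_point_process M \<mu> \<Phi>"
    and field: "\<And>\<omega> t. \<omega> \<in> space M \<Longrightarrow> \<eta> t \<omega> = max_field (\<Phi> \<omega>) t"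
    and stationary: "stationary_field M \<eta>"
begin

lemma \<eta>_measurable [measurable]: "\<eta> t \<in> borel_measurable M"
  using stationary by (simp add: stationary_field_def random_field_def)

lemma sets_\<mu> [measurable_cong]: "sets \<mu> = sets (restrict_space borel C0)"
  using exponent by (simp add: exponent_measure_def)

lemma space_\<mu>: "space \<mu> = C0"
  using sets_eq_imp_space_eq[OF sets_\<mu>] by (simp add: space_restrict_space)

lemma eval_measurable [measurable]: "(\<lambda>f. f t) \<in> borel_measurable \<mu>"
proof -
  have "(\<lambda>f::int ^ 'd \<Rightarrow> real. f t) \<in> borel_measurable borel"
    by (intro borel_measurable_continuous_onI continuous_on_product_coordinates)
  then have "(\<lambda>f. f t) \<in> borel_measurable (restrict_space borel C0)"
    by (rule measurable_restrict_space1)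
  then show ?thesis by (simp add: measurable_cong_sets[OF sets_\<mu>])
qed

lemma finite_exceed: "0 < l \<Longrightarrow> emeasure \<mu> {f \<in> C0. l < f t} < \<infinity>"
proof -
  assume "0 < l"
  then have "emeasure \<mu> {f \<in> C0. l < Max (f ` {t})} < \<infinity>"
    using conjunct2[OF conjunct2[OF exponent[unfolded exponent_measure_def]], rule_format, of "{t}" l] by simp
  then show ?thesis by simp
qed

lemma exceed_iff:
  assumes "\<omega> \<in> space M" "0 \<le> l"
  shows "l < \<eta> t \<omega> \<longleftrightarrow> (\<exists>f\<in>C0. 0 < \<Phi> \<omega> f \<and> l < f t)"
proof -
  have c: "configuration (\<Phi> \<omega>)" using ppp assms by (simp add: poisson_point_process_def)
  then have "{f. 0 < \<Phi> \<omega> f} \<subseteq> C0" by (simp add: configuration_def)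
  then show ?thesis
    unfolding field[OF assms(1)] max_field_greater_iff[OF c assms(2)] by blast
qed

lemma \<eta>_nonneg:
  assumes "\<omega> \<in> space M" shows "0 \<le> \<eta> t \<omega>"
proof -
  have "configuration (\<Phi> \<omega>)" using ppp assms by (simp add: poisson_point_process_def)
  then show ?thesis unfolding field[OF assms] max_field_def
    by (intro cSup_upper configuration_bdd_above) auto
qed

lemma num_points_distributed:
  "A \<in> sets \<mu> \<Longrightarrow> poisson_distributed M (\<lambda>\<omega>. num_points (\<Phi> \<omega>) A) (emeasure \<mu> A)"
  using ppp by (simp add: poisson_point_process_def)

lemma num_points_measurable: "A \<in> sets \<mu> \<Longrightarrow> (\<lambda>\<omega>. num_points (\<Phi> \<omega>) A) \<in> borel_measurable M"
  using num_points_distributed by (simp add: poisson_distributed_def)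

lemma prob_void:
  assumes "A \<in> sets \<mu>" "emeasure \<mu> A < \<infinity>"
  shows "prob {\<omega> \<in> space M. num_points (\<Phi> \<omega>) A = 0} = exp (- measure \<mu> A)"
proof -
  have "\<forall>k::nat. prob {\<omega> \<in> space M. num_points (\<Phi> \<omega>) A = of_nat k}
         = enn2real (emeasure \<mu> A) ^ k / fact k * exp (- enn2real (emeasure \<mu> A))"
    using num_points_distributed[OF assms(1)] assms(2) unfolding poisson_distributed_def
    by (auto split: if_splits)
  from spec[OF this, of 0] show ?thesis by (simp add: measure_def)
qed

end

section \<open>Discretisation\<close>

locale discretized_field = stationary_max_id M \<mu> \<eta> \<Phi>
  for M :: "'w measure" and \<mu> :: "(int ^ 'd \<Rightarrow> real) measure" and \<eta> \<Phi> +
  fixes S :: "(int ^ 'd) set" and D :: "real set"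
  assumes fin_S: "finite S" and fin_D: "finite D" and pos_D: "\<And>l. l \<in> D \<Longrightarrow> 0 < l"
begin

text \<open>The empty signature is left out: it adds nothing to a union, and its cell may have
  infinite mass. Any other cell lies in some set \<open>{f \<in> C0. l < f s}\<close> with
  \<open>0 < l\<close>, whose mass is finite.\<close>

definition cells where "cells = Pow (S \<times> D) - {{}}"

definition hit_prob where "hit_prob a = 1 - exp (- measure \<mu> (cell S D a))"

definition hits where "hits \<omega> = {a \<in> cells. 0 < num_points (\<Phi> \<omega>) (cell S D a)}"

lemma finite_cells: "finite cells"
  unfolding cells_def using fin_S fin_D by auto

lemma hit_prob: "0 \<le> hit_prob a" "hit_prob a \<le> 1"
  by (simp_all add: hit_prob_def)

text \<open>A supremum strictly exceeds a level exactly when one of its members does. Hence what the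
  grid sees of the field is a function of the random set of hit cells, and
  \<open>bernoulli_mean\<close> computes its expectations.\<close>

lemma signature_field:
  assumes "\<omega> \<in> space M"
  shows "signature S D (\<lambda>s. \<eta> s \<omega>) = \<Union>(hits \<omega>)"
proof (intro set_eqI iffI)
  fix x assume "x \<in> signature S D (\<lambda>s. \<eta> s \<omega>)"
  then obtain s l where x: "x = (s, l)" "s \<in> S" "l \<in> D" "l < \<eta> s \<omega>" by (auto simp: signature_def)
  then obtain f where f: "f \<in> C0" "0 < \<Phi> \<omega> f" "l < f s"
    using exceed_iff[OF assms, of l s] pos_D[of l] by auto
  let ?a = "signature S D f"
  have "x \<in> ?a" using f x by (auto simp: signature_def)
  moreover have "?a \<in> hits \<omega>"
    using f x \<open>x \<in> ?a\<close> unfolding hits_def num_points_pos_iff cells_def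
    by (auto simp: cell_def signature_def)
  ultimately show "x \<in> \<Union>(hits \<omega>)" by blast
next
  fix x assume "x \<in> \<Union>(hits \<omega>)"
  then obtain f where f: "f \<in> C0" "0 < \<Phi> \<omega> f" "x \<in> signature S D f"
    unfolding hits_def num_points_pos_iff by (auto simp: cell_def)
  then obtain s l where x: "x = (s, l)" "s \<in> S" "l \<in> D" "l < f s" by (auto simp: signature_def)
  then have "l < \<eta> s \<omega>" using exceed_iff[OF assms, of l s] pos_D[of l] f by auto
  then show "x \<in> signature S D (\<lambda>s. \<eta> s \<omega>)" using x by (auto simp: signature_def)
qed

lemma cell_measurable: "cell S D a \<in> sets \<mu>"
proof -
  have "signature S D f = a \<longleftrightarrow> (\<forall>s\<in>S. \<forall>l\<in>D. l < f s \<longleftrightarrow> (s, l) \<in> a) \<and> a \<subseteq> S \<times> D" for f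
    unfolding signature_def set_eq_iff split_paired_All by auto
  then have "cell S D a = {f \<in> space \<mu>. (\<forall>s\<in>S. \<forall>l\<in>D. l < f s \<longleftrightarrow> (s, l) \<in> a) \<and> a \<subseteq> S \<times> D}"
    by (simp add: cell_def space_\<mu>)
  also have "\<dots> \<in> sets \<mu>"
    using fin_S fin_D by measurable
  finally show ?thesis .
qed

lemma cell_finite: "a \<in> cells \<Longrightarrow> emeasure \<mu> (cell S D a) < \<infinity>"
proof -
  assume "a \<in> cells"
  then obtain s l where sl: "(s, l) \<in> a" "s \<in> S" "l \<in> D" unfolding cells_def by auto
  have "cell S D a \<subseteq> {f \<in> space \<mu>. l < f s}"
    using sl by (auto simp: cell_def signature_def space_\<mu>)
  then have "emeasure \<mu> (cell S D a) \<le> emeasure \<mu> {f \<in> space \<mu>. l < f s}"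
    by (intro emeasure_mono) auto
  also have "\<dots> < \<infinity>" using finite_exceed[OF pos_D[OF sl(3)]] by (simp add: space_\<mu>)
  finally show ?thesis .
qed

lemma hits_measurable [measurable]: "{\<omega> \<in> space M. hits \<omega> = B} \<in> sets M"
proof -
  have [measurable]: "(\<lambda>\<omega>. num_points (\<Phi> \<omega>) (cell S D a)) \<in> borel_measurable M" for a
    by (intro num_points_measurable cell_measurable)
  have "{\<omega> \<in> space M. hits \<omega> = B} =
     {\<omega> \<in> space M. \<forall>a\<in>cells. a \<in> B \<longleftrightarrow> 0 < num_points (\<Phi> \<omega>) (cell S D a)} \<inter> (if B \<subseteq> cells then space M else {})"
    unfolding hits_def by auto
  moreover have "{\<omega> \<in> space M. \<forall>a\<in>cells. a \<in> B \<longleftrightarrow> 0 < num_points (\<Phi> \<omega>) (cell S D a)} \<in> sets M"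
    using finite_cells by measurable
  ultimately show ?thesis by auto
qed

text \<open>Counts in disjoint cells are independent, and a cell of mass x is empty with probability
  exp (- x). The set of hit cells is thus the random subset behind
  \<open>bernoulli_mean\<close>.\<close>

lemma prob_hits:
  assumes "B \<subseteq> cells"
  shows "prob {\<omega> \<in> space M. hits \<omega> = B} = (\<Prod>a\<in>B. hit_prob a) * (\<Prod>a\<in>cells - B. 1 - hit_prob a)"
\<comment> \<open>The product formula for independent variables asks for a nonempty index
  set.\<close>
proof (cases "cells = {}")
  case True
  then show ?thesis using assms prob_space by (simp add: hits_def)
next
  case False
  have ne: "{..<card cells} \<noteq> {}" using False finite_cells by (auto simp: lessThan_empty_iff)
  obtain h where h: "bij_betw h {..<card cells} cells"
    using ex_bij_betw_nat_finite[OF finite_cells] by (auto simp: atLeast0LessThan)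
  let ?N = "\<lambda>i \<omega>. num_points (\<Phi> \<omega>) (cell S D (h i))"
  have hi: "h i \<in> cells" if "i < card cells" for i using h that by (auto simp: bij_betw_def)
  have "disjoint_family_on (\<lambda>i. cell S D (h i)) {..<card cells}"
    using h unfolding disjoint_family_on_def bij_betw_def inj_on_def
    by (metis cell_disjoint)
  then have ind: "indep_vars (\<lambda>_. borel) ?N {..<card cells}"
    using ppp cell_measurable unfolding poisson_point_process_def by auto
  define Y where "Y i = (if h i \<in> B then {0<..} else {0} :: ennreal set)" for i
  have "{\<omega> \<in> space M. hits \<omega> = B} = (\<Inter>i\<in>{..<card cells}. ?N i -` Y i \<inter> space M)"
  proof (intro set_eqI)
    fix \<omega>
    have "hits \<omega> = B \<longleftrightarrow> (\<forall>a\<in>cells. a \<in> B \<longleftrightarrow> 0 < num_points (\<Phi> \<omega>) (cell S D a))"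
      using assms unfolding hits_def by auto
    also have "\<dots> \<longleftrightarrow> (\<forall>i<card cells. h i \<in> B \<longleftrightarrow> 0 < ?N i \<omega>)"
    proof -
      have "cells = h ` {..<card cells}" using h by (simp add: bij_betw_def)
      then have "(\<forall>a\<in>cells. a \<in> B \<longleftrightarrow> 0 < num_points (\<Phi> \<omega>) (cell S D a))
        \<longleftrightarrow> (\<forall>a\<in>h ` {..<card cells}. a \<in> B \<longleftrightarrow> 0 < num_points (\<Phi> \<omega>) (cell S D a))"
        by simp
      then show ?thesis by auto
    qed
    also have "\<dots> \<longleftrightarrow> (\<forall>i<card cells. ?N i \<omega> \<in> Y i)"
      unfolding Y_def by (auto simp: not_less)
    finally show "\<omega> \<in> {\<omega> \<in> space M. hits \<omega> = B} \<longleftrightarrow> \<omega> \<in> (\<Inter>i\<in>{..<card cells}. ?N i -` Y i \<inter> space M)"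
      using ne by auto
  qed
  also have "prob \<dots> = (\<Prod>i\<in>{..<card cells}. prob (?N i -` Y i \<inter> space M))"
    using ne by (intro indep_varsD[OF ind]) (auto simp: Y_def)
  also have "\<dots> = (\<Prod>i\<in>{..<card cells}. if h i \<in> B then hit_prob (h i) else 1 - hit_prob (h i))"
  proof (intro prod.cong refl)
    fix i assume i: "i \<in> {..<card cells}"
    have [measurable]: "?N i \<in> borel_measurable M" by (intro num_points_measurable cell_measurable)
    have v: "prob {\<omega> \<in> space M. ?N i \<omega> = 0} = 1 - hit_prob (h i)"
      using prob_void[OF cell_measurable cell_finite[OF hi]] i by (simp add: hit_prob_def)
    have "{\<omega> \<in> space M. 0 < ?N i \<omega>} = space M - {\<omega> \<in> space M. ?N i \<omega> = 0}"
      by (auto simp: zero_less_iff_neq_zero)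
    also have "prob \<dots> = 1 - prob {\<omega> \<in> space M. ?N i \<omega> = 0}"
      by (intro prob_compl) measurable
    finally have "prob {\<omega> \<in> space M. 0 < ?N i \<omega>} = hit_prob (h i)" using v by simp
    then show "prob (?N i -` Y i \<inter> space M) = (if h i \<in> B then hit_prob (h i) else 1 - hit_prob (h i))"
      using v by (auto simp: Y_def vimage_def Int_def conj_commute)
  qed
  also have "\<dots> = (\<Prod>a\<in>cells. if a \<in> B then hit_prob a else 1 - hit_prob a)"
    by (rule prod.reindex_bij_betw[OF h])
  also have "\<dots> = (\<Prod>a\<in>B. hit_prob a) * (\<Prod>a\<in>cells - B. 1 - hit_prob a)"
    using assms finite_cells by (simp add: prod.If_cases Int_absorb1 Diff_eq)
  finally show ?thesis .
qed

lemma expectation_hits: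
  shows "integrable M (\<lambda>\<omega>. F (hits \<omega>) :: real)"
    and "expectation (\<lambda>\<omega>. F (hits \<omega>)) = bernoulli_mean hit_prob cells F"
proof -
  have eq: "F (hits \<omega>) = (\<Sum>B\<in>Pow cells. F B * indicator {\<omega> \<in> space M. hits \<omega> = B} \<omega>)"
    if "\<omega> \<in> space M" for \<omega>
  proof -
    have "(\<Sum>B\<in>Pow cells. F B * indicator {\<omega> \<in> space M. hits \<omega> = B} \<omega>)
      = (\<Sum>B\<in>Pow cells. if hits \<omega> = B then F B else 0)"
      using that by (intro sum.cong) auto
    also have "\<dots> = F (hits \<omega>)" using finite_cells by (simp add: hits_def)
    finally show ?thesis by simp
  qed
  have int: "integrable M (\<lambda>\<omega>. F B * indicator {\<omega> \<in> space M. hits \<omega> = B} \<omega>)" for B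
    by (intro integrable_mult_right integrable_real_indicator) (auto simp: emeasure_eq_measure)
  show "integrable M (\<lambda>\<omega>. F (hits \<omega>))"
    by (subst Bochner_Integration.integrable_cong[OF refl eq]) (auto intro!: int)
  have "expectation (\<lambda>\<omega>. F (hits \<omega>)) = (\<Sum>B\<in>Pow cells. F B * prob {\<omega> \<in> space M. hits \<omega> = B})"
    by (subst Bochner_Integration.integral_cong[OF refl eq])
       (auto simp: Bochner_Integration.integral_sum[OF int])
  also have "\<dots> = bernoulli_mean hit_prob cells F"
    unfolding bernoulli_mean_def by (intro sum.cong refl) (simp add: prob_hits)
  finally show "expectation (\<lambda>\<omega>. F (hits \<omega>)) = bernoulli_mean hit_prob cells F" .
qed

end

section \<open>The covariance inequality for discretised fields\<close>

context stationary_max_id begin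

text \<open>Functions vanishing at \<open>s\<close> or \<open>s'\<close> are left out because stationarity of the field says nothing
  about the mass that \<open>\<mu>\<close> gives to functions vanishing at both sites.\<close>

definition pair_coeff :: "int ^ 'd \<Rightarrow> int ^ 'd \<Rightarrow> ennreal" where
  "pair_coeff s s' = (\<integral>\<^sup>+f. indicator {f. 0 < f s \<and> 0 < f s'} f *
     emeasure M {\<omega> \<in> space M. \<eta> s \<omega> \<le> f s \<and> \<eta> s' \<omega> \<le> f s'} \<partial>\<mu>)"

lemma joint_cdf_measurable:
  "(\<lambda>(x, y). emeasure M {\<omega> \<in> space M. \<eta> s \<omega> \<le> x \<and> \<eta> s' \<omega> \<le> y}) \<in> borel_measurable (borel \<Otimes>\<^sub>M borel)"
proof -
  have "(\<lambda>z. emeasure M {\<omega> \<in> space M. \<eta> s \<omega> \<le> fst z \<and> \<eta> s' \<omega> \<le> snd z}) \<in> borel_measurable (borel \<Otimes>\<^sub>M borel)"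
    by measurable
  then show ?thesis by (simp add: case_prod_unfold)
qed

end

context discretized_field begin

text \<open>A point above \<open>f\<close> at \<open>s\<close> exceeds there every level that
  \<open>f\<close> exceeds, so its signature is one of those in the product; it is nonempty because
  \<open>k\<close> has a level at \<open>s\<close>. If all these cells are void, nothing overtakes
  \<open>f\<close> at \<open>s\<close> or at \<open>s'\<close>. The cell \<open>k\<close> itself is
  among them, since another function of the same cell may lie above \<open>f\<close>.\<close>

lemma prob_no_overtaking:
  assumes k: "k \<in> cells" and f: "f \<in> cell S D k"
    and s: "\<exists>l. (s, l) \<in> k" and s': "\<exists>l. (s', l) \<in> k"
  shows "(\<Prod>b\<in>{b \<in> cells. {l. (s, l) \<in> k} \<subseteq> {l. (s, l) \<in> b} \<or> {l. (s', l) \<in> k} \<subseteq> {l. (s', l) \<in> b}}. 1 - hit_prob b)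
    \<le> prob {\<omega> \<in> space M. \<eta> s \<omega> \<le> f s \<and> \<eta> s' \<omega> \<le> f s'}"
proof -
  define W where "W = {b \<in> cells. {l. (s, l) \<in> k} \<subseteq> {l. (s, l) \<in> b} \<or> {l. (s', l) \<in> k} \<subseteq> {l. (s', l) \<in> b}}"
  define E where "E = (\<Union>b\<in>W. cell S D b)"
  have W: "finite W" "W \<subseteq> cells" using finite_cells by (auto simp: W_def)
  have E: "E \<in> sets \<mu>" unfolding E_def using W cell_measurable by auto
  have Efin: "emeasure \<mu> (cell S D b) \<noteq> \<infinity>" if "b \<in> W" for b
    using cell_finite[of b] W that by auto
  have meas: "measure \<mu> E = (\<Sum>b\<in>W. measure \<mu> (cell S D b))"
    unfolding E_def using W cell_measurable Efin
    by (intro measure_finite_Union) (auto simp: disjoint_family_on_def cell_disjoint)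
  have "emeasure \<mu> E \<le> (\<Sum>b\<in>W. emeasure \<mu> (cell S D b))"
    unfolding E_def using W cell_measurable by (intro emeasure_subadditive_finite) auto
  also have "\<dots> < \<infinity>" using W cell_finite by (auto simp: ennreal_sum_less_top)
  finally have fin: "emeasure \<mu> E < \<infinity>" .
  have "(\<Prod>b\<in>W. 1 - hit_prob b) = exp (- measure \<mu> E)"
    unfolding meas hit_prob_def using W by (simp add: exp_sum sum_negf[symmetric])
  also have "\<dots> = prob {\<omega> \<in> space M. num_points (\<Phi> \<omega>) E = 0}"
    using prob_void[OF E fin] by simp
  also have "\<dots> \<le> prob {\<omega> \<in> space M. \<eta> s \<omega> \<le> f s \<and> \<eta> s' \<omega> \<le> f s'}"
  proof (intro finite_measure_mono subsetI)
    fix \<omega> assume \<omega>: "\<omega> \<in> {\<omega> \<in> space M. num_points (\<Phi> \<omega>) E = 0}"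
    have fC: "f \<in> C0" and sig: "signature S D f = k" using f by (auto simp: cell_def)
    have "\<eta> t \<omega> \<le> f t" if t: "t \<in> {s, s'}" for t
    proof (rule ccontr)
      assume "\<not> \<eta> t \<omega> \<le> f t"
      then obtain f' where f': "f' \<in> C0" "0 < \<Phi> \<omega> f'" "f t < f' t"
        using exceed_iff[of \<omega> "f t" t] C0_nonneg[OF fC, of t] \<omega> by auto
      let ?b = "signature S D f'"
      have sub: "{l. (t, l) \<in> k} \<subseteq> {l. (t, l) \<in> ?b}"
        using f'(3) unfolding sig[symmetric] by (auto simp: signature_def)
      obtain l where "(t, l) \<in> k" using t s s' by auto
      with sub have "?b \<noteq> {}" by auto
      moreover have "?b \<subseteq> S \<times> D" by (auto simp: signature_def)
      ultimately have "?b \<in> W" using sub t unfolding W_def cells_def by auto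
      then have "f' \<in> E" unfolding E_def using f' by (auto simp: cell_def)
      then have "0 < num_points (\<Phi> \<omega>) E" using f' by (auto simp: num_points_pos_iff)
      then show False using \<omega> by simp
    qed
    then show "\<omega> \<in> {\<omega> \<in> space M. \<eta> s \<omega> \<le> f s \<and> \<eta> s' \<omega> \<le> f s'}" using \<omega> by auto
  qed measurable
  finally show ?thesis by (simp add: W_def)
qed

text \<open>The factor \<open>1 - hit_prob k\<close> of the variance is exactly the one missing from
  the product over \<open>cells - {k}\<close>. The completed product is at most the integrand at
  each \<open>f\<close> of the cell, and \<open>hit_prob k\<close> is at most the mass of the cell
  because 1 - exp (- x) \<le> x.\<close>

lemma cell_weight_le:
  assumes k: "k \<in> cells" and s: "\<exists>l. (s, l) \<in> k" and s': "\<exists>l. (s', l) \<in> k"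
  shows "ennreal (hit_prob k * (1 - hit_prob k) * (\<Prod>b\<in>cells - {k}.
      if {l. (s, l) \<in> k} \<subseteq> {l. (s, l) \<in> b} \<or> {l. (s', l) \<in> k} \<subseteq> {l. (s', l) \<in> b} then 1 - hit_prob b else 1))
    \<le> (\<integral>\<^sup>+f\<in>cell S D k. indicator {f. 0 < f s \<and> 0 < f s'} f *
     emeasure M {\<omega> \<in> space M. \<eta> s \<omega> \<le> f s \<and> \<eta> s' \<omega> \<le> f s'} \<partial>\<mu>)"
proof -
  let ?Q = "\<lambda>b. {l. (s, l) \<in> k} \<subseteq> {l. (s, l) \<in> b} \<or> {l. (s', l) \<in> k} \<subseteq> {l. (s', l) \<in> b}"
  define R where "R = (\<Prod>b\<in>{b \<in> cells. ?Q b}. 1 - hit_prob b)"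
  have "(1 - hit_prob k) * (\<Prod>b\<in>cells - {k}. if ?Q b then 1 - hit_prob b else 1)
     = (\<Prod>b\<in>cells. if ?Q b then 1 - hit_prob b else 1)"
    using k finite_cells by (subst prod.remove[of cells k]) auto
  also have "\<dots> = R" unfolding R_def using finite_cells by (rule prod.inter_filter[symmetric])
  finally have eq: "hit_prob k * (1 - hit_prob k) * (\<Prod>b\<in>cells - {k}. if ?Q b then 1 - hit_prob b else 1) = hit_prob k * R"
    by (simp add: mult.assoc)
  have R0: "0 \<le> R" unfolding R_def using hit_prob by (intro prod_nonneg) auto
  have "hit_prob k \<le> measure \<mu> (cell S D k)"
    using exp_ge_add_one_self[of "- measure \<mu> (cell S D k)"] by (simp add: hit_prob_def)
  then have "ennreal (hit_prob k * R) \<le> ennreal (measure \<mu> (cell S D k)) * ennreal R"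
    using R0 hit_prob(1)[of k] by (simp flip: ennreal_mult' add: mult_right_mono ennreal_leI)
  also have "\<dots> = (\<integral>\<^sup>+f\<in>cell S D k. ennreal R \<partial>\<mu>)"
    using cell_finite[OF k] cell_measurable[of k]
    by (simp add: nn_integral_cmult_indicator emeasure_eq_ennreal_measure mult.commute)
  also have "\<dots> \<le> (\<integral>\<^sup>+f\<in>cell S D k. indicator {f. 0 < f s \<and> 0 < f s'} f *
     emeasure M {\<omega> \<in> space M. \<eta> s \<omega> \<le> f s \<and> \<eta> s' \<omega> \<le> f s'} \<partial>\<mu>)"
  proof (intro nn_integral_mono)
    fix f
    show "ennreal R * indicator (cell S D k) f \<le> indicator {f. 0 < f s \<and> 0 < f s'} f *
       emeasure M {\<omega> \<in> space M. \<eta> s \<omega> \<le> f s \<and> \<eta> s' \<omega> \<le> f s'} * indicator (cell S D k) f"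
    proof (cases "f \<in> cell S D k")
      case True
      then have sig: "signature S D f = k" by (simp add: cell_def)
      \<comment> \<open>Levels are positive, so a level exceeded at a site makes \<open>f\<close>
        positive there, and the indicator in the integrand is 1 on the whole cell.\<close>
      have "0 < f t" if "\<exists>l. (t, l) \<in> k" for t
        using that pos_D unfolding sig[symmetric] by (force simp: signature_def)
      then have "0 < f s" "0 < f s'" using s s' by auto
      then show ?thesis
        using prob_no_overtaking[OF k True s s'] True
        by (simp add: R_def emeasure_eq_measure ennreal_leI)
    qed simp
  qed
  finally show ?thesis unfolding eq .
qed

lemma sum_cells_le: "(\<Sum>k\<in>cells. \<integral>\<^sup>+f\<in>cell S D k. indicator {f. 0 < f s \<and> 0 < f s'} f *
     emeasure M {\<omega> \<in> space M. \<eta> s \<omega> \<le> f s \<and> \<eta> s' \<omega> \<le> f s'} \<partial>\<mu>) \<le> pair_coeff s s'"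
proof -
  define g where "g f = indicator {f. 0 < f s \<and> 0 < f s'} f *
     emeasure M {\<omega> \<in> space M. \<eta> s \<omega> \<le> f s \<and> \<eta> s' \<omega> \<le> f s'}" for f
  have 1: "(\<lambda>f. emeasure M {\<omega> \<in> space M. \<eta> s \<omega> \<le> f s \<and> \<eta> s' \<omega> \<le> f s'}) \<in> borel_measurable \<mu>"
    using measurable_compose[OF _ joint_cdf_measurable, of "\<lambda>f. (f s, f s')" \<mu> s s'] by simp
  have "{f \<in> space \<mu>. 0 < f s \<and> 0 < f s'} \<in> sets \<mu>" by measurable
  then have "(indicator {f \<in> space \<mu>. 0 < f s \<and> 0 < f s'} :: _ \<Rightarrow> ennreal) \<in> borel_measurable \<mu>"
    by (rule borel_measurable_indicator)
  then have 2: "(indicator {f. 0 < f s \<and> 0 < f s'} :: _ \<Rightarrow> ennreal) \<in> borel_measurable \<mu>"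
    by (rule measurable_cong[THEN iffD1, rotated]) (simp add: indicator_def)
  have g: "g \<in> borel_measurable \<mu>"
    unfolding g_def by (intro borel_measurable_times_ennreal 1 2)
  have "(\<Sum>k\<in>cells. \<integral>\<^sup>+f\<in>cell S D k. g f \<partial>\<mu>) = (\<integral>\<^sup>+f. (\<Sum>k\<in>cells. g f * indicator (cell S D k) f) \<partial>\<mu>)"
    by (intro nn_integral_sum[symmetric] borel_measurable_times_ennreal g borel_measurable_indicator cell_measurable)
  also have "\<dots> \<le> (\<integral>\<^sup>+f. g f \<partial>\<mu>)"
  proof (intro nn_integral_mono)
    fix f
    have "(\<Sum>k\<in>cells. indicator (cell S D k) f :: ennreal) = (\<Sum>k\<in>cells. if k = signature S D f then indicator C0 f else 0)"
      by (intro sum.cong) (auto simp: cell_def indicator_def)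
    also have "\<dots> \<le> 1" using finite_cells by (auto simp: indicator_def)
    finally have "g f * (\<Sum>k\<in>cells. indicator (cell S D k) f) \<le> g f * 1"
      by (intro mult_left_mono) auto
    then show "(\<Sum>k\<in>cells. g f * indicator (cell S D k) f) \<le> g f"
      by (simp add: sum_distrib_left)
  qed
  finally show ?thesis unfolding g_def pair_coeff_def .
qed

text \<open>Both functionals are functions of the union of the hit signatures. A cell
  \<open>k\<close> acts at the site \<open>u i\<close> only if no other hit cell already contains
  its levels there, so \<open>bernoulli_mean_covariance\<close> applies with \<open>U k i\<close>
  the cells that do. \<open>cell_weight_le\<close> then bounds each product by an integral over the
  cell \<open>k\<close>.\<close>

proposition covariance_signature:
  fixes c :: "'i \<Rightarrow> real" and d :: "'j \<Rightarrow> real" and \<phi> \<psi> :: "((int ^ 'd) \<times> real) set \<Rightarrow> real"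
  assumes "finite I" "finite J" "\<And>i. 0 \<le> c i" "\<And>j. 0 \<le> d j"
    and \<phi>: "\<And>w w'. w \<subseteq> S \<times> D \<Longrightarrow> w' \<subseteq> S \<times> D \<Longrightarrow>
      \<bar>\<phi> (w \<union> w') - \<phi> w\<bar> \<le> (\<Sum>i\<in>I. c i * of_bool (\<exists>l. (u i, l) \<in> w' - w))"
    and \<psi>: "\<And>w w'. w \<subseteq> S \<times> D \<Longrightarrow> w' \<subseteq> S \<times> D \<Longrightarrow>
      \<bar>\<psi> (w \<union> w') - \<psi> w\<bar> \<le> (\<Sum>j\<in>J. d j * of_bool (\<exists>l. (v j, l) \<in> w' - w))"
  defines "F \<equiv> \<lambda>\<omega>. \<phi> (signature S D (\<lambda>s. \<eta> s \<omega>))" and "G \<equiv> \<lambda>\<omega>. \<psi> (signature S D (\<lambda>s. \<eta> s \<omega>))"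
  shows "ennreal \<bar>expectation (\<lambda>\<omega>. F \<omega> * G \<omega>) - expectation F * expectation G\<bar>
    \<le> (\<Sum>i\<in>I. \<Sum>j\<in>J. ennreal (c i * d j) * pair_coeff (u i) (v j))"
    and "integrable M F" and "integrable M G"
proof -
  have F: "F \<omega> = \<phi> (\<Union>(hits \<omega>))" and G: "G \<omega> = \<psi> (\<Union>(hits \<omega>))" if "\<omega> \<in> space M" for \<omega>
    using signature_field[OF that] by (simp_all add: F_def G_def)
  have EF: "expectation F = bernoulli_mean hit_prob cells (\<lambda>B. \<phi> (\<Union>B))"
    using expectation_hits(2)[of "\<lambda>B. \<phi> (\<Union>B)"] by (simp add: F cong: Bochner_Integration.integral_cong)
  have EG: "expectation G = bernoulli_mean hit_prob cells (\<lambda>B. \<psi> (\<Union>B))"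
    using expectation_hits(2)[of "\<lambda>B. \<psi> (\<Union>B)"] by (simp add: G cong: Bochner_Integration.integral_cong)
  have EFG: "expectation (\<lambda>\<omega>. F \<omega> * G \<omega>) = bernoulli_mean hit_prob cells (\<lambda>B. \<phi> (\<Union>B) * \<psi> (\<Union>B))"
    using expectation_hits(2)[of "\<lambda>B. \<phi> (\<Union>B) * \<psi> (\<Union>B)"]
    by (simp add: F G cong: Bochner_Integration.integral_cong)
  show "integrable M F" "integrable M G"
    using expectation_hits(1)[of "\<lambda>B. \<phi> (\<Union>B)"] expectation_hits(1)[of "\<lambda>B. \<psi> (\<Union>B)"]
    by (simp_all add: F G cong: Bochner_Integration.integrable_cong)
  define slice where "slice x k = {l. (x, l) \<in> k}" for x :: "int ^ 'd" and k :: "((int ^ 'd) \<times> real) set"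
  have osc: "\<bar>h (\<Union>(insert k B)) - h (\<Union>B)\<bar>
      \<le> (\<Sum>i\<in>I'. e i * of_bool (slice (x i) k \<noteq> {}) * of_bool (B \<inter> {b. slice (x i) k \<subseteq> slice (x i) b} = {}))"
    if h: "\<And>w w'. w \<subseteq> S \<times> D \<Longrightarrow> w' \<subseteq> S \<times> D \<Longrightarrow> \<bar>h (w \<union> w') - h w\<bar> \<le> (\<Sum>i\<in>I'. e i * of_bool (\<exists>l. (x i, l) \<in> w' - w))"
      and e: "\<And>i. 0 \<le> e i" and k: "k \<in> cells" and B: "B \<subseteq> cells - {k}"
    for h :: "_ \<Rightarrow> real" and I' :: "'z set" and e x k B
  proof -
    have "\<bar>h (\<Union>B \<union> k) - h (\<Union>B)\<bar> \<le> (\<Sum>i\<in>I'. e i * of_bool (\<exists>l. (x i, l) \<in> k - \<Union>B))"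
      using k B by (intro h) (auto simp: cells_def)
    also have "\<dots> \<le> (\<Sum>i\<in>I'. e i * of_bool (slice (x i) k \<noteq> {}) * of_bool (B \<inter> {b. slice (x i) k \<subseteq> slice (x i) b} = {}))"
    proof (intro sum_mono)
      fix i
      have "(\<exists>l. (x i, l) \<in> k - \<Union>B) \<Longrightarrow> slice (x i) k \<noteq> {} \<and> B \<inter> {b. slice (x i) k \<subseteq> slice (x i) b} = {}"
        unfolding slice_def by blast
      then show "e i * of_bool (\<exists>l. (x i, l) \<in> k - \<Union>B) \<le>
         e i * of_bool (slice (x i) k \<noteq> {}) * of_bool (B \<inter> {b. slice (x i) k \<subseteq> slice (x i) b} = {})"
        using e[of i] by (cases "\<exists>l. (x i, l) \<in> k - \<Union>B") simp_all
    qed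
    finally show ?thesis by (simp add: Un_commute)
  qed
  define c' where "c' k i = c i * of_bool (slice (u i) k \<noteq> {})" for k i
  define d' where "d' k j = d j * of_bool (slice (v j) k \<noteq> {})" for k j
  define U where "U k i = {b. slice (u i) k \<subseteq> slice (u i) b}" for k i
  define V where "V k j = {b. slice (v j) k \<subseteq> slice (v j) b}" for k j
  define P where "P k i j = hit_prob k * (1 - hit_prob k) * (\<Prod>l\<in>cells - {k}. if l \<in> U k i \<union> V k j then 1 - hit_prob l else 1)" for k i j
  have c'0: "0 \<le> c' k i" and d'0: "0 \<le> d' k j" for k i j
    using assms(3,4) by (simp_all add: c'_def d'_def)
  have P0: "0 \<le> P k i j" for k i j
    unfolding P_def using hit_prob by (intro mult_nonneg_nonneg prod_nonneg) auto
  have "\<bar>expectation (\<lambda>\<omega>. F \<omega> * G \<omega>) - expectation F * expectation G\<bar>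
     \<le> (\<Sum>k\<in>cells. hit_prob k * (1 - hit_prob k) * (\<Sum>i\<in>I. \<Sum>j\<in>J. c' k i * d' k j *
       (\<Prod>l\<in>cells - {k}. if l \<in> U k i \<union> V k j then 1 - hit_prob l else 1)))"
    unfolding EF EG EFG
  proof (rule bernoulli_mean_covariance[OF finite_cells])
    fix k B assume kB: "k \<in> cells" "B \<subseteq> cells - {k}"
    show "\<bar>\<phi> (\<Union>(insert k B)) - \<phi> (\<Union>B)\<bar> \<le> (\<Sum>i\<in>I. c' k i * of_bool (B \<inter> U k i = {}))"
      unfolding c'_def U_def by (rule osc[OF \<phi> assms(3) kB])
    show "\<bar>\<psi> (\<Union>(insert k B)) - \<psi> (\<Union>B)\<bar> \<le> (\<Sum>j\<in>J. d' k j * of_bool (B \<inter> V k j = {}))"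
      unfolding d'_def V_def by (rule osc[OF \<psi> assms(4) kB])
  qed (use hit_prob c'0 d'0 in auto)
  also have "\<dots> = (\<Sum>k\<in>cells. \<Sum>i\<in>I. \<Sum>j\<in>J. c' k i * d' k j * P k i j)"
    unfolding P_def sum_distrib_left by (intro sum.cong refl) (simp add: mult_ac)
  also have "\<dots> = (\<Sum>i\<in>I. \<Sum>j\<in>J. \<Sum>k\<in>cells. c' k i * d' k j * P k i j)"
    by (subst sum.swap, intro sum.cong refl, rule sum.swap)
  finally have "ennreal \<bar>expectation (\<lambda>\<omega>. F \<omega> * G \<omega>) - expectation F * expectation G\<bar>
     \<le> ennreal \<dots>" by (rule ennreal_leI)
  also have "\<dots> = (\<Sum>i\<in>I. \<Sum>j\<in>J. \<Sum>k\<in>cells. ennreal (c' k i * d' k j * P k i j))"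
    using c'0 d'0 P0 by (simp add: sum_nonneg)
  also have "\<dots> \<le> (\<Sum>i\<in>I. \<Sum>j\<in>J. ennreal (c i * d j) * pair_coeff (u i) (v j))"
  proof (intro sum_mono)
    fix i j
    have "(\<Sum>k\<in>cells. ennreal (c' k i * d' k j * P k i j)) \<le> (\<Sum>k\<in>cells. ennreal (c i * d j) *
      (\<integral>\<^sup>+f\<in>cell S D k. indicator {f. 0 < f (u i) \<and> 0 < f (v j)} f *
     emeasure M {\<omega> \<in> space M. \<eta> (u i) \<omega> \<le> f (u i) \<and> \<eta> (v j) \<omega> \<le> f (v j)} \<partial>\<mu>))"
    proof (intro sum_mono)
      fix k assume k: "k \<in> cells"
      show "ennreal (c' k i * d' k j * P k i j) \<le> ennreal (c i * d j) *
      (\<integral>\<^sup>+f\<in>cell S D k. indicator {f. 0 < f (u i) \<and> 0 < f (v j)} f *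
     emeasure M {\<omega> \<in> space M. \<eta> (u i) \<omega> \<le> f (u i) \<and> \<eta> (v j) \<omega> \<le> f (v j)} \<partial>\<mu>)"
      proof (cases "slice (u i) k \<noteq> {} \<and> slice (v j) k \<noteq> {}")
        case True
        then have eq: "c' k i * d' k j = c i * d j" by (simp add: c'_def d'_def)
        have "ennreal (c' k i * d' k j * P k i j) = ennreal (c i * d j) * ennreal (P k i j)"
          unfolding eq by (rule ennreal_mult''[OF P0])
        also have "\<dots> \<le> ennreal (c i * d j) * (\<integral>\<^sup>+f\<in>cell S D k. indicator {f. 0 < f (u i) \<and> 0 < f (v j)} f *
     emeasure M {\<omega> \<in> space M. \<eta> (u i) \<omega> \<le> f (u i) \<and> \<eta> (v j) \<omega> \<le> f (v j)} \<partial>\<mu>)"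
          using cell_weight_le[OF k, of "u i" "v j"] True
          by (intro mult_left_mono) (auto simp: P_def U_def V_def slice_def)
        finally show ?thesis .
      qed (auto simp: c'_def d'_def)
    qed
    also have "\<dots> \<le> ennreal (c i * d j) * pair_coeff (u i) (v j)"
      unfolding sum_distrib_left[symmetric] by (intro mult_left_mono sum_cells_le) simp
    finally show "(\<Sum>k\<in>cells. ennreal (c' k i * d' k j * P k i j)) \<le> ennreal (c i * d j) * pair_coeff (u i) (v j)" .
  qed
  finally show "ennreal \<bar>expectation (\<lambda>\<omega>. F \<omega> * G \<omega>) - expectation F * expectation G\<bar>
    \<le> (\<Sum>i\<in>I. \<Sum>j\<in>J. ennreal (c i * d j) * pair_coeff (u i) (v j))" .
qed

end

section \<open>What stationarity of the field says about the exponent measure\<close>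

section \<open>Stationarity of the pair coefficients\<close>

lemma borel_pair_eq_quadrants:
  "sets (borel \<Otimes>\<^sub>M borel :: (real \<times> real) measure) = sigma_sets UNIV (range (\<lambda>(x, y). {x<..} \<times> {y<..}))"
proof -
  have "range (\<lambda>a::real \<times> real. {x. eucl_less a x}) = range (\<lambda>(x, y). {x<..} \<times> {y<..})"
    by (intro image_cong refl) (auto simp: eucl_less_def Basis_prod_def)
  moreover have "sets (borel :: (real \<times> real) measure) = sigma_sets UNIV (range (\<lambda>a. {x. eucl_less a x}))"
    by (subst borel_eq_greaterThan) simp
  ultimately show ?thesis by (simp only: borel_prod)
qed

lemma measure_eqI_quadrants:
  fixes M N :: "(real \<times> real) measure"
  assumes "sets M = sets (borel \<Otimes>\<^sub>M borel)" "sets N = sets (borel \<Otimes>\<^sub>M borel)"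
    and fin: "emeasure M UNIV < \<infinity>"
    and eq: "\<And>x y. emeasure M ({x<..} \<times> {y<..}) = emeasure N ({x<..} \<times> {y<..})"
  shows "M = N"
proof (rule measure_eqI_generator_eq[where A = "\<lambda>n. {- real n<..} \<times> {- real n<..}"])
  show "Int_stable (range (\<lambda>(x::real, y::real). {x<..} \<times> {y<..}))"
  proof (rule Int_stableI)
    fix a b assume "a \<in> range (\<lambda>(x::real, y::real). {x<..} \<times> {y<..})" "b \<in> range (\<lambda>(x::real, y::real). {x<..} \<times> {y<..})"
    then obtain x y x' y' where ab: "a = {x<..} \<times> {y<..}" "b = {x'<..} \<times> {y'<..}" by auto
    show "a \<inter> b \<in> range (\<lambda>(x::real, y::real). {x<..} \<times> {y<..})"
      by (rule range_eqI[of _ _ "(max x x', max y y')"]) (auto simp: ab)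
  qed
  show "(\<Union>n. {- real n<..} \<times> {- real n<..}) = UNIV"
  proof (intro equalityI subsetI UNIV_I)
    fix z :: "real \<times> real"
    obtain n where "\<bar>fst z\<bar> + \<bar>snd z\<bar> < real n" using reals_Archimedean2 by blast
    then show "z \<in> (\<Union>n. {- real n<..} \<times> {- real n<..})" by (cases z) (auto intro!: exI[of _ n])
  qed
  fix n :: nat
  have "emeasure M ({- real n<..} \<times> {- real n<..}) \<le> emeasure M UNIV"
    using sets_eq_imp_space_eq[OF assms(1)] by (metis UNIV_Times_UNIV emeasure_space space_borel space_pair_measure)
  then show "emeasure M ({- real n<..} \<times> {- real n<..}) \<noteq> \<infinity>" using fin by (auto simp: top_unique)
qed (use assms in \<open>auto simp: borel_pair_eq_quadrants\<close>)

context stationary_max_id begin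

lemma joint_cdf_shift:
  "emeasure M {\<omega> \<in> space M. \<eta> s \<omega> \<le> x \<and> \<eta> s' \<omega> \<le> y} = emeasure M {\<omega> \<in> space M. \<eta> 0 \<omega> \<le> x \<and> \<eta> (s' - s) \<omega> \<le> y}"
proof -
  let ?P = "Pi\<^sub>M UNIV (\<lambda>_. borel) :: (int ^ 'd \<Rightarrow> real) measure"
  have law: "shifted_law M \<eta> s = shifted_law M \<eta> 0"
    using stationary by (simp add: stationary_field_def)
  define A where "A = {z \<in> space ?P. z 0 \<le> x \<and> z (s' - s) \<le> y}"
  have A: "A \<in> sets ?P" unfolding A_def by measurable
  have T: "(\<lambda>\<omega> t. \<eta> (t + r) \<omega>) \<in> measurable M ?P" for r
    by (rule measurable_PiM_single') auto
  have "emeasure (shifted_law M \<eta> r) A = emeasure M {\<omega> \<in> space M. \<eta> r \<omega> \<le> x \<and> \<eta> (s' - s + r) \<omega> \<le> y}" for r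
    unfolding shifted_law_def emeasure_distr[OF T A]
    by (intro arg_cong[where f = "emeasure M"]) (auto simp: A_def space_PiM)
  from this[of s] this[of 0] law show ?thesis by simp
qed

lemma exceed_measurable: "{f \<in> C0. x < f s \<or> y < f s'} \<in> sets \<mu>" "{f \<in> C0. x < f s \<and> y < f s'} \<in> sets \<mu>"
proof -
  have "{f \<in> space \<mu>. x < f s \<or> y < f s'} \<in> sets \<mu>" "{f \<in> space \<mu>. x < f s \<and> y < f s'} \<in> sets \<mu>"
    by measurable
  then show "{f \<in> C0. x < f s \<or> y < f s'} \<in> sets \<mu>" "{f \<in> C0. x < f s \<and> y < f s'} \<in> sets \<mu>"
    by (simp_all add: space_\<mu>)
qed

lemma exceed_fmeasurable: "0 < x \<Longrightarrow> {f \<in> C0. x < f s} \<in> fmeasurable \<mu>"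
  using exceed_measurable(1)[of x s x s] finite_exceed[of x s] by (intro fmeasurableI) auto

text \<open>The field stays below both levels exactly when no point exceeds either of them, which is
  a void event of the Poisson process. Through this formula stationarity of the field becomes a
  property of \<mu>: the exponential is injective, and positive levels keep the exponent
  finite.\<close>

lemma exponent_eq_ln_cdf:
  assumes "0 < x" "0 < y"
  shows "exp (- measure \<mu> {f \<in> C0. x < f s \<or> y < f s'}) = prob {\<omega> \<in> space M. \<eta> s \<omega> \<le> x \<and> \<eta> s' \<omega> \<le> y}"
proof -
  let ?E = "{f \<in> C0. x < f s \<or> y < f s'}"
  have "?E = {f \<in> C0. x < f s} \<union> {f \<in> C0. y < f s'}" by auto
  then have "?E \<in> fmeasurable \<mu>" using assms by (simp add: exceed_fmeasurable fmeasurable.Un)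
  then have "exp (- measure \<mu> ?E) = prob {\<omega> \<in> space M. num_points (\<Phi> \<omega>) ?E = 0}"
    by (subst prob_void) (auto simp: fmeasurable_def)
  also have "{\<omega> \<in> space M. num_points (\<Phi> \<omega>) ?E = 0} = {\<omega> \<in> space M. \<eta> s \<omega> \<le> x \<and> \<eta> s' \<omega> \<le> y}"
  proof (intro Collect_cong conj_cong refl)
    fix \<omega> assume \<omega>: "\<omega> \<in> space M"
    have "num_points (\<Phi> \<omega>) ?E = 0 \<longleftrightarrow> \<not> (\<exists>f\<in>?E. 0 < \<Phi> \<omega> f)"
      unfolding num_points_pos_iff[symmetric] by (simp add: zero_less_iff_neq_zero)
    also have "\<dots> \<longleftrightarrow> \<not> (\<exists>f\<in>C0. 0 < \<Phi> \<omega> f \<and> x < f s) \<and> \<not> (\<exists>f\<in>C0. 0 < \<Phi> \<omega> f \<and> y < f s')" by blast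
    also have "\<dots> \<longleftrightarrow> \<eta> s \<omega> \<le> x \<and> \<eta> s' \<omega> \<le> y"
      using exceed_iff[OF \<omega>, of x s] exceed_iff[OF \<omega>, of y s'] assms by (simp add: not_less[symmetric])
    finally show "num_points (\<Phi> \<omega>) ?E = 0 \<longleftrightarrow> \<eta> s \<omega> \<le> x \<and> \<eta> s' \<omega> \<le> y" .
  qed
  finally show ?thesis .
qed

lemma exponent_shift_or:
  assumes "0 < x" "0 < y"
  shows "measure \<mu> {f \<in> C0. x < f s \<or> y < f s'} = measure \<mu> {f \<in> C0. x < f 0 \<or> y < f (s' - s)}"
proof -
  have "exp (- measure \<mu> {f \<in> C0. x < f s \<or> y < f s'}) = exp (- measure \<mu> {f \<in> C0. x < f 0 \<or> y < f (s' - s)})"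
    unfolding exponent_eq_ln_cdf[OF assms] using joint_cdf_shift[of s x s' y] by (simp add: emeasure_eq_measure)
  then show ?thesis by simp
qed

text \<open>Inclusion and exclusion. The one-site masses are shift invariant too, by
  \<open>exponent_shift_or\<close> with equal sites and equal levels.\<close>

lemma exponent_shift_and:
  assumes "0 < x" "0 < y"
  shows "emeasure \<mu> {f \<in> C0. x < f s \<and> y < f s'} = emeasure \<mu> {f \<in> C0. x < f 0 \<and> y < f (s' - s)}"
proof -
  have single: "measure \<mu> {f \<in> C0. z < f t} = measure \<mu> {f \<in> C0. z < f 0}" if "0 < z" for z t
    using exponent_shift_or[OF that that, of t t] by simp
  have "measure \<mu> {f \<in> C0. x < f t \<and> y < f t'} = measure \<mu> {f \<in> C0. x < f 0} + measure \<mu> {f \<in> C0. y < f 0}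
     - measure \<mu> {f \<in> C0. x < f t \<or> y < f t'}" for t t'
  proof -
    have "measure \<mu> ({f \<in> C0. x < f t} \<union> {f \<in> C0. y < f t'}) = measure \<mu> {f \<in> C0. x < f t} + measure \<mu> {f \<in> C0. y < f t'}
      - measure \<mu> ({f \<in> C0. x < f t} \<inter> {f \<in> C0. y < f t'})"
      using assms by (intro measure_Un3 exceed_fmeasurable)
    moreover have "{f \<in> C0. x < f t} \<union> {f \<in> C0. y < f t'} = {f \<in> C0. x < f t \<or> y < f t'}"
      "{f \<in> C0. x < f t} \<inter> {f \<in> C0. y < f t'} = {f \<in> C0. x < f t \<and> y < f t'}" by auto
    ultimately show ?thesis using single[OF assms(1), of t] single[OF assms(2), of t'] by simp
  qed
  then have "measure \<mu> {f \<in> C0. x < f s \<and> y < f s'} = measure \<mu> {f \<in> C0. x < f 0 \<and> y < f (s' - s)}"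
    using exponent_shift_or[OF assms] by simp
  moreover have "emeasure \<mu> {f \<in> C0. x < f t \<and> y < f t'} = ennreal (measure \<mu> {f \<in> C0. x < f t \<and> y < f t'})" for t t'
  proof -
    have "{f \<in> C0. x < f t \<and> y < f t'} = {f \<in> C0. x < f t} \<inter> {f \<in> C0. y < f t'}" by auto
    then have "{f \<in> C0. x < f t \<and> y < f t'} \<in> fmeasurable \<mu>"
      using assms by (simp add: exceed_fmeasurable fmeasurable.Int)
    then show ?thesis by (simp add: emeasure_eq_measure2)
  qed
  ultimately show ?thesis by simp
qed

text \<open>The image of \<mu> under evaluation at two sites, restricted to values above
  \<open>e\<close> at both. For positive \<open>e\<close> it is finite, so that its values on
  quadrants determine it; without the restriction the mass may be infinite.\<close>

definition quadrant_law :: "real \<Rightarrow> int ^ 'd \<Rightarrow> int ^ 'd \<Rightarrow> (real \<times> real) measure" where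
  "quadrant_law e s s' =
     distr (density \<mu> (indicator {f \<in> C0. e < f s \<and> e < f s'})) (borel \<Otimes>\<^sub>M borel) (\<lambda>f. (f s, f s'))"

lemma quadrant_law_shift:
  assumes "0 < e"
  shows "quadrant_law e s s' = quadrant_law e 0 (s' - s)"
proof (rule measure_eqI_quadrants)
  have meas: "(\<lambda>f. (f t, f t')) \<in> measurable (density \<mu> (indicator {f \<in> C0. e < f t \<and> e < f t'})) (borel \<Otimes>\<^sub>M borel)" for t t'
    by measurable
  have em: "emeasure (quadrant_law e t t') A = emeasure \<mu> {f \<in> C0. (f t, f t') \<in> A \<and> e < f t \<and> e < f t'}"
    if A: "A \<in> sets (borel \<Otimes>\<^sub>M borel)" for t t' A
  proof -
    have [measurable]: "{f \<in> C0. e < f t \<and> e < f t'} \<in> sets \<mu>" by (rule exceed_measurable)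
    have "emeasure (quadrant_law e t t') A = emeasure (density \<mu> (indicator {f \<in> C0. e < f t \<and> e < f t'}))
      ((\<lambda>f. (f t, f t')) -` A \<inter> space \<mu>)"
      unfolding quadrant_law_def emeasure_distr[OF meas A] by simp
    also have "\<dots> = emeasure \<mu> ({f \<in> C0. e < f t \<and> e < f t'} \<inter> ((\<lambda>f. (f t, f t')) -` A \<inter> space \<mu>))"
      using A by (subst emeasure_density) (auto simp: indicator_inter_arith[symmetric] intro!: measurable_sets)
    also have "{f \<in> C0. e < f t \<and> e < f t'} \<inter> ((\<lambda>f. (f t, f t')) -` A \<inter> space \<mu>) = {f \<in> C0. (f t, f t') \<in> A \<and> e < f t \<and> e < f t'}"
      by (auto simp: space_\<mu>)
    finally show ?thesis .
  qed
  show "emeasure (quadrant_law e s s') ({x<..} \<times> {y<..}) = emeasure (quadrant_law e 0 (s' - s)) ({x<..} \<times> {y<..})" for x y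
  proof -
    have Q: "{x<..} \<times> {y<..} \<in> sets (borel \<Otimes>\<^sub>M borel :: (real \<times> real) measure)" by auto
    have "{f \<in> C0. (f t, f t') \<in> {x<..} \<times> {y<..} \<and> e < f t \<and> e < f t'} = {f \<in> C0. max x e < f t \<and> max y e < f t'}"
      for t t' :: "int ^ 'd" by auto
    then show ?thesis
      unfolding em[OF Q] using exponent_shift_and[of "max x e" "max y e" s s'] assms by simp
  qed
  have "emeasure (quadrant_law e s s') UNIV = emeasure \<mu> {f \<in> C0. e < f s \<and> e < f s'}"
    using sets.top[of "borel \<Otimes>\<^sub>M borel :: (real \<times> real) measure"]
    by (subst em) (auto simp: space_pair_measure)
  also have "\<dots> \<le> emeasure \<mu> {f \<in> C0. e < f s}"
    using exceed_measurable(1)[of e s e s] by (intro emeasure_mono) auto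
  also have "\<dots> < \<infinity>" by (rule finite_exceed[OF assms])
  finally show "emeasure (quadrant_law e s s') UNIV < \<infinity>" .
qed (simp_all add: quadrant_law_def)

text \<open>The cutoffs 1 / (n + 1) exhaust the functions that are positive at both sites, so
  monotone convergence reduces the claim to the finite measures of
  \<open>quadrant_law_shift\<close>. The integrand depends on the sites only through their
  difference, by \<open>joint_cdf_shift\<close>.\<close>

lemma pair_coeff_shift: "pair_coeff s s' = pair_coeff 0 (s' - s)"
proof -
  define H where "H z = emeasure M {\<omega> \<in> space M. \<eta> 0 \<omega> \<le> fst z \<and> \<eta> (s' - s) \<omega> \<le> snd z}" for z
  have H: "H \<in> borel_measurable (borel \<Otimes>\<^sub>M borel)"
    using joint_cdf_measurable[of 0 "s' - s"] unfolding H_def by (simp add: case_prod_unfold)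
  have "pair_coeff t t' = (SUP n. \<integral>\<^sup>+z. H z \<partial>quadrant_law (1 / Suc n) t t')" if "t' - t = s' - s" for t t'
  proof -
    have int: "(\<integral>\<^sup>+z. H z \<partial>quadrant_law e t t') = (\<integral>\<^sup>+f. indicator {f \<in> C0. e < f t \<and> e < f t'} f * H (f t, f t') \<partial>\<mu>)" for e
    proof -
      have ind: "(indicator {f \<in> C0. e < f t \<and> e < f t'} :: _ \<Rightarrow> ennreal) \<in> borel_measurable \<mu>"
        by (intro borel_measurable_indicator exceed_measurable)
      have T: "(\<lambda>f. (f t, f t')) \<in> measurable \<mu> (borel \<Otimes>\<^sub>M borel)" by measurable
      then have T': "(\<lambda>f. (f t, f t')) \<in> measurable (density \<mu> (indicator {f \<in> C0. e < f t \<and> e < f t'})) (borel \<Otimes>\<^sub>M borel)"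
        by (subst measurable_cong_sets[OF sets_density refl])
      show ?thesis unfolding quadrant_law_def
        using nn_integral_distr[OF T', of H] nn_integral_density[OF ind measurable_compose[OF T H]] H by simp
    qed
    have "pair_coeff t t' = (\<integral>\<^sup>+f. (SUP n. indicator {f \<in> C0. 1 / Suc n < f t \<and> 1 / Suc n < f t'} f * H (f t, f t')) \<partial>\<mu>)"
      unfolding pair_coeff_def
    proof (intro nn_integral_cong)
      fix f assume "f \<in> space \<mu>"
      then have f: "f \<in> C0" by (simp add: space_\<mu>)
      have "(SUP n. indicator {f \<in> C0. 1 / Suc n < f t \<and> 1 / Suc n < f t'} f) = (indicator {f. 0 < f t \<and> 0 < f t'} f :: ennreal)"
      proof (cases "0 < f t \<and> 0 < f t'")
        case True
        then obtain n where "1 / Suc n < min (f t) (f t')" by (metis min_less_iff_conj nat_approx_posE)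
        then have "indicator {f \<in> C0. 1 / Suc n < f t \<and> 1 / Suc n < f t'} f = (1::ennreal)" using f by simp
        then show ?thesis using True
          by (intro antisym SUP_least) (auto simp: indicator_def intro!: SUP_upper2[of n])
      next
        case False
        then have "indicator {f \<in> C0. 1 / Suc n < f t \<and> 1 / Suc n < f t'} f = (0::ennreal)" for n
          by (auto simp: indicator_def) (smt (verit) divide_nonneg_nonneg of_nat_0_le_iff)+
        then have "(SUP n. indicator {f \<in> C0. 1 / Suc n < f t \<and> 1 / Suc n < f t'} f) = (SUP n::nat. 0::ennreal)"
          by (intro SUP_cong refl)
        then show ?thesis using False by simp
      qed
      then show "indicator {f. 0 < f t \<and> 0 < f t'} f * emeasure M {\<omega> \<in> space M. \<eta> t \<omega> \<le> f t \<and> \<eta> t' \<omega> \<le> f t'}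
        = (SUP n. indicator {f \<in> C0. 1 / Suc n < f t \<and> 1 / Suc n < f t'} f * H (f t, f t'))"
        unfolding joint_cdf_shift[of t] that by (simp add: H_def SUP_mult_right_ennreal[symmetric])
    qed
    also have "\<dots> = (SUP n. \<integral>\<^sup>+f. indicator {f \<in> C0. 1 / Suc n < f t \<and> 1 / Suc n < f t'} f * H (f t, f t') \<partial>\<mu>)"
    proof (rule nn_integral_monotone_convergence_SUP)
      show "incseq (\<lambda>n f. indicator {f \<in> C0. 1 / Suc n < f t \<and> 1 / Suc n < f t'} f * H (f t, f t'))"
      proof (intro incseq_SucI le_funI mult_right_mono)
        fix n :: nat and f :: "int ^ 'd \<Rightarrow> real"
        have "1 / Suc (Suc n) \<le> 1 / real (Suc n)" by (intro divide_left_mono) auto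
        then show "indicator {f \<in> C0. 1 / Suc n < f t \<and> 1 / Suc n < f t'} f
           \<le> (indicator {f \<in> C0. 1 / Suc (Suc n) < f t \<and> 1 / Suc (Suc n) < f t'} f :: ennreal)"
          by (auto simp: indicator_def simp del: of_nat_Suc)
      qed simp
      fix n
      have T: "(\<lambda>f. (f t, f t')) \<in> measurable \<mu> (borel \<Otimes>\<^sub>M borel)" by measurable
      show "(\<lambda>f. indicator {f \<in> C0. 1 / Suc n < f t \<and> 1 / Suc n < f t'} f * H (f t, f t')) \<in> borel_measurable \<mu>"
        by (intro borel_measurable_times_ennreal borel_measurable_indicator exceed_measurable measurable_compose[OF T H])
    qed
    finally show ?thesis by (simp add: int)
  qed
  then have "pair_coeff s s' = (SUP n. \<integral>\<^sup>+z. H z \<partial>quadrant_law (1 / Suc n) s s')"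
    "pair_coeff 0 (s' - s) = (SUP n. \<integral>\<^sup>+z. H z \<partial>quadrant_law (1 / Suc n) 0 (s' - s))" by simp_all
  moreover have "quadrant_law (1 / Suc n) s s' = quadrant_law (1 / Suc n) 0 (s' - s)" for n
    by (rule quadrant_law_shift) simp
  ultimately show ?thesis by simp
qed

text \<open>After the shift to the sites 0 and \<open>s' - s\<close> only the indicator has to be
  dropped. The inequality may be strict, since \<gamma> also counts functions that vanish at one of
  the two sites or at both.\<close>

lemma pair_coeff_le_gamma: "pair_coeff s s' \<le> gamma_coeff M \<mu> \<eta> (s' - s)"
proof -
  let ?h = "s' - s"
  let ?H = "\<lambda>(y1, y2). emeasure M {\<omega> \<in> space M. \<eta> 0 \<omega> \<le> y1 \<and> \<eta> ?h \<omega> \<le> y2}"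
  have T: "(\<lambda>f. (f 0, f ?h)) \<in> measurable \<mu> (restrict_space borel ({0..} \<times> {0..}))"
  proof (rule measurable_restrict_space2)
    show "(\<lambda>f. (f 0, f ?h)) \<in> borel_measurable \<mu>" by measurable
  qed (auto simp: space_\<mu> C0_nonneg)
  have "?H \<in> borel_measurable borel" using joint_cdf_measurable[of 0 ?h] by (simp add: borel_prod)
  then have H: "?H \<in> borel_measurable (restrict_space borel ({0..} \<times> {0..}))" by (rule measurable_restrict_space1)
  have "pair_coeff s s' = pair_coeff 0 ?h" by (rule pair_coeff_shift)
  also have "\<dots> \<le> (\<integral>\<^sup>+f. ?H (f 0, f ?h) \<partial>\<mu>)"
    unfolding pair_coeff_def by (intro nn_integral_mono) (auto simp: indicator_def)
  also have "\<dots> = gamma_coeff M \<mu> \<eta> ?h"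
    unfolding gamma_coeff_def bivariate_exponent_def using nn_integral_distr[OF T, of ?H] H by simp
  finally show ?thesis .
qed

end

section \<open>From grid functions to bounded measurable functions of a window\<close>

section \<open>Approximation by grid functions\<close>

text \<open>A function of the vector \<open>x\<close> that sees only which levels its coordinates
  exceed, with the strict inequality of \<open>signature\<close>. Evaluated at a window of the
  field, it is therefore a function of a signature.\<close>

definition grid_fun :: "real set \<Rightarrow> (('p \<times> real) set \<Rightarrow> real) \<Rightarrow> real ^ 'p \<Rightarrow> real" where
  "grid_fun D v x = v {(i, l). l \<in> D \<and> l < x $ i}"

lemma grid_fun_measurable:
  fixes v :: "('p::finite \<times> real) set \<Rightarrow> real"
  assumes "finite D"
  shows "grid_fun D v \<in> borel_measurable borel"
proof -
  let ?A = "\<lambda>w. {x :: real ^ 'p. \<forall>i. \<forall>l\<in>D. (i, l) \<in> w \<longleftrightarrow> l < x $ i}"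
  have eq: "grid_fun D v x = (\<Sum>w\<in>Pow (UNIV \<times> D). v w * indicator (?A w) x)" for x
  proof -
    have "(\<Sum>w\<in>Pow (UNIV \<times> D). v w * indicator (?A w) x)
        = (\<Sum>w\<in>Pow (UNIV \<times> D). if w = {(i, l). l \<in> D \<and> l < x $ i} then v w else 0)"
      by (intro sum.cong refl) (auto simp: indicator_def)
    then show ?thesis using assms by (subst (asm) sum.delta) (auto simp: grid_fun_def)
  qed
  have "?A w \<in> sets borel" for w
  proof -
    have gt: "{x :: real ^ 'p. l < x $ i} \<in> sets borel" for i l
      by (intro borel_open open_Collect_less continuous_intros)
    have "{x :: real ^ 'p. (i, l) \<in> w \<longleftrightarrow> l < x $ i} = (if (i, l) \<in> w then {x. l < x $ i} else - {x. l < x $ i})" for i l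
      by auto
    then have one: "{x :: real ^ 'p. (i, l) \<in> w \<longleftrightarrow> l < x $ i} \<in> sets borel" for i l
      using gt by (simp add: borel_comp)
    have "?A w = (\<Inter>i. \<Inter>l\<in>D. {x. (i, l) \<in> w \<longleftrightarrow> l < x $ i})" by auto
    also have "\<dots> \<in> sets borel"
    proof (cases "D = {}")
      case False
      then show ?thesis using assms one by (intro sets.finite_INT) auto
    qed simp
    finally show ?thesis .
  qed
  then show ?thesis
    by (subst ext[OF eq]) (intro borel_measurable_sum borel_measurable_times borel_measurable_indicator borel_measurable_const)
qed

lemma grid_fun_bounded:
  fixes v :: "('p::finite \<times> real) set \<Rightarrow> real"
  assumes "finite D"
  shows "\<bar>grid_fun D v x\<bar> \<le> (\<Sum>w\<in>Pow (UNIV \<times> D). \<bar>v w\<bar>)"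
  unfolding grid_fun_def using assms by (intro member_le_sum[where f = "\<lambda>w. \<bar>v w\<bar>"]) auto

locale nonneg_vector_law = finite_measure Q for Q :: "(real ^ 'p) measure" +
  assumes sets_Q [measurable_cong]: "sets Q = sets borel"
    and nonneg_Q: "AE x in Q. \<forall>i. 0 \<le> x $ i"
begin

text \<open>Approximability in L1, the mode that \<open>covariance_perturb\<close> works with. The
  levels have to be positive because only then do the cells of \<open>discretized_field\<close> have
  finite mass.\<close>

definition grid_approx :: "(real ^ 'p \<Rightarrow> real) \<Rightarrow> bool" where
  "grid_approx f \<longleftrightarrow> integrable Q f \<and>
     (\<forall>e>0. \<exists>D v. finite D \<and> (\<forall>l\<in>D. 0 < l) \<and> (\<integral>x. \<bar>f x - grid_fun D v x\<bar> \<partial>Q) < e)"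

lemma grid_approxE:
  assumes "grid_approx f" "0 < e"
  obtains D v where "finite D" "\<forall>l\<in>D. 0 < l" "(\<integral>x. \<bar>f x - grid_fun D v x\<bar> \<partial>Q) < e"
  using assms unfolding grid_approx_def by blast

lemma integrable_grid_fun: "finite D \<Longrightarrow> integrable Q (grid_fun D v)"
  using grid_fun_bounded[of D v] grid_fun_measurable[of D v]
  by (intro integrable_const_bound) (auto simp: measurable_cong_sets[OF sets_Q refl])

lemma grid_approx_closure:
  assumes "integrable Q f"
    and "\<And>e. 0 < e \<Longrightarrow> \<exists>g. grid_approx g \<and> (\<integral>x. \<bar>f x - g x\<bar> \<partial>Q) < e"
  shows "grid_approx f"
  unfolding grid_approx_def
proof (intro conjI allI impI assms(1))
  fix e :: real assume "0 < e"
  then obtain g where g: "grid_approx g" "(\<integral>x. \<bar>f x - g x\<bar> \<partial>Q) < e / 2"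
    using assms(2)[of "e / 2"] by auto
  then obtain D v where D: "finite D" "\<forall>l\<in>D. 0 < l" "(\<integral>x. \<bar>g x - grid_fun D v x\<bar> \<partial>Q) < e / 2"
    using grid_approxE[OF g(1), of "e / 2"] \<open>0 < e\<close> by auto
  have int: "integrable Q g" "integrable Q (grid_fun D v)"
    using g integrable_grid_fun[OF D(1)] by (auto simp: grid_approx_def)
  have "(\<integral>x. \<bar>f x - grid_fun D v x\<bar> \<partial>Q) \<le> (\<integral>x. \<bar>f x - g x\<bar> + \<bar>g x - grid_fun D v x\<bar> \<partial>Q)"
    using int assms(1) by (intro integral_mono) auto
  also have "\<dots> = (\<integral>x. \<bar>f x - g x\<bar> \<partial>Q) + (\<integral>x. \<bar>g x - grid_fun D v x\<bar> \<partial>Q)"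
    using int assms(1) by (intro Bochner_Integration.integral_add) auto
  finally have "(\<integral>x. \<bar>f x - grid_fun D v x\<bar> \<partial>Q) < e" using g(2) D(3) by simp
  then show "\<exists>D v. finite D \<and> (\<forall>l\<in>D. 0 < l) \<and> (\<integral>x. \<bar>f x - grid_fun D v x\<bar> \<partial>Q) < e"
    using D by blast
qed

lemma grid_approx_lim:
  assumes "integrable Q f" "\<And>n::nat. grid_approx (g n)" "(\<lambda>n. \<integral>x. \<bar>f x - g n x\<bar> \<partial>Q) \<longlonglongrightarrow> 0"
  shows "grid_approx f"
proof (rule grid_approx_closure[OF assms(1)])
  fix e :: real assume "0 < e"
  from order_tendstoD(2)[OF assms(3) this]
  obtain n where "(\<integral>x. \<bar>f x - g n x\<bar> \<partial>Q) < e" by (auto simp: eventually_sequentially)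
  then show "\<exists>g. grid_approx g \<and> (\<integral>x. \<bar>f x - g x\<bar> \<partial>Q) < e" using assms(2) by blast
qed

lemma grid_approx_dominated:
  assumes "\<And>n::nat. grid_approx (g n)" "AE x in Q. (\<lambda>n. g n x) \<longlonglongrightarrow> f x"
    and "f \<in> borel_measurable Q" "integrable Q w" "\<And>n. AE x in Q. \<bar>g n x\<bar> \<le> w x"
  shows "grid_approx f"
proof (rule grid_approx_lim[OF _ assms(1)])
  have g: "g n \<in> borel_measurable Q" for n using assms(1)[of n] by (auto simp: grid_approx_def)
  show f: "integrable Q f"
    by (rule integrable_dominated_convergence[OF assms(3) g assms(4,2)]) (use assms(5) in simp)
  have "(\<lambda>n. \<integral>x. \<bar>f x - g n x\<bar> \<partial>Q) \<longlonglongrightarrow> (\<integral>x. 0 \<partial>Q)"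
  proof (rule integral_dominated_convergence[where w = "\<lambda>x. \<bar>f x\<bar> + w x"])
    show "AE x in Q. (\<lambda>n. \<bar>f x - g n x\<bar>) \<longlonglongrightarrow> 0"
      using assms(2)
    proof eventually_elim
      case (elim x)
      have "(\<lambda>n. \<bar>f x - g n x\<bar>) \<longlonglongrightarrow> \<bar>f x - f x\<bar>" using elim by (intro tendsto_intros)
      then show ?case by simp
    qed
    show "AE x in Q. norm \<bar>f x - g n x\<bar> \<le> \<bar>f x\<bar> + w x" for n
      using assms(5)[of n] by eventually_elim auto
  qed (use f g assms in auto)
  then show "(\<lambda>n. \<integral>x. \<bar>f x - g n x\<bar> \<partial>Q) \<longlonglongrightarrow> 0" by simp
qed

lemma grid_approx_cmult:
  assumes "grid_approx f" shows "grid_approx (\<lambda>x. c * f x)"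
  unfolding grid_approx_def
proof (intro conjI allI impI)
  show "integrable Q (\<lambda>x. c * f x)" using assms by (auto simp: grid_approx_def)
  fix e :: real assume "0 < e"
  then have "0 < e / (\<bar>c\<bar> + 1)" by simp
  then obtain D v where D: "finite D" "\<forall>l\<in>D. 0 < l" "(\<integral>x. \<bar>f x - grid_fun D v x\<bar> \<partial>Q) < e / (\<bar>c\<bar> + 1)"
    using assms unfolding grid_approx_def by blast
  have "\<bar>c * f x - grid_fun D (\<lambda>w. c * v w) x\<bar> = \<bar>c\<bar> * \<bar>f x - grid_fun D v x\<bar>" for x
    unfolding grid_fun_def abs_mult[symmetric] by (simp add: algebra_simps)
  then have "(\<integral>x. \<bar>c * f x - grid_fun D (\<lambda>w. c * v w) x\<bar> \<partial>Q) = \<bar>c\<bar> * (\<integral>x. \<bar>f x - grid_fun D v x\<bar> \<partial>Q)"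
    by simp
  also have "\<dots> \<le> (\<bar>c\<bar> + 1) * (\<integral>x. \<bar>f x - grid_fun D v x\<bar> \<partial>Q)"
    by (intro mult_right_mono integral_nonneg) auto
  also have "\<dots> < e" using D(3) by (simp add: field_simps add_pos_nonneg)
  finally show "\<exists>D v. finite D \<and> (\<forall>l\<in>D. 0 < l) \<and> (\<integral>x. \<bar>c * f x - grid_fun D v x\<bar> \<partial>Q) < e"
    using D by blast
qed

lemma grid_approx_add:
  assumes "grid_approx f" "grid_approx g" shows "grid_approx (\<lambda>x. f x + g x)"
  unfolding grid_approx_def
proof (intro conjI allI impI)
  show "integrable Q (\<lambda>x. f x + g x)" using assms by (auto simp: grid_approx_def)
  fix e :: real assume "0 < e"
  then have "0 < e / 2" by simp
  obtain D v where D: "finite D" "\<forall>l\<in>D. 0 < l" "(\<integral>x. \<bar>f x - grid_fun D v x\<bar> \<partial>Q) < e / 2"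
    using grid_approxE[OF assms(1) \<open>0 < e / 2\<close>] .
  obtain E u where E: "finite E" "\<forall>l\<in>E. 0 < l" "(\<integral>x. \<bar>g x - grid_fun E u x\<bar> \<partial>Q) < e / 2"
    using grid_approxE[OF assms(2) \<open>0 < e / 2\<close>] .
  \<comment> \<open>The levels of \<open>D\<close> and of \<open>E\<close> are pooled, and each
    summand recovers its own data by intersecting.\<close>
  define r where "r w = v (w \<inter> UNIV \<times> D) + u (w \<inter> UNIV \<times> E)" for w
  have r: "grid_fun (D \<union> E) r x = grid_fun D v x + grid_fun E u x" for x
  proof -
    have "{(i, l). l \<in> D \<union> E \<and> l < x $ i} \<inter> UNIV \<times> D = {(i, l). l \<in> D \<and> l < x $ i}"
      "{(i, l). l \<in> D \<union> E \<and> l < x $ i} \<inter> UNIV \<times> E = {(i, l). l \<in> E \<and> l < x $ i}" by auto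
    then show ?thesis by (simp add: grid_fun_def r_def)
  qed
  have int: "integrable Q f" "integrable Q g" "integrable Q (grid_fun D v)" "integrable Q (grid_fun E u)"
    using assms D E by (auto simp: grid_approx_def integrable_grid_fun)
  have "(\<integral>x. \<bar>f x + g x - grid_fun (D \<union> E) r x\<bar> \<partial>Q) \<le> (\<integral>x. \<bar>f x - grid_fun D v x\<bar> + \<bar>g x - grid_fun E u x\<bar> \<partial>Q)"
    unfolding r using int by (intro integral_mono) auto
  also have "\<dots> = (\<integral>x. \<bar>f x - grid_fun D v x\<bar> \<partial>Q) + (\<integral>x. \<bar>g x - grid_fun E u x\<bar> \<partial>Q)"
    using int by (intro Bochner_Integration.integral_add) auto
  also have "\<dots> < e" using D(3) E(3) by simp
  finally show "\<exists>D v. finite D \<and> (\<forall>l\<in>D. 0 < l) \<and> (\<integral>x. \<bar>f x + g x - grid_fun D v x\<bar> \<partial>Q) < e"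
    using D E by (intro exI[of _ "D \<union> E"] exI[of _ r]) auto
qed

lemma grid_approx_grid: "finite D \<Longrightarrow> \<forall>l\<in>D. 0 < l \<Longrightarrow> grid_approx (grid_fun D v)"
  unfolding grid_approx_def using integrable_grid_fun
  by (intro conjI allI impI exI[of _ D] exI[of _ v]) auto

lemma grid_approx_const: "grid_approx (\<lambda>x. c)"
proof -
  have "grid_fun {} (\<lambda>_. c) = (\<lambda>x :: real ^ 'p. c)" by (rule ext) (simp add: grid_fun_def)
  then show ?thesis using grid_approx_grid[of "{}" "\<lambda>_. c"] by simp
qed

text \<open>Levels of a grid are positive; the threshold 0 is a limit, and negative thresholds
  are almost surely exceeded.\<close>

lemma grid_approx_orthant: "grid_approx (indicator {x. \<forall>i. a $ i < x $ i})"
proof (rule grid_approx_dominated[where w = "\<lambda>_. 1"])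
  define A where "A n = {x :: real ^ 'p. \<forall>i. 0 \<le> a $ i \<longrightarrow> max (a $ i) (1 / Suc n) < x $ i}" for n
  define D where "D n = range (\<lambda>i. max (a $ i) (1 / Suc n))" for n
  define v where "v n w = (of_bool (\<forall>i. 0 \<le> a $ i \<longrightarrow> (i, max (a $ i) (1 / Suc n)) \<in> w) :: real)" for n and w :: "('p \<times> real) set"
  have "indicator (A n) = grid_fun (D n) (v n)" for n
    by (intro ext) (simp add: A_def grid_fun_def v_def D_def indicator_def)
  moreover have "finite (D n)" "\<forall>l\<in>D n. 0 < l" for n
    by (auto simp: D_def less_max_iff_disj)
  ultimately show "grid_approx (indicator (A n))" for n by (simp add: grid_approx_grid)
  show "AE x in Q. (\<lambda>n. indicator (A n) x :: real) \<longlonglongrightarrow> indicator {x. \<forall>i. a $ i < x $ i} x"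
    using nonneg_Q
  proof eventually_elim
    case (elim x)
    show ?case
    proof (cases "\<forall>i. a $ i < x $ i")
      case True
      \<comment> \<open>The \<open>1\<close> keeps the minimum defined when all thresholds are
        negative.\<close>
      define m where "m = Min (insert 1 ((\<lambda>i. x $ i) ` {i. 0 \<le> a $ i}))"
      have "0 < m" unfolding m_def using True by (subst Min_gr_iff) (auto intro: le_less_trans)
      then obtain N where N: "1 / Suc N < m" by (rule nat_approx_posE)
      have "x \<in> A n" if "N \<le> n" for n
      proof -
        have "1 / Suc n \<le> 1 / Suc N" using that by (intro divide_left_mono) auto
        then have "1 / Suc n < x $ i" if "0 \<le> a $ i" for i
          using N that unfolding m_def by (subst (asm) Min_gr_iff) (auto intro: le_less_trans)
        then show ?thesis using True by (simp add: A_def)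
      qed
      then have "\<forall>\<^sub>F n in sequentially. indicator (A n) x = (1::real)"
        by (auto simp: eventually_sequentially intro!: exI[of _ N])
      then show ?thesis using True by (simp add: tendsto_eventually)
    next
      case False
      then obtain i where i: "x $ i \<le> a $ i" by (auto simp: not_less)
      moreover have "0 \<le> a $ i" using elim i by (meson order_trans)
      ultimately have "x \<notin> A n" for n unfolding A_def by (auto intro!: exI[of _ i])
      then show ?thesis using False by simp
    qed
  qed
  have "{x. \<forall>i. a $ i < x $ i} \<in> sets borel"
    by (intro borel_open) (auto intro!: open_INT open_Collect_less continuous_intros simp: Collect_all_eq)
  then show "indicator {x. \<forall>i. a $ i < x $ i} \<in> borel_measurable Q"
    by (intro borel_measurable_indicator) (simp add: sets_Q)
qed (auto simp: indicator_def)

text \<open>Open orthants are stable under intersection and generate the Borel sets, so a Dynkin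
  induction can start from \<open>grid_approx_orthant\<close>. Complements and finite disjoint
  unions are linear combinations of indicators, and countable unions are dominated limits.\<close>

lemma grid_approx_indicator:
  assumes "A \<in> sets borel" shows "grid_approx (indicator A)"
proof -
  let ?G = "range (\<lambda>a :: real ^ 'p. {x. \<forall>i. a $ i < x $ i})"
  have "(\<lambda>a :: real ^ 'p. {x. eucl_less a x}) = (\<lambda>a. {x. \<forall>i. a $ i < x $ i})"
    by (auto simp: eucl_less_def Basis_vec_def inner_axis fun_eq_iff)
  then have gen: "sets borel = sigma_sets UNIV ?G"
    using borel_eq_greaterThan[where 'a = "real ^ 'p"] by (metis Pow_UNIV sets_measure_of subset_UNIV top_greatest)
  have "Int_stable ?G"
  proof (rule Int_stableI)
    fix S T assume "S \<in> ?G" "T \<in> ?G"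
    then obtain a b where "S = {x. \<forall>i. a $ i < x $ i}" "T = {x. \<forall>i. b $ i < x $ i}" by auto
    then show "S \<inter> T \<in> ?G" by (intro range_eqI[of _ _ "\<chi> i. max (a $ i) (b $ i)"]) auto
  qed
  moreover have "?G \<subseteq> Pow UNIV" by simp
  moreover have "A \<in> sigma_sets UNIV ?G" using assms gen by simp
  ultimately show ?thesis
  proof (induction rule: sigma_sets_induct_disjoint)
    case (basic A) then show ?case using grid_approx_orthant by auto
  next
    case empty show ?case using grid_approx_const[of 0] by (simp add: indicator_def cong: if_cong)
  next
    case (compl A)
    have "indicator (UNIV - A) = (\<lambda>x. 1 + (-1) * indicator A x :: real)" by (auto simp: indicator_def)
    then show ?case using grid_approx_add[OF grid_approx_const[of 1] grid_approx_cmult[OF compl(2), of "-1"]] by simp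
  next
    case (union A)
    define B where "B n = (\<Union>i<n. A i)" for n
    have B: "grid_approx (indicator (B n))" for n
    proof (induction n)
      case 0 show ?case using grid_approx_const[of 0] by (simp add: B_def indicator_def cong: if_cong)
    next
      case (Suc n)
      have "A n \<inter> A i = {}" if "i < n" for i
        using disjoint_family_onD[OF union(1), of n i] that by simp
      then have "A n \<inter> B n = {}" by (auto simp: B_def)
      then have "indicator (B (Suc n)) = (\<lambda>x. indicator (B n) x + indicator (A n) x :: real)"
      proof (intro ext)
        fix x
        have "x \<in> B (Suc n) \<longleftrightarrow> x \<in> B n \<or> x \<in> A n" by (auto simp: B_def less_Suc_eq)
        moreover have "\<not> (x \<in> A n \<and> x \<in> B n)" using \<open>A n \<inter> B n = {}\<close> by blast
        ultimately show "indicator (B (Suc n)) x = (indicator (B n) x + indicator (A n) x :: real)"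
          by (simp add: indicator_def)
      qed
      then show ?case using grid_approx_add[OF Suc union(3)[of n]] by simp
    qed
    show ?case
    proof (rule grid_approx_dominated[OF B, where w = "\<lambda>_. 1"])
      have "(\<lambda>n. indicator (\<Union>i<n. A i) x :: real) \<longlonglongrightarrow> indicator (\<Union>i. A i) x" for x
        by (rule LIMSEQ_indicator_UN)
      then show "AE x in Q. (\<lambda>n. indicator (B n) x :: real) \<longlonglongrightarrow> indicator (\<Union> (range A)) x"
        by (simp add: B_def)
      show "indicator (\<Union> (range A)) \<in> borel_measurable Q"
        using union(2) by (intro borel_measurable_indicator) (auto simp: sets_Q gen[symmetric])
    qed (auto simp: indicator_def)
  qed
qed

lemma grid_approx_integrable:
  assumes "integrable Q f" shows "grid_approx f"
  using assms
proof (induction rule: integrable_induct)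
  case (base A c)
  then have "grid_approx (indicator A)" by (intro grid_approx_indicator) (simp add: sets_Q)
  from grid_approx_cmult[OF this, of c] show ?case by (simp add: mult.commute)
next
  case (add f g) then show ?case by (intro grid_approx_add)
next
  case (lim f s)
  show ?case
    by (rule grid_approx_dominated[where g = s and w = "\<lambda>x. 2 * \<bar>f x\<bar>"]) (use lim in auto)
qed

text \<open>Clipping the values of an approximant to [-K, K] cannot increase its distance from a
  function with values in that interval. The bound has to be kept because it is the only trace that
  the function leaves in the covariance inequality.\<close>

lemma bounded_grid_approx:
  assumes "f \<in> borel_measurable borel" "\<And>x. \<bar>f x\<bar> \<le> K" "0 < e"
  obtains D v where "finite D" "\<forall>l\<in>D. 0 < l" "\<And>w. \<bar>v w\<bar> \<le> K" "(\<integral>x. \<bar>f x - grid_fun D v x\<bar> \<partial>Q) < e"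
proof -
  have f: "integrable Q f" using assms
    by (intro integrable_const_bound[of _ K]) (auto simp: measurable_cong_sets[OF sets_Q refl])
  from grid_approx_integrable[OF this] obtain D v
    where D: "finite D" "\<forall>l\<in>D. 0 < l" "(\<integral>x. \<bar>f x - grid_fun D v x\<bar> \<partial>Q) < e"
    unfolding grid_approx_def using assms(3) by blast
  define v' where "v' w = max (- K) (min K (v w))" for w
  have K: "0 \<le> K" using assms(2)[of undefined] by linarith
  have "(\<integral>x. \<bar>f x - grid_fun D v' x\<bar> \<partial>Q) \<le> (\<integral>x. \<bar>f x - grid_fun D v x\<bar> \<partial>Q)"
  proof (rule integral_mono)
    show "\<bar>f x - grid_fun D v' x\<bar> \<le> \<bar>f x - grid_fun D v x\<bar>" for x
      using assms(2)[of x] unfolding grid_fun_def v'_def by (auto simp: abs_le_iff max_def min_def)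
  qed (use f integrable_grid_fun[OF D(1)] in auto)
  moreover have "\<bar>v' w\<bar> \<le> K" for w using K by (auto simp: v'_def)
  ultimately show ?thesis using that[of D v'] D by force
qed

end

section \<open>The covariance inequality for Lipschitz functionals\<close>

text \<open>\<open>L t\<close> measures the influence of coordinate \<open>t\<close>, and only the
  finitely many coordinates in \<open>A\<close> matter. Lipschitz continuity makes the functionals
  stable under L1 approximation of the coordinates; it is asked on a cube only, so that products of
  coordinates qualify.\<close>

definition lipschitz_on_cube :: "'s set \<Rightarrow> ('s \<Rightarrow> real) \<Rightarrow> real \<Rightarrow> (('s \<Rightarrow> real) \<Rightarrow> real) \<Rightarrow> bool" where
  "lipschitz_on_cube A L K \<Psi> \<longleftrightarrow> finite A \<and> (\<forall>t. 0 \<le> L t) \<and>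
     (\<forall>x y. (\<forall>t. \<bar>x t\<bar> \<le> K) \<longrightarrow> (\<forall>t. \<bar>y t\<bar> \<le> K) \<longrightarrow> \<bar>\<Psi> x - \<Psi> y\<bar> \<le> (\<Sum>t\<in>A. L t * \<bar>x t - y t\<bar>))"

lemma lipschitz_on_cubeD:
  assumes "lipschitz_on_cube A L K \<Psi>"
  shows "finite A" "0 \<le> L t"
    "(\<And>t. \<bar>x t\<bar> \<le> K) \<Longrightarrow> (\<And>t. \<bar>y t\<bar> \<le> K) \<Longrightarrow> \<bar>\<Psi> x - \<Psi> y\<bar> \<le> (\<Sum>t\<in>A. L t * \<bar>x t - y t\<bar>)"
  using assms by (auto simp: lipschitz_on_cube_def)

lemma lipschitz_on_cube_bounded:
  assumes "lipschitz_on_cube A L K \<Psi>" "\<And>t. \<bar>x t\<bar> \<le> K"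
  shows "\<bar>\<Psi> x\<bar> \<le> \<bar>\<Psi> (\<lambda>_. 0)\<bar> + (\<Sum>t\<in>A. L t) * K"
proof -
  have "0 \<le> K" using assms(2)[of undefined] by linarith
  then have "\<bar>\<Psi> x - \<Psi> (\<lambda>_. 0)\<bar> \<le> (\<Sum>t\<in>A. L t * \<bar>x t - 0\<bar>)"
    using assms(2) by (intro lipschitz_on_cubeD(3)[OF assms(1)]) auto
  also have "\<dots> \<le> (\<Sum>t\<in>A. L t * K)"
    using assms(2) lipschitz_on_cubeD(2)[OF assms(1)] by (intro sum_mono mult_left_mono) auto
  finally show ?thesis by (simp add: sum_distrib_right)
qed

lemma lipschitz_on_cube_cong:
  assumes "lipschitz_on_cube A L K \<Psi>" "\<And>t. \<bar>x t\<bar> \<le> K" "\<And>t. \<bar>y t\<bar> \<le> K" "\<And>t. t \<in> A \<Longrightarrow> x t = y t"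
  shows "\<Psi> x = \<Psi> y"
  using lipschitz_on_cubeD(3)[OF assms(1), of x y] assms(2-4) by simp

abbreviation (in prob_space) covar :: "('a \<Rightarrow> real) \<Rightarrow> ('a \<Rightarrow> real) \<Rightarrow> real" where
  "covar F G \<equiv> expectation (\<lambda>\<omega>. F \<omega> * G \<omega>) - expectation F * expectation G"

text \<open>The difference of products is telescoped once for the mean of the product and once for
  the product of the means; hence the two factors 2.\<close>

lemma (in prob_space) covariance_perturb:
  fixes F G F' G' :: "'a \<Rightarrow> real"
  assumes [measurable]: "F \<in> borel_measurable M" "G \<in> borel_measurable M" "F' \<in> borel_measurable M" "G' \<in> borel_measurable M"
    and F: "\<And>\<omega>. \<bar>F \<omega>\<bar> \<le> B" "\<And>\<omega>. \<bar>F' \<omega>\<bar> \<le> B" and G: "\<And>\<omega>. \<bar>G \<omega>\<bar> \<le> C" "\<And>\<omega>. \<bar>G' \<omega>\<bar> \<le> C"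
  shows "\<bar>covar F G\<bar>
    \<le> \<bar>covar F' G'\<bar>
      + 2 * C * expectation (\<lambda>\<omega>. \<bar>F \<omega> - F' \<omega>\<bar>) + 2 * B * expectation (\<lambda>\<omega>. \<bar>G \<omega> - G' \<omega>\<bar>)"
proof -
  have B0: "0 \<le> B" and C0: "0 \<le> C" using F(1)[of undefined] G(1)[of undefined] by linarith+
  have FG: "\<bar>P \<omega> * R \<omega>\<bar> \<le> B * C" if "\<And>\<omega>. \<bar>P \<omega>\<bar> \<le> B" "\<And>\<omega>. \<bar>R \<omega>\<bar> \<le> C" for P R :: "'a \<Rightarrow> real" and \<omega>
    unfolding abs_mult using that B0 by (intro mult_mono) auto
  have i: "integrable M F" "integrable M F'" "integrable M G" "integrable M G'"
    using F by (auto intro!: integrable_const_bound[of _ B])[2] (use G in \<open>auto intro!: integrable_const_bound[of _ C]\<close>)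
  have ii: "integrable M (\<lambda>\<omega>. F \<omega> * G \<omega>)" "integrable M (\<lambda>\<omega>. F' \<omega> * G' \<omega>)"
    using FG[of F G] FG[of F' G'] F G by (auto intro!: integrable_const_bound[of _ "B * C"])
  have "\<bar>expectation (\<lambda>\<omega>. F \<omega> * G \<omega>) - expectation (\<lambda>\<omega>. F' \<omega> * G' \<omega>)\<bar> = \<bar>expectation (\<lambda>\<omega>. F \<omega> * G \<omega> - F' \<omega> * G' \<omega>)\<bar>"
    using ii by simp
  also have "\<dots> \<le> expectation (\<lambda>\<omega>. \<bar>F \<omega> * G \<omega> - F' \<omega> * G' \<omega>\<bar>)"
    by (rule integral_abs_bound)
  also have "\<dots> \<le> expectation (\<lambda>\<omega>. C * \<bar>F \<omega> - F' \<omega>\<bar> + B * \<bar>G \<omega> - G' \<omega>\<bar>)"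
  proof (intro integral_mono)
    fix \<omega>
    have "F \<omega> * G \<omega> - F' \<omega> * G' \<omega> = G \<omega> * (F \<omega> - F' \<omega>) + F' \<omega> * (G \<omega> - G' \<omega>)" by (simp add: algebra_simps)
    also have "\<bar>\<dots>\<bar> \<le> \<bar>G \<omega>\<bar> * \<bar>F \<omega> - F' \<omega>\<bar> + \<bar>F' \<omega>\<bar> * \<bar>G \<omega> - G' \<omega>\<bar>"
      unfolding abs_mult[symmetric] by (rule abs_triangle_ineq)
    also have "\<dots> \<le> C * \<bar>F \<omega> - F' \<omega>\<bar> + B * \<bar>G \<omega> - G' \<omega>\<bar>"
      using F(2) G(1) by (intro add_mono mult_right_mono) auto
    finally show "\<bar>F \<omega> * G \<omega> - F' \<omega> * G' \<omega>\<bar> \<le> C * \<bar>F \<omega> - F' \<omega>\<bar> + B * \<bar>G \<omega> - G' \<omega>\<bar>" .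
  qed (use i ii in auto)
  also have "\<dots> = C * expectation (\<lambda>\<omega>. \<bar>F \<omega> - F' \<omega>\<bar>) + B * expectation (\<lambda>\<omega>. \<bar>G \<omega> - G' \<omega>\<bar>)"
    using i by simp
  finally have 1: "\<bar>expectation (\<lambda>\<omega>. F \<omega> * G \<omega>) - expectation (\<lambda>\<omega>. F' \<omega> * G' \<omega>)\<bar> \<le> \<dots>" .
  have dF: "\<bar>expectation F - expectation F'\<bar> \<le> expectation (\<lambda>\<omega>. \<bar>F \<omega> - F' \<omega>\<bar>)"
    and dG: "\<bar>expectation G - expectation G'\<bar> \<le> expectation (\<lambda>\<omega>. \<bar>G \<omega> - G' \<omega>\<bar>)"
    using i integral_abs_bound[of M "\<lambda>\<omega>. F \<omega> - F' \<omega>"] integral_abs_bound[of M "\<lambda>\<omega>. G \<omega> - G' \<omega>"] by simp_all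
  have EG: "\<bar>expectation G\<bar> \<le> C" and EF: "\<bar>expectation F'\<bar> \<le> B"
    using i F G by (auto intro!: order_trans[OF integral_abs_bound] integral_le_const)
  have "expectation F * expectation G - expectation F' * expectation G'
    = expectation G * (expectation F - expectation F') + expectation F' * (expectation G - expectation G')"
    by (simp add: algebra_simps)
  also have "\<bar>\<dots>\<bar> \<le> \<bar>expectation G\<bar> * \<bar>expectation F - expectation F'\<bar> + \<bar>expectation F'\<bar> * \<bar>expectation G - expectation G'\<bar>"
    unfolding abs_mult[symmetric] by (rule abs_triangle_ineq)
  also have "\<dots> \<le> C * expectation (\<lambda>\<omega>. \<bar>F \<omega> - F' \<omega>\<bar>) + B * expectation (\<lambda>\<omega>. \<bar>G \<omega> - G' \<omega>\<bar>)"
    using EG EF dF dG B0 C0 by (intro add_mono mult_mono) auto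
  finally show ?thesis using 1 by linarith
qed

lemma vec_measurable:
  fixes f :: "'x \<Rightarrow> real ^ 'p"
  assumes "\<And>i. (\<lambda>x. f x $ i) \<in> borel_measurable N"
  shows "f \<in> borel_measurable N"
  using assms by (intro borel_measurable_euclidean_space[THEN iffD2]) (auto simp: Basis_vec_def inner_axis)

locale window_field = stationary_max_id M \<mu> \<eta> \<Phi>
  for M :: "'w measure" and \<mu> :: "(int ^ 'd \<Rightarrow> real) measure" and \<eta> \<Phi> +
  fixes \<tau> :: "'p::finite \<Rightarrow> int ^ 'd"
begin

definition window :: "int ^ 'd \<Rightarrow> 'w \<Rightarrow> real ^ 'p" where
  "window t \<omega> = (\<chi> i. \<eta> (\<tau> i + t) \<omega>)"

lemma window_measurable [measurable]: "window t \<in> borel_measurable M"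
  by (rule vec_measurable) (simp add: window_def)

lemma field_law_shift:
  assumes T: "T \<in> measurable (Pi\<^sub>M UNIV (\<lambda>_. borel)) N"
  shows "distr M N (\<lambda>\<omega>. T (\<lambda>r. \<eta> (r + t) \<omega>)) = distr M N (\<lambda>\<omega>. T (\<lambda>r. \<eta> r \<omega>))"
proof -
  have "(\<lambda>\<omega> r. \<eta> (r + s) \<omega>) \<in> measurable M (Pi\<^sub>M UNIV (\<lambda>_. borel))" for s
    by (rule measurable_PiM_single') auto
  then have law: "distr M N (\<lambda>\<omega>. T (\<lambda>r. \<eta> (r + s) \<omega>)) = distr (shifted_law M \<eta> s) N T" for s
    unfolding shifted_law_def by (subst distr_distr[OF T]) (auto simp: comp_def)
  have "shifted_law M \<eta> t = shifted_law M \<eta> 0" using stationary by (simp add: stationary_field_def)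
  then show ?thesis using law[of 0] unfolding law[of t] by simp
qed

lemma window_pair_law:
  "distr M (borel \<Otimes>\<^sub>M borel) (\<lambda>\<omega>. (window s \<omega>, window t \<omega>)) = distr M (borel \<Otimes>\<^sub>M borel) (\<lambda>\<omega>. (window 0 \<omega>, window (t - s) \<omega>))"
proof -
  define T where "T z = ((\<chi> i. z (\<tau> i)) :: real ^ 'p, (\<chi> i. z (\<tau> i + (t - s))) :: real ^ 'p)" for z :: "int ^ 'd \<Rightarrow> real"
  have T: "T \<in> measurable (Pi\<^sub>M UNIV (\<lambda>_. borel)) (borel \<Otimes>\<^sub>M borel)"
    unfolding T_def by (intro measurable_Pair vec_measurable) auto
  have "T (\<lambda>r. \<eta> (r + s) \<omega>) = (window s \<omega>, window t \<omega>)" "T (\<lambda>r. \<eta> r \<omega>) = (window 0 \<omega>, window (t - s) \<omega>)" for \<omega>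
    by (simp_all add: T_def window_def algebra_simps)
  with field_law_shift[OF T, of s] show ?thesis by simp
qed

lemma window_law: "distr M borel (window t) = distr M borel (window 0)"
proof -
  have "distr (distr M (borel \<Otimes>\<^sub>M borel) (\<lambda>\<omega>. (window s \<omega>, window s \<omega>))) borel fst = distr M borel (window s)" for s
    by (subst distr_distr) (auto simp: comp_def)
  from this[of t] this[of 0] show ?thesis unfolding window_pair_law[of t t] by simp
qed

lemma window_integral:
  fixes f :: "real ^ 'p \<Rightarrow> real"
  assumes [measurable]: "f \<in> borel_measurable borel"
  shows "expectation (\<lambda>\<omega>. f (window t \<omega>)) = expectation (\<lambda>\<omega>. f (window 0 \<omega>))"
    and "integrable M (\<lambda>\<omega>. f (window t \<omega>)) \<longleftrightarrow> integrable M (\<lambda>\<omega>. f (window 0 \<omega>))"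
  using integral_distr[of "window t" M borel f] integral_distr[of "window 0" M borel f]
    integrable_distr_eq[of "window t" M borel f] integrable_distr_eq[of "window 0" M borel f]
  by (simp_all add: window_law[of t])

lemma nonneg_vector_law_window: "nonneg_vector_law (distr M borel (window 0))"
proof -
  interpret Q: prob_space "distr M borel (window 0)" by (rule prob_space_distr) simp
  show ?thesis
  proof
    have "AE \<omega> in M. \<forall>i. 0 \<le> window 0 \<omega> $ i" using \<eta>_nonneg by (auto simp: window_def)
    then show "AE x in distr M borel (window 0). \<forall>i. 0 \<le> x $ i"
      by (subst AE_distr_iff) (auto intro!: borel_closed closed_INT closed_Collect_le continuous_intros simp: Collect_all_eq)
  qed simp
qed

text \<open>All window values can be read off one signature over the sites that occur in the
  windows. A new level at one site changes a window value by at most \<open>2 * K\<close>, so it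
  changes \<Psi>1 through the window \<open>t\<close> by at most \<open>2 * K * L1 t\<close>; the
  product of two such bounds gives \<open>4 * K\<^sup>2\<close>.\<close>

lemma covariance_grid:
  fixes \<Psi>1 \<Psi>2 :: "(int ^ 'd \<Rightarrow> real) \<Rightarrow> real"
  assumes L1: "lipschitz_on_cube A1 L1 K \<Psi>1" and L2: "lipschitz_on_cube A2 L2 K \<Psi>2"
    and D: "finite D" "\<forall>l\<in>D. 0 < l" and v: "\<And>w. \<bar>v w\<bar> \<le> K"
  defines "F \<equiv> \<lambda>\<omega>. \<Psi>1 (\<lambda>t. grid_fun D v (window t \<omega>))" and "G \<equiv> \<lambda>\<omega>. \<Psi>2 (\<lambda>t. grid_fun D v (window t \<omega>))"
  shows "ennreal \<bar>covar F G\<bar>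
    \<le> (\<Sum>t\<in>A1. \<Sum>t'\<in>A2. ennreal (4 * K\<^sup>2 * (L1 t * L2 t')) * (\<Sum>i\<in>UNIV. \<Sum>j\<in>UNIV. pair_coeff (\<tau> i + t) (\<tau> j + t')))"
    and "integrable M F" and "integrable M G"
proof -
  have K: "0 \<le> K" using v[of undefined] by linarith
  note fin = lipschitz_on_cubeD(1)[OF L1] lipschitz_on_cubeD(1)[OF L2]
  define S where "S = (\<lambda>(i, t). \<tau> i + t) ` (UNIV \<times> (A1 \<union> A2))"
  interpret discretized_field M \<mu> \<eta> \<Phi> S D
    by unfold_locales (use fin D in \<open>auto simp: S_def\<close>)
  define lev where "lev w t = v {(i, l). (\<tau> i + t, l) \<in> w}" for w t
  have val: "lev (signature S D (\<lambda>s. \<eta> s \<omega>)) t = grid_fun D v (window t \<omega>)" if "t \<in> A1 \<union> A2" for t \<omega>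
  proof -
    have "\<tau> i + t \<in> S" for i using that by (force simp: S_def)
    then show ?thesis by (simp add: lev_def grid_fun_def signature_def window_def)
  qed
  have eq: "\<Psi> (lev (signature S D (\<lambda>s. \<eta> s \<omega>))) = \<Psi> (\<lambda>t. grid_fun D v (window t \<omega>))"
    if "lipschitz_on_cube A L K \<Psi>" "A \<subseteq> A1 \<union> A2" for \<Psi> A L \<omega>
    by (rule lipschitz_on_cube_cong[OF that(1)]) (use val v that in \<open>auto simp: lev_def grid_fun_def\<close>)
  have osc: "\<bar>\<Psi> (lev (w \<union> w')) - \<Psi> (lev w)\<bar>
      \<le> (\<Sum>x\<in>A \<times> UNIV. (2 * K * L (fst x)) * of_bool (\<exists>l. (\<tau> (snd x) + fst x, l) \<in> w' - w))"
    if \<Psi>: "lipschitz_on_cube A L K \<Psi>" for \<Psi> A L w w'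
  proof -
    have "\<bar>\<Psi> (lev (w \<union> w')) - \<Psi> (lev w)\<bar> \<le> (\<Sum>t\<in>A. L t * \<bar>lev (w \<union> w') t - lev w t\<bar>)"
      by (rule lipschitz_on_cubeD(3)[OF \<Psi>]) (simp_all add: lev_def v)
    also have "\<dots> \<le> (\<Sum>t\<in>A. L t * (\<Sum>i\<in>UNIV. 2 * K * of_bool (\<exists>l. (\<tau> i + t, l) \<in> w' - w)))"
    proof (intro sum_mono mult_left_mono lipschitz_on_cubeD(2)[OF \<Psi>])
      fix t
      show "\<bar>lev (w \<union> w') t - lev w t\<bar> \<le> (\<Sum>i\<in>UNIV. 2 * K * of_bool (\<exists>l. (\<tau> i + t, l) \<in> w' - w))"
      proof (cases "\<exists>i l. (\<tau> i + t, l) \<in> w' - w")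
        case True
        then obtain i where i: "\<exists>l. (\<tau> i + t, l) \<in> w' - w" by blast
        have "\<bar>lev (w \<union> w') t - lev w t\<bar> \<le> 2 * K"
          using v[of "{(i, l). (\<tau> i + t, l) \<in> w \<union> w'}"] v[of "{(i, l). (\<tau> i + t, l) \<in> w}"]
          unfolding lev_def by linarith
        also have "\<dots> = 2 * K * of_bool (\<exists>l. (\<tau> i + t, l) \<in> w' - w)" using i by simp
        also have "\<dots> \<le> (\<Sum>i\<in>UNIV. 2 * K * of_bool (\<exists>l. (\<tau> i + t, l) \<in> w' - w))"
          using K by (intro member_le_sum) auto
        finally show ?thesis .
      next
        case False
        then have "{(i, l). (\<tau> i + t, l) \<in> w \<union> w'} = {(i, l). (\<tau> i + t, l) \<in> w}" by auto
        then show ?thesis using K by (simp add: lev_def sum_nonneg)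
      qed
    qed
    also have "\<dots> = (\<Sum>x\<in>A \<times> UNIV. (2 * K * L (fst x)) * of_bool (\<exists>l. (\<tau> (snd x) + fst x, l) \<in> w' - w))"
      unfolding sum_distrib_left sum.cartesian_product by (intro sum.cong refl) (auto simp: mult_ac)
    finally show ?thesis .
  qed
  let ?I = "A1 \<times> (UNIV :: 'p set)" and ?J = "A2 \<times> (UNIV :: 'p set)"
  have F: "F = (\<lambda>\<omega>. \<Psi>1 (lev (signature S D (\<lambda>s. \<eta> s \<omega>))))" and G: "G = (\<lambda>\<omega>. \<Psi>2 (lev (signature S D (\<lambda>s. \<eta> s \<omega>))))"
    unfolding F_def G_def using eq[OF L1] eq[OF L2] by auto
  note cs = covariance_signature[of ?I ?J "\<lambda>x. 2 * K * L1 (fst x)" "\<lambda>x. 2 * K * L2 (fst x)"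
      "\<lambda>w. \<Psi>1 (lev w)" "\<lambda>x. \<tau> (snd x) + fst x" "\<lambda>w. \<Psi>2 (lev w)" "\<lambda>x. \<tau> (snd x) + fst x"]
  have pos: "0 \<le> 2 * K * L1 (fst x)" "0 \<le> 2 * K * L2 (fst x)" for x
    using K lipschitz_on_cubeD(2)[OF L1] lipschitz_on_cubeD(2)[OF L2] by simp_all
  have finI: "finite ?I" "finite ?J" using fin by auto
  show "integrable M F" unfolding F by (rule cs(2)[OF finI pos osc[OF L1] osc[OF L2]])
  show "integrable M G" unfolding G by (rule cs(3)[OF finI pos osc[OF L1] osc[OF L2]])
  have "ennreal \<bar>covar F G\<bar>
    \<le> (\<Sum>x\<in>?I. \<Sum>y\<in>?J. ennreal (2 * K * L1 (fst x) * (2 * K * L2 (fst y))) * pair_coeff (\<tau> (snd x) + fst x) (\<tau> (snd y) + fst y))"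
    unfolding F G by (rule cs(1)[OF finI pos osc[OF L1] osc[OF L2]])
  also have "\<dots> = (\<Sum>t\<in>A1. \<Sum>i\<in>UNIV. \<Sum>t'\<in>A2. \<Sum>j\<in>UNIV. ennreal (4 * K\<^sup>2 * (L1 t * L2 t')) * pair_coeff (\<tau> i + t) (\<tau> j + t'))"
    by (simp add: sum.cartesian_product' power2_eq_square mult_ac)
  also have "\<dots> = (\<Sum>t\<in>A1. \<Sum>t'\<in>A2. ennreal (4 * K\<^sup>2 * (L1 t * L2 t')) * (\<Sum>i\<in>UNIV. \<Sum>j\<in>UNIV. pair_coeff (\<tau> i + t) (\<tau> j + t')))"
    unfolding sum_distrib_left by (intro sum.cong refl, rule sum.swap)
  finally show "ennreal \<bar>covar F G\<bar> \<le> \<dots>" .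
qed

end

context window_field begin

text \<open>The right side depends on \<open>u\<close> only through \<open>K\<close>, so the bound
  for grid approximants with the same \<open>K\<close> passes to the limit. All windows have the
  same law, hence one approximant, close in L1 under the law of \<open>window 0\<close>, serves
  every site.\<close>

lemma covariance_pair_coeff:
  fixes \<Psi>1 \<Psi>2 :: "(int ^ 'd \<Rightarrow> real) \<Rightarrow> real"
  assumes L1: "lipschitz_on_cube A1 L1 K \<Psi>1" and L2: "lipschitz_on_cube A2 L2 K \<Psi>2"
    and u: "u \<in> borel_measurable borel" "\<And>x. \<bar>u x\<bar> \<le> K"
  defines "F \<equiv> \<lambda>\<omega>. \<Psi>1 (\<lambda>t. u (window t \<omega>))" and "G \<equiv> \<lambda>\<omega>. \<Psi>2 (\<lambda>t. u (window t \<omega>))"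
  assumes meas: "F \<in> borel_measurable M" "G \<in> borel_measurable M"
  shows "ennreal \<bar>covar F G\<bar>
    \<le> (\<Sum>t\<in>A1. \<Sum>t'\<in>A2. ennreal (4 * K\<^sup>2 * (L1 t * L2 t')) * (\<Sum>i\<in>UNIV. \<Sum>j\<in>UNIV. pair_coeff (\<tau> i + t) (\<tau> j + t')))"
    (is "_ \<le> ?R")
proof (rule ennreal_le_epsilon)
  fix e :: real assume e: "0 < e"
  have K: "0 \<le> K" using u(2)[of undefined] by linarith
  define B where "B = \<bar>\<Psi>1 (\<lambda>_. 0)\<bar> + (\<Sum>t\<in>A1. L1 t) * K"
  define C where "C = \<bar>\<Psi>2 (\<lambda>_. 0)\<bar> + (\<Sum>t\<in>A2. L2 t) * K"
  define S1 where "S1 = (\<Sum>t\<in>A1. L1 t)"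
  define S2 where "S2 = (\<Sum>t\<in>A2. L2 t)"
  have S: "0 \<le> S1" "0 \<le> S2"
    using lipschitz_on_cubeD(2)[OF L1] lipschitz_on_cubeD(2)[OF L2] by (auto simp: S1_def S2_def intro!: sum_nonneg)
  have BC: "0 \<le> B" "0 \<le> C" using S K by (auto simp: B_def C_def S1_def S2_def)
  \<comment> \<open>The error in \<open>covariance_perturb\<close> is Z - 1 times the accuracy e /
    Z, so it stays below e; the \<open>1\<close> makes \<open>Z\<close> positive.\<close>
  define Z where "Z = 2 * C * S1 + 2 * B * S2 + 1"
  have Z: "0 < Z" using S BC unfolding Z_def by (intro add_nonneg_pos add_nonneg_nonneg mult_nonneg_nonneg) auto
  interpret Q: nonneg_vector_law "distr M borel (window 0)" by (rule nonneg_vector_law_window)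
  obtain D v where D: "finite D" "\<forall>l\<in>D. 0 < l" and v: "\<And>w. \<bar>v w\<bar> \<le> K"
    and app: "(\<integral>x. \<bar>u x - grid_fun D v x\<bar> \<partial>distr M borel (window 0)) < e / Z"
    using Q.bounded_grid_approx[OF u, of "e / Z"] e Z by auto
  have g_meas: "grid_fun D v \<in> borel_measurable borel" by (rule grid_fun_measurable[OF D(1)])
  have g_le: "\<bar>grid_fun D v x\<bar> \<le> K" for x using v by (simp add: grid_fun_def)
  note u(1)[measurable] g_meas[measurable]
  have site: "expectation (\<lambda>\<omega>. \<bar>u (window t \<omega>) - grid_fun D v (window t \<omega>)\<bar>) \<le> e / Z" for t
  proof -
    have "expectation (\<lambda>\<omega>. \<bar>u (window t \<omega>) - grid_fun D v (window t \<omega>)\<bar>)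
       = expectation (\<lambda>\<omega>. \<bar>u (window 0 \<omega>) - grid_fun D v (window 0 \<omega>)\<bar>)"
      by (rule window_integral(1)[where f = "\<lambda>x. \<bar>u x - grid_fun D v x\<bar>"]) measurable
    also have "\<dots> = (\<integral>x. \<bar>u x - grid_fun D v x\<bar> \<partial>distr M borel (window 0))"
      by (rule integral_distr[symmetric]) measurable
    finally show ?thesis using app by simp
  qed
  have int: "integrable M (\<lambda>\<omega>. u (window t \<omega>))" "integrable M (\<lambda>\<omega>. grid_fun D v (window t \<omega>))" for t
    using u(2) g_le by (auto intro!: integrable_const_bound[of _ K])
  define F' where "F' = (\<lambda>\<omega>. \<Psi>1 (\<lambda>t. grid_fun D v (window t \<omega>)))"
  define G' where "G' = (\<lambda>\<omega>. \<Psi>2 (\<lambda>t. grid_fun D v (window t \<omega>)))"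
  note grid = covariance_grid[OF L1 L2 D, of v, OF v, folded F'_def G'_def]
  have dist: "expectation (\<lambda>\<omega>. \<bar>\<Psi> (\<lambda>t. u (window t \<omega>)) - \<Psi> (\<lambda>t. grid_fun D v (window t \<omega>))\<bar>) \<le> sum L A * (e / Z)"
    if \<Psi>: "lipschitz_on_cube A L K \<Psi>"
      and m: "(\<lambda>\<omega>. \<Psi> (\<lambda>t. u (window t \<omega>))) \<in> borel_measurable M" "(\<lambda>\<omega>. \<Psi> (\<lambda>t. grid_fun D v (window t \<omega>))) \<in> borel_measurable M"
    for \<Psi> A L
  proof -
    have pt: "\<bar>\<Psi> (\<lambda>t. u (window t \<omega>)) - \<Psi> (\<lambda>t. grid_fun D v (window t \<omega>))\<bar>
      \<le> (\<Sum>t\<in>A. L t * \<bar>u (window t \<omega>) - grid_fun D v (window t \<omega>)\<bar>)" for \<omega>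
      by (rule lipschitz_on_cubeD(3)[OF \<Psi>]) (simp_all add: u g_le)
    have "expectation (\<lambda>\<omega>. \<bar>\<Psi> (\<lambda>t. u (window t \<omega>)) - \<Psi> (\<lambda>t. grid_fun D v (window t \<omega>))\<bar>)
      \<le> expectation (\<lambda>\<omega>. \<Sum>t\<in>A. L t * \<bar>u (window t \<omega>) - grid_fun D v (window t \<omega>)\<bar>)"
    proof (rule integral_mono)
      show R: "integrable M (\<lambda>\<omega>. \<Sum>t\<in>A. L t * \<bar>u (window t \<omega>) - grid_fun D v (window t \<omega>)\<bar>)"
        using int by (intro Bochner_Integration.integrable_sum integrable_mult_right integrable_abs Bochner_Integration.integrable_diff)
      show "integrable M (\<lambda>\<omega>. \<bar>\<Psi> (\<lambda>t. u (window t \<omega>)) - \<Psi> (\<lambda>t. grid_fun D v (window t \<omega>))\<bar>)"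
        by (rule Bochner_Integration.integrable_bound[OF R]) (use m pt in \<open>auto intro: order_trans[OF _ abs_ge_self]\<close>)
    qed (rule pt)
    also have "\<dots> = (\<Sum>t\<in>A. L t * expectation (\<lambda>\<omega>. \<bar>u (window t \<omega>) - grid_fun D v (window t \<omega>)\<bar>))"
      using int by (subst Bochner_Integration.integral_sum) auto
    also have "\<dots> \<le> (\<Sum>t\<in>A. L t * (e / Z))"
      using lipschitz_on_cubeD(2)[OF \<Psi>] site by (intro sum_mono mult_left_mono)
    finally show ?thesis by (simp only: sum_distrib_right)
  qed
  have m': "F' \<in> borel_measurable M" "G' \<in> borel_measurable M" using grid(2,3) by auto
  have dF: "expectation (\<lambda>\<omega>. \<bar>F \<omega> - F' \<omega>\<bar>) \<le> S1 * (e / Z)" and dG: "expectation (\<lambda>\<omega>. \<bar>G \<omega> - G' \<omega>\<bar>) \<le> S2 * (e / Z)"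
    using dist[OF L1] dist[OF L2] meas m' unfolding F_def G_def F'_def G'_def S1_def S2_def by auto
  have "\<bar>covar F G\<bar> \<le> \<bar>covar F' G'\<bar> + 2 * C * expectation (\<lambda>\<omega>. \<bar>F \<omega> - F' \<omega>\<bar>) + 2 * B * expectation (\<lambda>\<omega>. \<bar>G \<omega> - G' \<omega>\<bar>)"
  proof (rule covariance_perturb[OF meas m'])
    fix \<omega>
    show "\<bar>F \<omega>\<bar> \<le> B" "\<bar>F' \<omega>\<bar> \<le> B" unfolding F_def F'_def B_def
      by (rule lipschitz_on_cube_bounded[OF L1]; simp add: u g_le)+
    show "\<bar>G \<omega>\<bar> \<le> C" "\<bar>G' \<omega>\<bar> \<le> C" unfolding G_def G'_def C_def
      by (rule lipschitz_on_cube_bounded[OF L2]; simp add: u g_le)+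
  qed
  also have "\<dots> \<le> \<bar>covar F' G'\<bar> + 2 * C * (S1 * (e / Z)) + 2 * B * (S2 * (e / Z))"
    using dF dG BC by (intro add_mono mult_left_mono) auto
  also have "\<dots> = \<bar>covar F' G'\<bar> + (Z - 1) * (e / Z)"
  proof -
    have "Z - 1 = 2 * C * S1 + 2 * B * S2" by (simp add: Z_def)
    then show ?thesis by (simp only: distrib_right mult.assoc add.assoc)
  qed
  also have "\<dots> \<le> \<bar>covar F' G'\<bar> + e"
    using Z e by (simp add: field_simps)
  finally have "ennreal \<bar>covar F G\<bar> \<le> ennreal \<bar>covar F' G'\<bar> + ennreal e"
    using e by (simp flip: ennreal_plus add: ennreal_leI)
  also have "\<dots> \<le> ?R + ennreal e"
    unfolding F'_def G'_def by (intro add_right_mono covariance_grid(1)[OF L1 L2 D] v)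
  finally show "ennreal \<bar>covar F G\<bar> \<le> ?R + ennreal e" .
qed

text \<open>Capped before the conversion to reals, because \<open>enn2real\<close> would send an
  infinite value to 0.\<close>

definition clipped_gamma :: "int ^ 'd \<Rightarrow> real" where
  "clipped_gamma h = enn2real (min 1 (gamma_coeff M \<mu> \<eta> h))"

text \<open>The dependence between two windows at lag \<open>h\<close>: one term for each pair of
  sites, one site from either window. The value 1 marks the lags at which the covariance inequality
  is given up for the trivial bound.\<close>

definition dep :: "int ^ 'd \<Rightarrow> real" where
  "dep h = min 1 (\<Sum>i\<in>UNIV. \<Sum>j\<in>UNIV. clipped_gamma (h + \<tau> j - \<tau> i))"

lemma clipped_gamma_nonneg: "0 \<le> clipped_gamma h"
  by (simp add: clipped_gamma_def)

lemma dep_nonneg: "0 \<le> dep h" and dep_le_1: "dep h \<le> 1"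
  by (auto simp: dep_def clipped_gamma_nonneg intro!: sum_nonneg)

text \<open>A value of \<open>dep\<close> below 1 means that no cap is active, neither the outer one
  nor that of any \<open>clipped_gamma\<close>, so each term is the true \<gamma>.\<close>

lemma pair_coeff_sum_le_dep:
  assumes "dep (t' - t) < 1"
  shows "(\<Sum>i\<in>UNIV. \<Sum>j\<in>UNIV. pair_coeff (\<tau> i + t) (\<tau> j + t')) \<le> ennreal (dep (t' - t))"
proof -
  let ?h = "\<lambda>i j. t' - t + \<tau> j - \<tau> i"
  have d: "dep (t' - t) = (\<Sum>i\<in>UNIV. \<Sum>j\<in>UNIV. clipped_gamma (?h i j))"
    using assms by (auto simp: dep_def min_def split: if_splits)
  have "pair_coeff (\<tau> i + t) (\<tau> j + t') \<le> ennreal (clipped_gamma (?h i j))" for i j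
  proof -
    have "clipped_gamma (?h i j) \<le> (\<Sum>j\<in>UNIV. clipped_gamma (?h i j))"
      by (intro member_le_sum) (auto simp: clipped_gamma_nonneg)
    also have "\<dots> \<le> (\<Sum>i\<in>UNIV. \<Sum>j\<in>UNIV. clipped_gamma (?h i j))"
      by (intro member_le_sum[where f = "\<lambda>i. \<Sum>j\<in>UNIV. clipped_gamma (?h i j)"]) (auto simp: clipped_gamma_nonneg intro!: sum_nonneg)
    finally have "clipped_gamma (?h i j) < 1" using assms d by simp
    then have "gamma_coeff M \<mu> \<eta> (?h i j) < 1"
      unfolding clipped_gamma_def by (cases "gamma_coeff M \<mu> \<eta> (?h i j) < 1") (auto simp: min_def not_less)
    moreover from this have "gamma_coeff M \<mu> \<eta> (?h i j) < top"
      by (rule less_trans) simp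
    ultimately have "ennreal (clipped_gamma (?h i j)) = gamma_coeff M \<mu> \<eta> (?h i j)"
      unfolding clipped_gamma_def by (simp add: min_absorb2)
    moreover have "(\<tau> j + t') - (\<tau> i + t) = ?h i j" by simp
    ultimately show ?thesis using pair_coeff_le_gamma[of "\<tau> i + t" "\<tau> j + t'"] by (simp only:)
  qed
  then have "(\<Sum>i\<in>UNIV. \<Sum>j\<in>UNIV. pair_coeff (\<tau> i + t) (\<tau> j + t')) \<le> (\<Sum>i\<in>UNIV. \<Sum>j\<in>UNIV. ennreal (clipped_gamma (?h i j)))"
    by (intro sum_mono)
  also have "\<dots> = ennreal (dep (t' - t))"
    unfolding d by (simp add: clipped_gamma_nonneg sum_nonneg)
  finally show ?thesis .
qed

text \<open>The covariance inequality in its final form, with \<open>dep\<close> in place of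
  \<gamma>. The assumption \<open>far\<close> keeps to pairs of sites whose cap is inactive: at a
  capped lag \<open>dep\<close> gives no bound on \<open>pair_coeff\<close>.\<close>

theorem covariance_dep:
  fixes \<Psi>1 \<Psi>2 :: "(int ^ 'd \<Rightarrow> real) \<Rightarrow> real"
  assumes L1: "lipschitz_on_cube A1 L1 K \<Psi>1" and L2: "lipschitz_on_cube A2 L2 K \<Psi>2"
    and u: "u \<in> borel_measurable borel" "\<And>x. \<bar>u x\<bar> \<le> K"
  defines "F \<equiv> \<lambda>\<omega>. \<Psi>1 (\<lambda>t. u (window t \<omega>))" and "G \<equiv> \<lambda>\<omega>. \<Psi>2 (\<lambda>t. u (window t \<omega>))"
  assumes meas: "F \<in> borel_measurable M" "G \<in> borel_measurable M"
    and far: "\<And>t t'. t \<in> A1 \<Longrightarrow> t' \<in> A2 \<Longrightarrow> dep (t' - t) < 1"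
  shows "\<bar>covar F G\<bar> \<le> 4 * K\<^sup>2 * (\<Sum>t\<in>A1. \<Sum>t'\<in>A2. L1 t * L2 t' * dep (t' - t))"
proof -
  have pos: "0 \<le> L1 t" "0 \<le> L2 t" for t
    using lipschitz_on_cubeD(2)[OF L1] lipschitz_on_cubeD(2)[OF L2] by auto
  have "ennreal \<bar>covar F G\<bar>
    \<le> (\<Sum>t\<in>A1. \<Sum>t'\<in>A2. ennreal (4 * K\<^sup>2 * (L1 t * L2 t')) * (\<Sum>i\<in>UNIV. \<Sum>j\<in>UNIV. pair_coeff (\<tau> i + t) (\<tau> j + t')))"
    using covariance_pair_coeff[OF L1 L2 u] meas unfolding F_def G_def by blast
  also have "\<dots> \<le> (\<Sum>t\<in>A1. \<Sum>t'\<in>A2. ennreal (4 * K\<^sup>2 * (L1 t * L2 t')) * ennreal (dep (t' - t)))"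
    by (intro sum_mono mult_left_mono pair_coeff_sum_le_dep far) auto
  also have "\<dots> = ennreal (\<Sum>t\<in>A1. \<Sum>t'\<in>A2. 4 * K\<^sup>2 * (L1 t * L2 t') * dep (t' - t))"
    using pos dep_nonneg by (simp add: ennreal_mult'[symmetric] sum_nonneg)
  also have "(\<Sum>t\<in>A1. \<Sum>t'\<in>A2. 4 * K\<^sup>2 * (L1 t * L2 t') * dep (t' - t)) = 4 * K\<^sup>2 * (\<Sum>t\<in>A1. \<Sum>t'\<in>A2. L1 t * L2 t' * dep (t' - t))"
    by (simp add: sum_distrib_left mult.assoc)
  finally show ?thesis
    using pos dep_nonneg by (subst (asm) ennreal_le_iff) (auto intro!: sum_nonneg mult_nonneg_nonneg)
qed

end

section \<open>Counting, summability and averaging on the lattice\<close>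

section \<open>Sums over the lattice\<close>

lemma sup_norm_le_iff: "sup_norm h \<le> m \<longleftrightarrow> (\<forall>i. \<bar>h $ i\<bar> \<le> m)"
  by (auto simp: sup_norm_def)

lemma sup_norm_ge: "\<bar>h $ i\<bar> \<le> sup_norm h"
  by (auto simp: sup_norm_def)

lemma sup_norm_nonneg: "0 \<le> sup_norm h"
  using order_trans[OF abs_ge_zero sup_norm_ge] .

lemma sup_norm_attained: obtains i where "\<bar>h $ i\<bar> = sup_norm h"
proof -
  have "sup_norm h \<in> range (\<lambda>i. \<bar>h $ i\<bar>)" unfolding sup_norm_def by (intro Max_in) auto
  then show ?thesis using that by auto
qed

lemma sup_norm_triangle: "sup_norm (g + h) \<le> sup_norm g + sup_norm h"
  unfolding sup_norm_le_iff
proof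
  fix i show "\<bar>(g + h) $ i\<bar> \<le> sup_norm g + sup_norm h"
    using sup_norm_ge[of g i] sup_norm_ge[of h i] by simp
qed

lemma sup_norm_eq_0_iff: "sup_norm h = 0 \<longleftrightarrow> h = 0"
proof -
  have "sup_norm h = 0 \<longleftrightarrow> sup_norm h \<le> 0" using sup_norm_nonneg[of h] by linarith
  then show ?thesis by (simp add: sup_norm_le_iff vec_eq_iff)
qed

lemma card_lattice_product:
  fixes A :: "'d::finite \<Rightarrow> int set"
  assumes "\<And>i. finite (A i)"
  shows "finite {h :: int ^ 'd. \<forall>i. h $ i \<in> A i}"
    and "card {h :: int ^ 'd. \<forall>i. h $ i \<in> A i} = (\<Prod>i\<in>UNIV. card (A i))"
proof -
  have bij: "bij_betw vec_nth {h :: int ^ 'd. \<forall>i. h $ i \<in> A i} (PiE UNIV A)"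
    unfolding bij_betw_def inj_on_def
  proof (intro conjI ballI impI equalityI subsetI)
    fix f assume "f \<in> PiE UNIV A"
    then have "\<forall>i. vec_lambda f $ i \<in> A i" by auto
    moreover have "f = vec_nth (vec_lambda f)" by (simp add: vec_lambda_inverse)
    ultimately show "f \<in> vec_nth ` {h :: int ^ 'd. \<forall>i. h $ i \<in> A i}" by (intro image_eqI) auto
  qed (auto simp: vec_eq_iff)
  have "finite (PiE UNIV A)" using assms by (intro finite_PiE) auto
  then show "finite {h :: int ^ 'd. \<forall>i. h $ i \<in> A i}" using bij_betw_finite[OF bij] by simp
  show "card {h :: int ^ 'd. \<forall>i. h $ i \<in> A i} = (\<Prod>i\<in>UNIV. card (A i))"
    using bij_betw_same_card[OF bij] by (simp add: card_PiE)
qed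

lemma card_sup_norm_ball:
  "finite {h :: int ^ 'd. sup_norm h \<le> int m}" "card {h :: int ^ 'd. sup_norm h \<le> int m} = (2 * m + 1) ^ CARD('d)"
proof -
  have eq: "{h :: int ^ 'd. sup_norm h \<le> int m} = {h. \<forall>i. h $ i \<in> {- int m..int m}}"
    by (auto simp: sup_norm_le_iff abs_le_iff; smt (verit))
  show "finite {h :: int ^ 'd. sup_norm h \<le> int m}" unfolding eq by (rule card_lattice_product) simp
  show "card {h :: int ^ 'd. sup_norm h \<le> int m} = (2 * m + 1) ^ CARD('d)"
  proof -
    have "card {- int m..int m} = 2 * m + 1" by (simp add: nat_eq_iff)
    then show ?thesis unfolding eq by (subst card_lattice_product(2)) simp_all
  qed
qed

text \<open>Some coordinate equals \<open>m\<close> or \<open>- m\<close>. There are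
  \<open>CARD('d)\<close> ways to select it, 2 values for it and at most 2 m + 1 values for each of
  the others.\<close>

lemma card_sup_norm_sphere:
  "card {h :: int ^ 'd. sup_norm h = int m} \<le> 2 * CARD('d) * (2 * m + 1) ^ (CARD('d) - 1)"
proof -
  define A where "A i j = (if j = i then {int m, - int m} else {- int m..int m})" for i j :: 'd
  have finA: "finite (A i j)" for i j by (simp add: A_def)
  have "{h :: int ^ 'd. sup_norm h = int m} \<subseteq> (\<Union>i. {h. \<forall>j. h $ j \<in> A i j})"
  proof
    fix h :: "int ^ 'd" assume h: "h \<in> {h. sup_norm h = int m}"
    obtain i where i: "\<bar>h $ i\<bar> = sup_norm h" by (rule sup_norm_attained)
    have "h $ j \<in> A i j" for j
      using h i sup_norm_ge[of h j] by (auto simp: A_def abs_le_iff abs_eq_iff')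
    then show "h \<in> (\<Union>i. {h. \<forall>j. h $ j \<in> A i j})" by auto
  qed
  then have "card {h :: int ^ 'd. sup_norm h = int m} \<le> card (\<Union>i. {h :: int ^ 'd. \<forall>j. h $ j \<in> A i j})"
    by (intro card_mono finite_UN_I card_lattice_product(1) finA) auto
  also have "\<dots> \<le> (\<Sum>i\<in>UNIV. card {h :: int ^ 'd. \<forall>j. h $ j \<in> A i j})"
    by (rule card_UN_le) simp
  also have "\<dots> \<le> (\<Sum>i\<in>(UNIV :: 'd set). 2 * (2 * m + 1) ^ (CARD('d) - 1))"
  proof (rule sum_mono)
    fix i :: 'd
    have "card {h :: int ^ 'd. \<forall>j. h $ j \<in> A i j} = (\<Prod>j\<in>UNIV. card (A i j))"
      by (rule card_lattice_product(2)[OF finA])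
    also have "\<dots> = card (A i i) * (\<Prod>j\<in>UNIV - {i}. card (A i j))"
      by (subst prod.remove[of UNIV i]) auto
    also have "(\<Prod>j\<in>UNIV - {i}. card (A i j)) = (\<Prod>j\<in>UNIV - {i}. 2 * m + 1)"
      by (intro prod.cong refl) (auto simp: A_def nat_eq_iff)
    also have "\<dots> = (2 * m + 1) ^ (CARD('d) - 1)" by simp
    also have "card (A i i) * \<dots> \<le> 2 * \<dots>" by (intro mult_right_mono) (auto simp: A_def card_insert_if)
    finally show "card {h :: int ^ 'd. \<forall>j. h $ j \<in> A i j} \<le> 2 * (2 * m + 1) ^ (CARD('d) - 1)" .
  qed
  finally show ?thesis by simp
qed

text \<open>Grouping by norm: a sphere of radius m has O(m^(d-1)) points, which is the weight in the
  series. The bound \<open>s\<close> is extended-valued, as suprema of powers of \<gamma> may be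
  infinite a priori; the origin, which the series omits, is a single term.\<close>

lemma summable_on_lattice_radial:
  fixes b :: "int ^ 'd \<Rightarrow> real" and s :: "nat \<Rightarrow> ennreal"
  assumes b: "\<And>h. 0 \<le> b h" "\<And>h. h \<noteq> 0 \<Longrightarrow> ennreal (b h) \<le> s (nat (sup_norm h))"
    and s: "(\<Sum>\<^sub>\<infinity>m\<in>{1..}. of_nat m ^ (CARD('d) - 1) * s m) < \<infinity>"
  shows "b summable_on UNIV"
proof -
  \<comment> \<open>From the count of a sphere, with 2 m + 1 \<le> 3 m for m \<ge> 1.\<close>
  define C :: nat where "C = 2 * CARD('d) * 3 ^ (CARD('d) - 1)"
  define T where "T = of_nat C * (\<Sum>\<^sub>\<infinity>m\<in>{1..}. of_nat m ^ (CARD('d) - 1) * s m)"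
  have T: "T < \<infinity>" using s unfolding T_def by (simp add: ennreal_mult_less_top of_nat_less_top)
  have bound: "sum b F \<le> enn2real T" if F: "finite F" "F \<subseteq> - {0}" for F
  proof -
    define N where "N = (\<lambda>h. nat (sup_norm h)) ` F"
    have N: "finite N" "N \<subseteq> {1..}"
    proof -
      have "1 \<le> nat (sup_norm h)" if "h \<in> F" for h
      proof -
        have "sup_norm h \<noteq> 0" using that F(2) sup_norm_eq_0_iff[of h] by auto
        then show ?thesis using sup_norm_nonneg[of h] by linarith
      qed
      then show "N \<subseteq> {1..}" unfolding N_def by auto
      show "finite N" using F(1) by (simp add: N_def)
    qed
    have "ennreal (sum b F) = (\<Sum>h\<in>F. ennreal (b h))" using b by simp
    also have "\<dots> \<le> (\<Sum>h\<in>F. s (nat (sup_norm h)))"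
    proof (intro sum_mono b(2))
      fix h assume "h \<in> F" then show "h \<noteq> 0" using F(2) by auto
    qed
    also have "\<dots> = (\<Sum>m\<in>N. \<Sum>h\<in>{h \<in> F. nat (sup_norm h) = m}. s (nat (sup_norm h)))"
      unfolding N_def by (rule sum.image_gen[OF F(1)])
    also have "\<dots> = (\<Sum>m\<in>N. of_nat (card {h \<in> F. nat (sup_norm h) = m}) * s m)"
      by (intro sum.cong refl) simp
    also have "\<dots> \<le> (\<Sum>m\<in>N. of_nat (C * m ^ (CARD('d) - 1)) * s m)"
    proof (intro sum_mono mult_right_mono of_nat_mono)
      fix m assume "m \<in> N"
      then have m: "1 \<le> m" using N by auto
      have "finite {h :: int ^ 'd. sup_norm h = int m}"
        by (rule finite_subset[OF _ card_sup_norm_ball(1)[of m]]) auto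
      then have "card {h \<in> F. nat (sup_norm h) = m} \<le> card {h :: int ^ 'd. sup_norm h = int m}"
        using m by (intro card_mono) auto
      also have "\<dots> \<le> 2 * CARD('d) * (2 * m + 1) ^ (CARD('d) - 1)" by (rule card_sup_norm_sphere)
      also have "\<dots> \<le> 2 * CARD('d) * (3 * m) ^ (CARD('d) - 1)" using m by (intro mult_left_mono power_mono) auto
      also have "\<dots> = C * m ^ (CARD('d) - 1)" by (simp add: C_def power_mult_distrib)
      finally show "card {h \<in> F. nat (sup_norm h) = m} \<le> C * m ^ (CARD('d) - 1)" .
    qed simp
    also have "\<dots> = of_nat C * (\<Sum>m\<in>N. of_nat m ^ (CARD('d) - 1) * s m)"
      by (simp add: sum_distrib_left mult.assoc)
    also have "\<dots> \<le> T"
      unfolding T_def nonneg_infsum_complete[OF zero_le] using N by (intro mult_left_mono SUP_upper) auto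
    finally have "enn2real (ennreal (sum b F)) \<le> enn2real T" using T by (intro enn2real_mono) auto
    then show ?thesis using b by (simp add: sum_nonneg)
  qed
  have "b summable_on - {0}"
    by (rule nonneg_bdd_above_summable_on) (use b bound in \<open>auto intro!: bdd_aboveI[of _ "enn2real T"]\<close>)
  then have "b summable_on (- {0} \<union> {0})" by (intro summable_on_Un_disjoint) auto
  moreover have "- {0} \<union> {0} = (UNIV :: (int ^ 'd) set)" by auto
  ultimately show ?thesis by (simp only:)
qed

text \<open>A number z in [0, 1] is at most its q-th power for q \<le> 1; this is applied to the
  shares of x and y in their sum.\<close>

lemma powr_sum_le:
  fixes f :: "'i \<Rightarrow> real"
  assumes "\<And>i. i \<in> A \<Longrightarrow> 0 \<le> f i" "0 < q" "q \<le> 1"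
  shows "(\<Sum>i\<in>A. f i) powr q \<le> (\<Sum>i\<in>A. f i powr q)"
proof -
  have two: "(x + y) powr q \<le> x powr q + y powr q" if "0 \<le> x" "0 \<le> y" for x y :: real
  proof (cases "x + y = 0")
    case True then show ?thesis by simp
  next
    case False
    define s where "s = x + y"
    have s: "0 < s" using that False by (simp add: s_def)
    have le: "z / s \<le> (z / s) powr q" if "0 \<le> z" "z \<le> s" for z
      using powr_mono'[of q 1 "z / s"] assms(3) that s by simp
    have "s powr q = s powr q * (x / s + y / s)" using s by (simp add: add_divide_distrib[symmetric] s_def)
    also have "\<dots> \<le> s powr q * ((x / s) powr q + (y / s) powr q)"
      using that by (intro mult_left_mono add_mono le) (auto simp: s_def)
    also have "\<dots> = x powr q + y powr q" using s that by (simp add: powr_divide distrib_left)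
    finally show ?thesis by (simp add: s_def)
  qed
  show ?thesis using assms(1)
  proof (induction A rule: infinite_finite_induct)
    case (insert a A)
    have "(\<Sum>i\<in>insert a A. f i) powr q \<le> f a powr q + (\<Sum>i\<in>A. f i) powr q"
      using insert by (simp add: two sum_nonneg)
    then show ?case using insert by simp
  qed simp_all
qed

text \<open>A path of \<open>sup_norm h\<close> unit steps from \<open>s\<close> to
  \<open>s + h\<close> has to cross the boundary of \<open>S\<close>. The induction looks at the
  first step: either it leaves \<open>S\<close> at once, so that \<open>s\<close> is a boundary
  point, or the remaining shift leads out of \<open>S\<close> from the next site.\<close>

lemma card_exits_le:
  fixes S :: "(int ^ 'd) set"
  assumes "finite S"
  shows "card {s \<in> S. s + h \<notin> S} \<le> nat (sup_norm h) * card (lattice_boundary S)"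
proof (induction "nat (sup_norm h)" arbitrary: h)
  case 0
  then have "h = 0" using sup_norm_nonneg[of h] by (simp add: sup_norm_eq_0_iff[symmetric])
  then show ?case by simp
next
  case (Suc n)
  \<comment> \<open>Subtracting the sign from every coordinate lowers all maximal ones at once, so
    \<open>h - e\<close> has norm exactly one less, while \<open>e\<close> has norm 1.\<close>
  define e :: "int ^ 'd" where "e = (\<chi> i. sgn (h $ i))"
  define g where "g = h - e"
  have h: "sup_norm h = int (Suc n)" using Suc(2) by linarith
  obtain i where i: "\<bar>h $ i\<bar> = sup_norm h" by (rule sup_norm_attained)
  have "sup_norm e \<le> 1" unfolding sup_norm_le_iff by (auto simp: e_def sgn_if)
  moreover have "1 \<le> \<bar>e $ i\<bar>" using i h by (auto simp: e_def sgn_if)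
  ultimately have e: "sup_norm e = 1" using sup_norm_ge[of e i] by linarith
  have "sup_norm g \<le> int n" unfolding sup_norm_le_iff
  proof
    fix j show "\<bar>g $ j\<bar> \<le> int n" using sup_norm_ge[of h j] h by (auto simp: g_def e_def sgn_if)
  qed
  moreover have "\<bar>g $ i\<bar> = int n" using i h by (auto simp: g_def e_def sgn_if)
  ultimately have g: "sup_norm g = int n" using sup_norm_ge[of g i] by linarith
  have "{s \<in> S. s + h \<notin> S} \<subseteq> lattice_boundary S \<union> (\<lambda>s. s - e) ` {s \<in> S. s + g \<notin> S}"
  proof
    fix s assume s: "s \<in> {s \<in> S. s + h \<notin> S}"
    show "s \<in> lattice_boundary S \<union> (\<lambda>s. s - e) ` {s \<in> S. s + g \<notin> S}"
    proof (cases "s + e \<in> S")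
      case True
      have "s = (s + e) - e" "s + e + g = s + h" by (simp_all add: g_def)
      then show ?thesis using s True by (intro UnI2 image_eqI[of _ _ "s + e"]) (auto simp: add.assoc)
    next
      case False
      have "sup_norm (s - (s + e)) = 1" using e by (simp add: sup_norm_def)
      then show ?thesis using s False by (auto simp: lattice_boundary_def)
    qed
  qed
  moreover have fin: "finite (lattice_boundary S)" using assms by (simp add: lattice_boundary_def)
  ultimately have "card {s \<in> S. s + h \<notin> S} \<le> card (lattice_boundary S \<union> (\<lambda>s. s - e) ` {s \<in> S. s + g \<notin> S})"
    using assms by (intro card_mono) auto
  also have "\<dots> \<le> card (lattice_boundary S) + card ((\<lambda>s. s - e) ` {s \<in> S. s + g \<notin> S})" by (rule card_Un_le)
  also have "\<dots> \<le> card (lattice_boundary S) + card {s \<in> S. s + g \<notin> S}"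
    using assms by (intro add_left_mono card_image_le) auto
  also have "\<dots> \<le> card (lattice_boundary S) + nat (sup_norm g) * card (lattice_boundary S)"
    using Suc(1)[of g] g by simp
  also have "\<dots> = nat (sup_norm h) * card (lattice_boundary S)"
  proof -
    have "nat (sup_norm h) = Suc (nat (sup_norm g))" using g h by simp
    then show ?thesis by simp
  qed
  finally show ?case .
qed

text \<open>For each \<open>s\<close> the inner sum misses precisely the lags that lead out of
  \<open>S\<close>. Those in \<open>H\<close> are counted by \<open>card_exits_le\<close>; the
  others cost at most the tail of the series, once per site.\<close>

lemma cesaro_bound:
  fixes c :: "int ^ 'd \<Rightarrow> real"
  assumes c: "(\<lambda>h. \<bar>c h\<bar>) summable_on UNIV" and S: "finite S" and H: "finite H"
  shows "\<bar>(\<Sum>s\<in>S. \<Sum>t\<in>S. c (t - s)) - real (card S) * (\<Sum>\<^sub>\<infinity>h. c h)\<bar>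
    \<le> (\<Sum>h\<in>H. \<bar>c h\<bar> * nat (sup_norm h)) * card (lattice_boundary S) + real (card S) * (\<Sum>\<^sub>\<infinity>h\<in>-H. \<bar>c h\<bar>)"
proof -
  have cs: "c summable_on A" "(\<lambda>h. \<bar>c h\<bar>) summable_on A" for A
  proof -
    show "(\<lambda>h. \<bar>c h\<bar>) summable_on A" by (rule summable_on_subset_banach[OF c subset_UNIV])
    from this show "c summable_on A" by (rule abs_summable_summable[where f = c, unfolded real_norm_def])
  qed
  define T where "T s = (\<lambda>t. t - s) ` S" for s
  have site: "\<bar>(\<Sum>t\<in>S. c (t - s)) - (\<Sum>\<^sub>\<infinity>h. c h)\<bar> \<le> (\<Sum>h\<in>H. \<bar>c h\<bar> * of_bool (s + h \<notin> S)) + (\<Sum>\<^sub>\<infinity>h\<in>-H. \<bar>c h\<bar>)" for s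
  proof -
    have T: "finite (T s)" using S by (simp add: T_def)
    have mem: "h \<in> T s \<longleftrightarrow> s + h \<in> S" for h unfolding T_def by (auto intro!: image_eqI[of _ _ "s + h"])
    have "(\<Sum>t\<in>S. c (t - s)) = sum c (T s)" unfolding T_def by (subst sum.reindex) (auto simp: inj_on_def)
    moreover have "(\<Sum>\<^sub>\<infinity>h. c h) = sum c (T s) + (\<Sum>\<^sub>\<infinity>h\<in>-T s. c h)"
      using infsum_Un_disjoint[OF cs(1)[of "T s"] cs(1)[of "- T s"]] T by simp
    ultimately have "\<bar>(\<Sum>t\<in>S. c (t - s)) - (\<Sum>\<^sub>\<infinity>h. c h)\<bar> = \<bar>\<Sum>\<^sub>\<infinity>h\<in>-T s. c h\<bar>" by simp
    also have "\<dots> \<le> (\<Sum>\<^sub>\<infinity>h\<in>-T s. \<bar>c h\<bar>)"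
      using norm_infsum_bound[of c "- T s"] cs(2)[of "- T s"] by simp
    also have "\<dots> \<le> (\<Sum>\<^sub>\<infinity>h\<in>(H - T s) \<union> -H. \<bar>c h\<bar>)"
      by (intro infsum_mono_neutral cs) auto
    also have "\<dots> = (\<Sum>\<^sub>\<infinity>h\<in>H - T s. \<bar>c h\<bar>) + (\<Sum>\<^sub>\<infinity>h\<in>-H. \<bar>c h\<bar>)"
      by (intro infsum_Un_disjoint cs) auto
    also have "(\<Sum>\<^sub>\<infinity>h\<in>H - T s. \<bar>c h\<bar>) = (\<Sum>h\<in>H. \<bar>c h\<bar> * of_bool (s + h \<notin> S))"
      using H by (simp add: mem[symmetric] sum.mono_neutral_left[of H "H - T s"]) (intro sum.mono_neutral_cong_left; auto)
    finally show ?thesis .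
  qed
  have "\<bar>(\<Sum>s\<in>S. \<Sum>t\<in>S. c (t - s)) - real (card S) * (\<Sum>\<^sub>\<infinity>h. c h)\<bar> = \<bar>\<Sum>s\<in>S. ((\<Sum>t\<in>S. c (t - s)) - (\<Sum>\<^sub>\<infinity>h. c h))\<bar>"
    by (simp add: sum_subtractf)
  also have "\<dots> \<le> (\<Sum>s\<in>S. (\<Sum>h\<in>H. \<bar>c h\<bar> * of_bool (s + h \<notin> S)) + (\<Sum>\<^sub>\<infinity>h\<in>-H. \<bar>c h\<bar>))"
    by (intro order_trans[OF sum_abs] sum_mono site)
  also have "\<dots> = (\<Sum>s\<in>S. \<Sum>h\<in>H. \<bar>c h\<bar> * of_bool (s + h \<notin> S)) + real (card S) * (\<Sum>\<^sub>\<infinity>h\<in>-H. \<bar>c h\<bar>)"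
    by (simp add: sum.distrib)
  also have "(\<Sum>s\<in>S. \<Sum>h\<in>H. \<bar>c h\<bar> * of_bool (s + h \<notin> S)) = (\<Sum>h\<in>H. \<bar>c h\<bar> * real (card {s \<in> S. s + h \<notin> S}))"
    using S by (subst sum.swap) (simp add: sum_distrib_left[symmetric] of_bool_def sum.If_cases Int_def)
  also have "\<dots> \<le> (\<Sum>h\<in>H. \<bar>c h\<bar> * (real (nat (sup_norm h)) * real (card (lattice_boundary S))))"
    using card_exits_le[OF S] by (intro sum_mono mult_left_mono) (simp_all flip: of_nat_mult)
  also have "\<dots> = (\<Sum>h\<in>H. \<bar>c h\<bar> * nat (sup_norm h)) * card (lattice_boundary S)"
    by (simp add: sum_distrib_right mult.assoc)
  finally show ?thesis by simp
qed

text \<open>Stated for all finite supersets of \<open>H\<close>, so that \<open>H\<close> can later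
  be enlarged to a symmetric set.\<close>

lemma infsum_tail_small:
  fixes f :: "'i \<Rightarrow> real"
  assumes "f summable_on UNIV" "0 < e"
  obtains H where "finite H" "\<And>H'. H \<subseteq> H' \<Longrightarrow> finite H' \<Longrightarrow> (\<Sum>\<^sub>\<infinity>h\<in>-H'. f h) < e"
proof -
  have "(sum f \<longlongrightarrow> infsum f UNIV) (finite_subsets_at_top UNIV)"
    using has_sum_infsum[OF assms(1)] by (simp add: has_sum_def)
  from tendstoD[OF this assms(2)] obtain H where H: "finite H"
    "\<And>H'. finite H' \<Longrightarrow> H \<subseteq> H' \<Longrightarrow> dist (sum f H') (infsum f UNIV) < e"
    unfolding eventually_finite_subsets_at_top by auto
  have "(\<Sum>\<^sub>\<infinity>h\<in>-H'. f h) < e" if "H \<subseteq> H'" "finite H'" for H'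
  proof -
    have sub: "f summable_on A" for A using assms(1) by (rule summable_on_subset_banach) simp
    have "infsum f UNIV = sum f H' + (\<Sum>\<^sub>\<infinity>h\<in>-H'. f h)"
      using infsum_Un_disjoint[OF sub[of H'] sub[of "- H'"]] that by simp
    then show ?thesis using H(2)[OF that(2,1)] by (simp add: dist_real_def)
  qed
  then show ?thesis using that H(1) by blast
qed

lemma cesaro_covariance:
  fixes c :: "int ^ 'd \<Rightarrow> real" and \<Lambda> :: "nat \<Rightarrow> (int ^ 'd) set"
  assumes c: "(\<lambda>h. \<bar>c h\<bar>) summable_on UNIV" and fin: "\<And>n. finite (\<Lambda> n)" and ne: "\<forall>\<^sub>F n in sequentially. \<Lambda> n \<noteq> {}"
    and bd: "(\<lambda>n. real (card (lattice_boundary (\<Lambda> n))) / real (card (\<Lambda> n))) \<longlonglongrightarrow> 0"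
  shows "(\<lambda>n. (\<Sum>s\<in>\<Lambda> n. \<Sum>t\<in>\<Lambda> n. c (t - s)) / real (card (\<Lambda> n))) \<longlonglongrightarrow> (\<Sum>\<^sub>\<infinity>h. c h)"
proof (rule tendstoI)
  fix e :: real assume e: "0 < e"
  obtain H where H: "finite H" "\<And>H'. H \<subseteq> H' \<Longrightarrow> finite H' \<Longrightarrow> (\<Sum>\<^sub>\<infinity>h\<in>-H'. \<bar>c h\<bar>) < e / 2"
    using infsum_tail_small[OF c, of "e / 2"] e by auto
  define P where "P = (\<Sum>h\<in>H. \<bar>c h\<bar> * nat (sup_norm h))"
  have "(\<lambda>n. P * (real (card (lattice_boundary (\<Lambda> n))) / real (card (\<Lambda> n)))) \<longlonglongrightarrow> P * 0"
    by (intro tendsto_intros bd)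
  then have "\<forall>\<^sub>F n in sequentially. P * (real (card (lattice_boundary (\<Lambda> n))) / real (card (\<Lambda> n))) < e / 2"
    using e by (intro order_tendstoD) auto
  then show "\<forall>\<^sub>F n in sequentially. dist ((\<Sum>s\<in>\<Lambda> n. \<Sum>t\<in>\<Lambda> n. c (t - s)) / real (card (\<Lambda> n))) (\<Sum>\<^sub>\<infinity>h. c h) < e"
    using ne
  proof eventually_elim
    case (elim n)
    have N: "0 < real (card (\<Lambda> n))" using elim fin by (simp add: card_gt_0_iff)
    have "dist ((\<Sum>s\<in>\<Lambda> n. \<Sum>t\<in>\<Lambda> n. c (t - s)) / real (card (\<Lambda> n))) (\<Sum>\<^sub>\<infinity>h. c h)
      = \<bar>(\<Sum>s\<in>\<Lambda> n. \<Sum>t\<in>\<Lambda> n. c (t - s)) - real (card (\<Lambda> n)) * (\<Sum>\<^sub>\<infinity>h. c h)\<bar> / real (card (\<Lambda> n))"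
    proof -
      have "x / N - y = (x - N * y) / N" if "0 < N" for x y N :: real using that by (simp add: diff_divide_distrib)
      from this[OF N] show ?thesis using N by (simp add: dist_real_def)
    qed
    also have "\<dots> \<le> (P * card (lattice_boundary (\<Lambda> n)) + real (card (\<Lambda> n)) * (\<Sum>\<^sub>\<infinity>h\<in>-H. \<bar>c h\<bar>)) / real (card (\<Lambda> n))"
      unfolding P_def using N by (intro divide_right_mono cesaro_bound c fin H) auto
    also have "\<dots> = P * (real (card (lattice_boundary (\<Lambda> n))) / real (card (\<Lambda> n))) + (\<Sum>\<^sub>\<infinity>h\<in>-H. \<bar>c h\<bar>)"
      using N by (simp add: add_divide_distrib)
    also have "\<dots> < e / 2 + e / 2" using elim H(2)[of H] H(1) by (intro add_strict_mono) auto
    finally show ?case by simp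
  qed
qed

text \<open>The boundary of a ball lies in its sphere, which is smaller than the ball by a factor of
  order 1 / n. The balls supply one admissible sequence, from which the limiting variance is seen to
  be nonnegative.\<close>

lemma lattice_balls_van_hove:
  "(\<lambda>n. real (card (lattice_boundary {h :: int ^ 'd. sup_norm h \<le> int n})) / real (card {h :: int ^ 'd. sup_norm h \<le> int n})) \<longlonglongrightarrow> 0"
proof (rule tendsto_sandwich[OF _ _ tendsto_const])
  show "\<forall>\<^sub>F n in sequentially. real (card (lattice_boundary {h :: int ^ 'd. sup_norm h \<le> int n})) / real (card {h :: int ^ 'd. sup_norm h \<le> int n})
    \<le> real (2 * CARD('d)) * (1 / real (2 * n + 1))"
  proof (intro always_eventually allI)
    fix n
    have "lattice_boundary {h :: int ^ 'd. sup_norm h \<le> int n} \<subseteq> {h. sup_norm h = int n}"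
    proof
      fix h :: "int ^ 'd" assume "h \<in> lattice_boundary {h. sup_norm h \<le> int n}"
      then obtain h' where h: "sup_norm h \<le> int n" "\<not> sup_norm h' \<le> int n" "sup_norm (h - h') = 1"
        by (auto simp: lattice_boundary_def)
      have "sup_norm (h' - h) = 1" using h(3) by (simp add: sup_norm_def abs_minus_commute)
      then have "sup_norm h' \<le> sup_norm h + 1" using sup_norm_triangle[of h "h' - h"] by simp
      then show "h \<in> {h. sup_norm h = int n}" using h by simp
    qed
    moreover have "finite {h :: int ^ 'd. sup_norm h = int n}"
      by (rule finite_subset[OF _ card_sup_norm_ball(1)[of n]]) auto
    ultimately have "card (lattice_boundary {h :: int ^ 'd. sup_norm h \<le> int n}) \<le> card {h :: int ^ 'd. sup_norm h = int n}"
      by (intro card_mono)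
    also have "\<dots> \<le> 2 * CARD('d) * (2 * n + 1) ^ (CARD('d) - 1)" by (rule card_sup_norm_sphere)
    finally have "real (card (lattice_boundary {h :: int ^ 'd. sup_norm h \<le> int n})) \<le> real (2 * CARD('d)) * real (2 * n + 1) ^ (CARD('d) - 1)"
      by (metis of_nat_le_iff of_nat_mult of_nat_power)
    then have "real (card (lattice_boundary {h :: int ^ 'd. sup_norm h \<le> int n})) / real (2 * n + 1) ^ CARD('d)
      \<le> real (2 * CARD('d)) * real (2 * n + 1) ^ (CARD('d) - 1) / real (2 * n + 1) ^ CARD('d)"
      by (intro divide_right_mono) auto
    also have "real (2 * n + 1) ^ CARD('d) = real (2 * n + 1) * real (2 * n + 1) ^ (CARD('d) - 1)"
      by (simp flip: power_Suc)
    also have "real (2 * CARD('d)) * real (2 * n + 1) ^ (CARD('d) - 1) / (real (2 * n + 1) * real (2 * n + 1) ^ (CARD('d) - 1))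
      = real (2 * CARD('d)) * (1 / real (2 * n + 1))"
      by (subst nonzero_mult_divide_mult_cancel_right) auto
    finally show "real (card (lattice_boundary {h :: int ^ 'd. sup_norm h \<le> int n})) / real (card {h :: int ^ 'd. sup_norm h \<le> int n})
      \<le> real (2 * CARD('d)) * (1 / real (2 * n + 1))"
      unfolding card_sup_norm_ball of_nat_power by (simp flip: power_Suc)
  qed
  have "(\<lambda>n. 1 / real (2 * n + 1)) \<longlonglongrightarrow> 0"
  proof (rule tendsto_sandwich[OF _ _ tendsto_const LIMSEQ_inverse_real_of_nat])
    show "\<forall>\<^sub>F n in sequentially. 1 / real (2 * n + 1) \<le> inverse (real (Suc n))"
      by (intro always_eventually allI) (simp add: field_simps)
  qed simp
  from tendsto_mult_left[OF this, of "real (2 * CARD('d))"]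
  show "(\<lambda>n. real (2 * CARD('d)) * (1 / real (2 * n + 1))) \<longlonglongrightarrow> 0" by simp
qed simp

section \<open>Gaussian approximation for bounded summands\<close>

section \<open>Characteristic functions and approximate Gaussian equations\<close>

lemma iexp_bounds:
  "cmod (iexp x - 1) \<le> \<bar>x\<bar>" "cmod (iexp x - 1 - \<i> * x) \<le> x\<^sup>2 / 2"
  using iexp_approx1[of x 0] iexp_approx1[of x 1] by (simp_all add: power2_eq_square algebra_simps)

lemma (in prob_space) integrable_bounded_complex:
  fixes f :: "'a \<Rightarrow> complex"
  assumes "f \<in> borel_measurable M" "\<And>\<omega>. cmod (f \<omega>) \<le> B"
  shows "integrable M f"
  using assms by (intro integrable_const_bound[of _ B]) auto

lemma (in prob_space) integrable_bounded_real:
  fixes f :: "'a \<Rightarrow> real"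
  assumes "f \<in> borel_measurable M" "\<And>\<omega>. \<bar>f \<omega>\<bar> \<le> B"
  shows "integrable M f"
  using assms by (intro integrable_const_bound[of _ B]) auto

lemma (in prob_space) expectation_cmod_le:
  fixes f :: "'a \<Rightarrow> complex"
  assumes "f \<in> borel_measurable M" "\<And>\<omega>. cmod (f \<omega>) \<le> B"
  shows "cmod (expectation f) \<le> B"
proof -
  have "cmod (expectation f) \<le> expectation (\<lambda>\<omega>. cmod (f \<omega>))" by (rule integral_norm_bound)
  also have "\<dots> \<le> B" using integrable_bounded_complex[OF assms] assms(2) by (intro integral_le_const) auto
  finally show ?thesis .
qed

lemma (in prob_space) char_function_derivative:
  fixes S :: "'a \<Rightarrow> real"
  assumes [measurable]: "S \<in> borel_measurable M" and B: "\<And>\<omega>. \<bar>S \<omega>\<bar> \<le> B"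
  shows "((\<lambda>\<theta>. expectation (\<lambda>\<omega>. iexp (\<theta> * S \<omega>))) has_vector_derivative
      expectation (\<lambda>\<omega>. \<i> * complex_of_real (S \<omega>) * iexp (\<theta> * S \<omega>))) (at \<theta>)"
proof -
  have B0: "0 \<le> B" using B[of undefined] by linarith
  have int1: "integrable M (\<lambda>\<omega>. iexp (\<theta> * S \<omega>))" for \<theta>
    by (rule integrable_bounded_complex[where B = 1]) auto
  have int2: "integrable M (\<lambda>\<omega>. \<i> * complex_of_real (S \<omega>) * iexp (\<theta> * S \<omega>))"
    by (rule integrable_bounded_complex[where B = B]) (auto simp: norm_mult B)
  have est: "cmod (expectation (\<lambda>\<omega>. iexp (y * S \<omega>)) - expectation (\<lambda>\<omega>. iexp (\<theta> * S \<omega>))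
      - (y - \<theta>) *\<^sub>R expectation (\<lambda>\<omega>. \<i> * complex_of_real (S \<omega>) * iexp (\<theta> * S \<omega>))) \<le> B\<^sup>2 / 2 * (y - \<theta>)\<^sup>2" for y
  proof -
    have "expectation (\<lambda>\<omega>. iexp (y * S \<omega>)) - expectation (\<lambda>\<omega>. iexp (\<theta> * S \<omega>))
      - (y - \<theta>) *\<^sub>R expectation (\<lambda>\<omega>. \<i> * complex_of_real (S \<omega>) * iexp (\<theta> * S \<omega>))
      = expectation (\<lambda>\<omega>. iexp (y * S \<omega>) - iexp (\<theta> * S \<omega>) - (y - \<theta>) *\<^sub>R (\<i> * complex_of_real (S \<omega>) * iexp (\<theta> * S \<omega>)))"
      using int1 int2 by simp
    also have "cmod \<dots> \<le> B\<^sup>2 / 2 * (y - \<theta>)\<^sup>2"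
    proof (rule expectation_cmod_le)
      fix \<omega>
      let ?x = "(y - \<theta>) * S \<omega>"
      have "iexp (y * S \<omega>) = iexp (\<theta> * S \<omega>) * iexp ?x"
        by (simp add: exp_add[symmetric] algebra_simps)
      then have "iexp (y * S \<omega>) - iexp (\<theta> * S \<omega>) - (y - \<theta>) *\<^sub>R (\<i> * complex_of_real (S \<omega>) * iexp (\<theta> * S \<omega>))
        = iexp (\<theta> * S \<omega>) * (iexp ?x - 1 - \<i> * ?x)"
        by (simp add: scaleR_conv_of_real algebra_simps)
      then have "cmod (iexp (y * S \<omega>) - iexp (\<theta> * S \<omega>) - (y - \<theta>) *\<^sub>R (\<i> * complex_of_real (S \<omega>) * iexp (\<theta> * S \<omega>)))
        = cmod (iexp ?x - 1 - \<i> * ?x)" by (simp add: norm_mult)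
      also have "\<dots> \<le> ?x\<^sup>2 / 2" by (rule iexp_bounds)
      also have "\<dots> = (y - \<theta>)\<^sup>2 * (S \<omega>)\<^sup>2 / 2" by (simp add: power_mult_distrib)
      also have "\<dots> \<le> (y - \<theta>)\<^sup>2 * B\<^sup>2 / 2"
        using B[of \<omega>] B0 by (intro divide_right_mono mult_left_mono) (auto simp: abs_le_square_iff[symmetric])
      finally show "cmod (iexp (y * S \<omega>) - iexp (\<theta> * S \<omega>) - (y - \<theta>) *\<^sub>R (\<i> * complex_of_real (S \<omega>) * iexp (\<theta> * S \<omega>)))
        \<le> B\<^sup>2 / 2 * (y - \<theta>)\<^sup>2" by (simp add: mult_ac)
    qed measurable
    finally show ?thesis .
  qed
  show ?thesis
    unfolding has_vector_derivative_def has_derivative_at_within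
  proof (intro conjI bounded_linear_scaleR_left)
    show "((\<lambda>y. (expectation (\<lambda>\<omega>. iexp (y * S \<omega>)) - expectation (\<lambda>\<omega>. iexp (\<theta> * S \<omega>))
      - (y - \<theta>) *\<^sub>R expectation (\<lambda>\<omega>. \<i> * complex_of_real (S \<omega>) * iexp (\<theta> * S \<omega>))) /\<^sub>R norm (y - \<theta>)) \<longlongrightarrow> 0) (at \<theta>)"
    proof (rule Lim_null_comparison)
      show "\<forall>\<^sub>F y in at \<theta>. norm ((expectation (\<lambda>\<omega>. iexp (y * S \<omega>)) - expectation (\<lambda>\<omega>. iexp (\<theta> * S \<omega>))
        - (y - \<theta>) *\<^sub>R expectation (\<lambda>\<omega>. \<i> * complex_of_real (S \<omega>) * iexp (\<theta> * S \<omega>))) /\<^sub>R norm (y - \<theta>)) \<le> B\<^sup>2 / 2 * \<bar>y - \<theta>\<bar>"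
      proof (intro always_eventually allI)
        fix y :: real
        define X where "X = expectation (\<lambda>\<omega>. iexp (y * S \<omega>)) - expectation (\<lambda>\<omega>. iexp (\<theta> * S \<omega>))
        - (y - \<theta>) *\<^sub>R expectation (\<lambda>\<omega>. \<i> * complex_of_real (S \<omega>) * iexp (\<theta> * S \<omega>))"
        have X: "norm X \<le> B\<^sup>2 / 2 * \<bar>y - \<theta>\<bar>\<^sup>2" using est[of y] by (simp add: X_def)
        show "norm (X /\<^sub>R norm (y - \<theta>)) \<le> B\<^sup>2 / 2 * \<bar>y - \<theta>\<bar>"
        proof (cases "y = \<theta>")
          case False
          then show ?thesis using X by (simp add: field_simps power2_eq_square)
        qed simp
      qed
      have "((\<lambda>y. B\<^sup>2 / 2 * \<bar>y - \<theta>\<bar>) \<longlongrightarrow> B\<^sup>2 / 2 * \<bar>\<theta> - \<theta>\<bar>) (at \<theta>)" by (intro tendsto_intros)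
      then show "((\<lambda>y. B\<^sup>2 / 2 * \<bar>y - \<theta>\<bar>) \<longlongrightarrow> 0) (at \<theta>)" by simp
    qed
  qed
qed

text \<open>If \<open>\<psi>\<close> almost solves \<open>\<psi>' = - V \<theta> \<psi>\<close> with \<open>\<psi> 0 = 1\<close>, then it is almost Gaussian:
  differentiate \<open>\<psi> \<theta> * exp (V * \<theta>\<^sup>2 / 2)\<close>.\<close>

lemma gaussian_ode_stability:
  fixes \<psi> \<psi>' :: "real \<Rightarrow> complex" and V \<theta> E :: real
  assumes d: "\<And>x. (\<psi> has_vector_derivative \<psi>' x) (at x)" and "\<psi> 0 = 1" and V: "0 \<le> V"
    and err: "\<And>x. \<bar>x\<bar> \<le> \<bar>\<theta>\<bar> \<Longrightarrow> cmod (\<psi>' x + complex_of_real (V * x) * \<psi> x) \<le> E"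
  shows "cmod (\<psi> \<theta> - complex_of_real (exp (- V * \<theta>\<^sup>2 / 2))) \<le> E * \<bar>\<theta>\<bar>"
proof -
  define r :: "real \<Rightarrow> real" where "r x = exp (V * x\<^sup>2 / 2)" for x
  define k where "k x = r x *\<^sub>R \<psi> x" for x
  have dr: "(r has_field_derivative V * x * r x) (at x)" for x
    unfolding r_def by (auto intro!: derivative_eq_intros)
  have dk: "(k has_vector_derivative (r x *\<^sub>R (\<psi>' x + complex_of_real (V * x) * \<psi> x))) (at x)" for x
  proof -
    have "(k has_vector_derivative r x *\<^sub>R \<psi>' x + (V * x * r x) *\<^sub>R \<psi> x) (at x)"
      unfolding k_def by (rule has_vector_derivative_scaleR[OF dr d])
    then show ?thesis by (simp add: scaleR_conv_of_real algebra_simps)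
  qed
  \<comment> \<open>On the interval in question the weight is largest at the ends. The same factor
    \<open>r \<theta>\<close> multiplies the error of \<psi> at \<theta>, so that it cancels at the
    end.\<close>
  have mono: "r x \<le> r \<theta>" if "\<bar>x\<bar> \<le> \<bar>\<theta>\<bar>" for x
    unfolding r_def using V that by (auto intro!: divide_right_mono mult_left_mono simp: abs_le_square_iff[symmetric])
  have "norm (k \<theta> - k 0) \<le> (r \<theta> * E) * norm (\<theta> - 0)"
  proof (rule differentiable_bound[where S = "{- \<bar>\<theta>\<bar>..\<bar>\<theta>\<bar>}" and f' = "\<lambda>x h. h *\<^sub>R (r x *\<^sub>R (\<psi>' x + complex_of_real (V * x) * \<psi> x))"])
    fix x assume x: "x \<in> {- \<bar>\<theta>\<bar>..\<bar>\<theta>\<bar>}"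
    show "(k has_derivative (\<lambda>h. h *\<^sub>R (r x *\<^sub>R (\<psi>' x + complex_of_real (V * x) * \<psi> x)))) (at x within {- \<bar>\<theta>\<bar>..\<bar>\<theta>\<bar>})"
      using dk[of x] unfolding has_vector_derivative_def by (rule has_derivative_at_withinI)
    show "onorm (\<lambda>h. h *\<^sub>R (r x *\<^sub>R (\<psi>' x + complex_of_real (V * x) * \<psi> x))) \<le> r \<theta> * E"
    proof (rule onorm_bound)
      have E: "0 \<le> E" using order_trans[OF norm_ge_zero err[of 0]] by simp
      then show "0 \<le> r \<theta> * E" by (simp add: r_def)
      fix h :: real
      have "cmod (\<psi>' x + complex_of_real (V * x) * \<psi> x) \<le> E" using x by (intro err) auto
      moreover have "r x \<le> r \<theta>" using x by (intro mono) auto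
      moreover have "0 \<le> r x" by (simp add: r_def)
      ultimately have "r x * cmod (\<psi>' x + complex_of_real (V * x) * \<psi> x) \<le> r \<theta> * E" by (intro mult_mono) (auto simp: r_def)
      then have "\<bar>h\<bar> * (r x * cmod (\<psi>' x + complex_of_real (V * x) * \<psi> x)) \<le> \<bar>h\<bar> * (r \<theta> * E)" by (rule mult_left_mono) simp
      then show "norm (h *\<^sub>R (r x *\<^sub>R (\<psi>' x + complex_of_real (V * x) * \<psi> x))) \<le> r \<theta> * E * norm h"
        by (simp add: r_def abs_mult mult_ac)
    qed
  qed auto
  moreover have "k 0 = 1" using assms(2) by (simp add: k_def r_def)
  moreover have "norm (k \<theta> - 1) = r \<theta> * cmod (\<psi> \<theta> - complex_of_real (exp (- V * \<theta>\<^sup>2 / 2)))"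
  proof -
    have "r \<theta> * exp (- V * \<theta>\<^sup>2 / 2) = 1" unfolding r_def by (simp add: exp_minus_inverse)
    then have "k \<theta> - 1 = r \<theta> *\<^sub>R (\<psi> \<theta> - complex_of_real (exp (- V * \<theta>\<^sup>2 / 2)))"
    proof -
      have "r \<theta> *\<^sub>R complex_of_real e = complex_of_real (r \<theta> * e)" for e by (simp add: scaleR_conv_of_real)
      with \<open>r \<theta> * exp (- V * \<theta>\<^sup>2 / 2) = 1\<close> show ?thesis
        unfolding k_def scaleR_diff_right by (simp only: of_real_1)
    qed
    then show ?thesis by (simp add: r_def)
  qed
  ultimately have "r \<theta> * cmod (\<psi> \<theta> - complex_of_real (exp (- V * \<theta>\<^sup>2 / 2))) \<le> r \<theta> * (E * \<bar>\<theta>\<bar>)" by (simp add: mult_ac)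
  then show ?thesis by (simp add: r_def)
qed

lemma (in prob_space) expectation_abs_le_sqrt:
  fixes W :: "'a \<Rightarrow> real"
  assumes [measurable]: "W \<in> borel_measurable M" and sq: "integrable M (\<lambda>\<omega>. (W \<omega>)\<^sup>2)"
  shows "integrable M W" "expectation (\<lambda>\<omega>. \<bar>W \<omega>\<bar>) \<le> sqrt (expectation (\<lambda>\<omega>. (W \<omega>)\<^sup>2))"
proof -
  show W: "integrable M W" by (rule square_integrable_imp_integrable[OF _ sq]) simp
  define m where "m = expectation (\<lambda>\<omega>. \<bar>W \<omega>\<bar>)"
  have "0 \<le> expectation (\<lambda>\<omega>. (\<bar>W \<omega>\<bar> - m)\<^sup>2)" by (intro Bochner_Integration.integral_nonneg) auto
  also have "(\<lambda>\<omega>. (\<bar>W \<omega>\<bar> - m)\<^sup>2) = (\<lambda>\<omega>. (W \<omega>)\<^sup>2 - 2 * m * \<bar>W \<omega>\<bar> + m\<^sup>2)"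
    by (auto simp: power2_diff algebra_simps)
  also have "expectation \<dots> = expectation (\<lambda>\<omega>. (W \<omega>)\<^sup>2) - 2 * m * m + m\<^sup>2"
    using W sq by (simp add: m_def prob_space)
  finally have "m\<^sup>2 \<le> expectation (\<lambda>\<omega>. (W \<omega>)\<^sup>2)" by (simp add: power2_eq_square)
  then show "expectation (\<lambda>\<omega>. \<bar>W \<omega>\<bar>) \<le> sqrt (expectation (\<lambda>\<omega>. (W \<omega>)\<^sup>2))"
    unfolding m_def by (rule real_le_rsqrt)
qed

text \<open>For each site S = N + F, with N the sum over its near sites, and iexp (x F) = iexp (x S)
  iexp (- x N) is expanded in x N. The left side pairs \<open>Y t\<close> with far sites only and is
  small by \<open>cov3\<close>; the linear terms add up to x Q with Q = \<Sum> Y N, which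
  \<open>cov1\<close> and \<open>cov2\<close> tie to the variance; the rest is quadratic in x b K.
  Here \<open>a\<close> describes the decay of covariances, \<open>b\<close> bounds the size of a
  neighbourhood and \<epsilon> the dependence beyond it. For \<theta> of order n^(-1/2) only the
  term with \<epsilon> does not vanish.\<close>

lemma (in prob_space) bounded_clt_estimate:
  fixes Y :: "'i \<Rightarrow> 'a \<Rightarrow> real" and a :: "'i \<Rightarrow> 'i \<Rightarrow> real" and K C A \<epsilon> \<theta> :: real and b :: nat
  assumes fin: "finite \<Lambda>"
    and Y [measurable]: "\<And>t. Y t \<in> borel_measurable M" and K: "\<And>t \<omega>. \<bar>Y t \<omega>\<bar> \<le> K"
    and symm: "\<And>s t. near s t \<Longrightarrow> near t s"
    and b: "\<And>t. t \<in> \<Lambda> \<Longrightarrow> card {s \<in> \<Lambda>. near t s} \<le> b"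
    and C: "0 \<le> C" and a: "\<And>s t. 0 \<le> a s t"
    and A: "\<And>t. t \<in> \<Lambda> \<Longrightarrow> (\<Sum>s\<in>\<Lambda>. a t s) \<le> A"
    and far: "\<And>t. t \<in> \<Lambda> \<Longrightarrow> (\<Sum>s\<in>{s \<in> \<Lambda>. \<not> near t s}. a t s) \<le> \<epsilon>"
    and cov1: "\<And>s t. s \<in> \<Lambda> \<Longrightarrow> t \<in> \<Lambda> \<Longrightarrow> \<not> near s t \<Longrightarrow> \<bar>expectation (\<lambda>\<omega>. Y s \<omega> * Y t \<omega>)\<bar> \<le> C * a s t"
    and cov2: "\<And>s t s' t'. s \<in> \<Lambda> \<Longrightarrow> t \<in> \<Lambda> \<Longrightarrow> s' \<in> \<Lambda> \<Longrightarrow> t' \<in> \<Lambda> \<Longrightarrow>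
      \<bar>expectation (\<lambda>\<omega>. (Y s \<omega> * Y t \<omega>) * (Y s' \<omega> * Y t' \<omega>)) - expectation (\<lambda>\<omega>. Y s \<omega> * Y t \<omega>) * expectation (\<lambda>\<omega>. Y s' \<omega> * Y t' \<omega>)\<bar>
        \<le> C * (a s s' + a s t' + a t s' + a t t')"
    and cov3: "\<And>t x. t \<in> \<Lambda> \<Longrightarrow> \<bar>expectation (\<lambda>\<omega>. Y t \<omega> * cos (x * (\<Sum>s\<in>{s \<in> \<Lambda>. \<not> near t s}. Y s \<omega>)))\<bar>
        \<le> C * \<bar>x\<bar> * (\<Sum>s\<in>{s \<in> \<Lambda>. \<not> near t s}. a t s)"
      "\<And>t x. t \<in> \<Lambda> \<Longrightarrow> \<bar>expectation (\<lambda>\<omega>. Y t \<omega> * sin (x * (\<Sum>s\<in>{s \<in> \<Lambda>. \<not> near t s}. Y s \<omega>)))\<bar>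
        \<le> C * \<bar>x\<bar> * (\<Sum>s\<in>{s \<in> \<Lambda>. \<not> near t s}. a t s)"
  defines "S \<equiv> \<lambda>\<omega>. \<Sum>t\<in>\<Lambda>. Y t \<omega>" and "n \<equiv> real (card \<Lambda>)"
  shows "cmod (expectation (\<lambda>\<omega>. iexp (\<theta> * S \<omega>)) - complex_of_real (exp (- expectation (\<lambda>\<omega>. (S \<omega>)\<^sup>2) * \<theta>\<^sup>2 / 2)))
    \<le> (3 * C * \<epsilon> * n * \<bar>\<theta>\<bar> + n * K * (real b * K)\<^sup>2 * \<theta>\<^sup>2 / 2 + 2 * real b * sqrt (C * n * A) * \<bar>\<theta>\<bar>) * \<bar>\<theta>\<bar>"
proof -
  define N where "N t \<omega> = (\<Sum>s\<in>{s \<in> \<Lambda>. near t s}. Y s \<omega>)" for t \<omega>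
  define F where "F t \<omega> = (\<Sum>s\<in>{s \<in> \<Lambda>. \<not> near t s}. Y s \<omega>)" for t \<omega>
  define Q where "Q \<omega> = (\<Sum>t\<in>\<Lambda>. Y t \<omega> * N t \<omega>)" for \<omega>
  define V where "V = expectation (\<lambda>\<omega>. (S \<omega>)\<^sup>2)"
  have [measurable]: "S \<in> borel_measurable M" "N t \<in> borel_measurable M" "F t \<in> borel_measurable M" "Q \<in> borel_measurable M" for t
    unfolding S_def N_def[abs_def] F_def[abs_def] Q_def[abs_def] by measurable
  have K0: "0 \<le> K" using K[of undefined undefined] by linarith
  have n0: "0 \<le> n" by (simp add: n_def)
  have split: "S \<omega> = N t \<omega> + F t \<omega>" for t \<omega>
    unfolding S_def N_def F_def using fin
    by (subst sum.union_disjoint[symmetric]) (auto intro!: sum.cong)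
  have sum_bound: "\<bar>\<Sum>s\<in>X. Y s \<omega>\<bar> \<le> real (card X) * K" for X \<omega>
    using K by (intro order_trans[OF sum_abs] order_trans[OF sum_bounded_above]) auto
  have N_bound: "\<bar>N t \<omega>\<bar> \<le> real b * K" if "t \<in> \<Lambda>" for t \<omega>
    unfolding N_def using b[OF that] K0 by (intro order_trans[OF sum_bound] mult_right_mono) auto
  have S_bound: "\<bar>S \<omega>\<bar> \<le> n * K" for \<omega> unfolding S_def n_def by (rule sum_bound)
  have YY: "\<bar>Y s \<omega> * Y t \<omega>\<bar> \<le> K * K" for s t \<omega> unfolding abs_mult using K K0 by (intro mult_mono) auto
  have YY_int: "integrable M (\<lambda>\<omega>. Y s \<omega> * Y t \<omega>)" for s t
    by (rule integrable_bounded_real[where B = "K * K"]) (use YY in auto)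
  have Q_bound: "\<bar>Q \<omega>\<bar> \<le> n * (K * (real b * K))" for \<omega>
  proof -
    have "\<bar>Q \<omega>\<bar> \<le> (\<Sum>t\<in>\<Lambda>. \<bar>Y t \<omega> * N t \<omega>\<bar>)" unfolding Q_def by (rule sum_abs)
    also have "\<dots> \<le> (\<Sum>t\<in>\<Lambda>. K * (real b * K))"
      unfolding abs_mult using K N_bound K0 by (intro sum_mono mult_mono) auto
    finally show ?thesis by (simp add: n_def)
  qed
  have Q_int: "integrable M Q" by (rule integrable_bounded_real[OF _ Q_bound]) simp

  \<comment> \<open>Q is a sum over ordered near pairs, so its variance is a double sum of the
    covariances in \<open>cov2\<close>.\<close>
  define P where "P = (SIGMA t:\<Lambda>. {s \<in> \<Lambda>. near t s})"
  define Z where "Z p \<omega> = Y (fst p) \<omega> * Y (snd p) \<omega>" for p \<omega>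
  have finP: "finite P" using fin by (auto simp: P_def)
  have QP: "Q \<omega> = (\<Sum>p\<in>P. Z p \<omega>)" for \<omega>
    unfolding Q_def N_def P_def Z_def sum_distrib_left using fin by (subst sum.Sigma) (auto simp: case_prod_unfold)
  have sum_fst: "(\<Sum>p\<in>P. f (fst p)) \<le> real b * (\<Sum>t\<in>\<Lambda>. f t)" if "\<And>t. 0 \<le> f t" for f :: "'i \<Rightarrow> real"
  proof -
    have "(\<Sum>p\<in>P. f (fst p)) = (\<Sum>t\<in>\<Lambda>. \<Sum>s\<in>{s \<in> \<Lambda>. near t s}. f t)"
      unfolding P_def using fin by (subst sum.Sigma) (auto simp: case_prod_unfold)
    also have "\<dots> \<le> (\<Sum>t\<in>\<Lambda>. real b * f t)"
      using b that by (intro sum_mono) (simp add: mult_right_mono)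
    finally show ?thesis by (simp add: sum_distrib_left)
  qed
  \<comment> \<open>Swapping the components maps \<open>P\<close> to itself, since
    \<open>near\<close> is symmetric.\<close>
  have sum_snd: "(\<Sum>p\<in>P. f (snd p)) \<le> real b * (\<Sum>t\<in>\<Lambda>. f t)" if "\<And>t. 0 \<le> f t" for f :: "'i \<Rightarrow> real"
  proof -
    have "(\<Sum>p\<in>P. f (snd p)) = (\<Sum>p\<in>prod.swap ` P. f (fst p))"
      by (subst sum.reindex) auto
    also have "prod.swap ` P = P" using symm by (force simp: P_def)
    finally show ?thesis using sum_fst[OF that] by simp
  qed
  \<comment> \<open>There are at most n b pairs p; for fixed p each site is a given component of at
    most b pairs p', so the inner sum is at most b A. The four choices of \<open>u\<close> and
    \<open>v\<close> give the factor 4 in the variance of Q.\<close>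
  have double: "(\<Sum>p\<in>P. \<Sum>p'\<in>P. a (u p) (v p')) \<le> n * real b * real b * A"
    if u: "u = fst \<or> u = snd" and v: "v = fst \<or> v = snd" for u v
  proof -
    have "(\<Sum>p\<in>P. \<Sum>p'\<in>P. a (u p) (v p')) \<le> (\<Sum>p\<in>P. real b * A)"
    proof (rule sum_mono)
      fix p assume "p \<in> P"
      then have up: "u p \<in> \<Lambda>" using u by (auto simp: P_def)
      have "(\<Sum>p'\<in>P. a (u p) (v p')) \<le> real b * (\<Sum>t\<in>\<Lambda>. a (u p) t)"
        using v sum_fst[of "a (u p)"] sum_snd[of "a (u p)"] a by auto
      also have "\<dots> \<le> real b * A" using A[OF up] by (intro mult_left_mono) auto
      finally show "(\<Sum>p'\<in>P. a (u p) (v p')) \<le> real b * A" .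
    qed
    also have "\<dots> = (\<Sum>p\<in>P. (\<lambda>_. 1) (fst p)) * (real b * A)" by simp
    also have "\<dots> \<le> (real b * n) * (real b * A)"
    proof (cases "\<Lambda> = {}")
      case False
      then obtain t where "t \<in> \<Lambda>" by blast
      then have "0 \<le> A" using A[of t] a by (meson order_trans sum_nonneg)
      then show ?thesis using sum_fst[of "\<lambda>_. 1"] by (intro mult_right_mono) (auto simp: n_def)
    qed (simp add: P_def n_def)
    finally show ?thesis by (simp add: mult_ac)
  qed
  have "expectation (\<lambda>\<omega>. (Q \<omega> - expectation Q)\<^sup>2) \<le> 4 * C * n * (real b)\<^sup>2 * A"
  proof -
    have Zint: "integrable M (Z p)" for p unfolding Z_def by (rule YY_int)
    have "\<bar>Z p \<omega>\<bar> \<le> K * K" for p \<omega> unfolding Z_def by (rule YY)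
    then have ZZ: "\<bar>Z p \<omega> * Z q \<omega>\<bar> \<le> (K * K) * (K * K)" for p q \<omega>
      unfolding abs_mult by (intro mult_mono) (auto simp: K0)
    have ZZint: "integrable M (\<lambda>\<omega>. Z p \<omega> * Z q \<omega>)" for p q
    proof (rule integrable_bounded_real[OF _ ZZ])
      show "(\<lambda>\<omega>. Z p \<omega> * Z q \<omega>) \<in> borel_measurable M" unfolding Z_def by measurable
    qed
    have "expectation (\<lambda>\<omega>. (Q \<omega> - expectation Q)\<^sup>2) = expectation (\<lambda>\<omega>. (Q \<omega>)\<^sup>2) - (expectation Q)\<^sup>2"
    proof (rule variance_eq[OF Q_int])
      show "integrable M (\<lambda>\<omega>. (Q \<omega>)\<^sup>2)"
        by (rule integrable_bounded_real[where B = "(n * (K * (real b * K)))\<^sup>2"]) (use Q_bound power_mono[OF Q_bound abs_ge_zero, of _ 2] in auto)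
    qed
    also have "(\<lambda>\<omega>. (Q \<omega>)\<^sup>2) = (\<lambda>\<omega>. \<Sum>p\<in>P. \<Sum>q\<in>P. Z p \<omega> * Z q \<omega>)"
      unfolding QP power2_eq_square sum_product ..
    also have "expectation \<dots> = (\<Sum>p\<in>P. \<Sum>q\<in>P. expectation (\<lambda>\<omega>. Z p \<omega> * Z q \<omega>))"
      using ZZint by (simp add: Bochner_Integration.integral_sum)
    also have "(expectation Q)\<^sup>2 = (\<Sum>p\<in>P. \<Sum>q\<in>P. expectation (Z p) * expectation (Z q))"
      unfolding QP[abs_def] power2_eq_square using Zint
      by (simp add: Bochner_Integration.integral_sum sum_product)
    also have "(\<Sum>p\<in>P. \<Sum>q\<in>P. expectation (\<lambda>\<omega>. Z p \<omega> * Z q \<omega>)) - (\<Sum>p\<in>P. \<Sum>q\<in>P. expectation (Z p) * expectation (Z q))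
      = (\<Sum>p\<in>P. \<Sum>q\<in>P. expectation (\<lambda>\<omega>. Z p \<omega> * Z q \<omega>) - expectation (Z p) * expectation (Z q))"
      by (simp add: sum_subtractf)
    also have "\<dots> \<le> (\<Sum>p\<in>P. \<Sum>q\<in>P. C * (a (fst p) (fst q) + a (fst p) (snd q) + a (snd p) (fst q) + a (snd p) (snd q)))"
    proof (intro sum_mono)
      fix p q assume "p \<in> P" "q \<in> P"
      then have "fst p \<in> \<Lambda>" "snd p \<in> \<Lambda>" "fst q \<in> \<Lambda>" "snd q \<in> \<Lambda>" by (auto simp: P_def)
      from cov2[OF this]
      show "expectation (\<lambda>\<omega>. Z p \<omega> * Z q \<omega>) - expectation (Z p) * expectation (Z q)
        \<le> C * (a (fst p) (fst q) + a (fst p) (snd q) + a (snd p) (fst q) + a (snd p) (snd q))"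
        unfolding Z_def by linarith
    qed
    also have "\<dots> = C * ((\<Sum>p\<in>P. \<Sum>q\<in>P. a (fst p) (fst q)) + (\<Sum>p\<in>P. \<Sum>q\<in>P. a (fst p) (snd q))
        + (\<Sum>p\<in>P. \<Sum>q\<in>P. a (snd p) (fst q)) + (\<Sum>p\<in>P. \<Sum>q\<in>P. a (snd p) (snd q)))"
      by (simp add: sum_distrib_left[symmetric] sum.distrib)
    also have "\<dots> \<le> C * (n * real b * real b * A + n * real b * real b * A + n * real b * real b * A + n * real b * real b * A)"
      using C by (intro mult_left_mono add_mono double) auto
    finally show ?thesis by (simp add: power2_eq_square mult_ac)
  qed
  then have "sqrt (expectation (\<lambda>\<omega>. (Q \<omega> - expectation Q)\<^sup>2)) \<le> sqrt (4 * C * n * (real b)\<^sup>2 * A)" by simp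
  also have "4 * C * n * (real b)\<^sup>2 * A = (2 * real b)\<^sup>2 * (C * n * A)" by (simp add: power2_eq_square mult_ac)
  also have "sqrt \<dots> = 2 * real b * sqrt (C * n * A)" by (simp add: real_sqrt_mult)
  finally have sd: "expectation (\<lambda>\<omega>. \<bar>Q \<omega> - expectation Q\<bar>) \<le> 2 * real b * sqrt (C * n * A)"
  proof (rule order_trans[rotated], intro expectation_abs_le_sqrt(2))
    have QQ: "\<bar>Q \<omega> - expectation Q\<bar> \<le> n * (K * (real b * K)) + \<bar>expectation Q\<bar>" for \<omega>
      using Q_bound[of \<omega>] by linarith
    show "integrable M (\<lambda>\<omega>. (Q \<omega> - expectation Q)\<^sup>2)"
      by (rule integrable_bounded_real[where B = "(n * (K * (real b * K)) + \<bar>expectation Q\<bar>)\<^sup>2"])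
         (use power_mono[OF QQ abs_ge_zero, of _ 2] in auto)
  qed simp
  have mean: "\<bar>expectation Q - V\<bar> \<le> n * (C * \<epsilon>)"
  proof -
    have sq: "(S \<omega>)\<^sup>2 = Q \<omega> + (\<Sum>t\<in>\<Lambda>. \<Sum>s\<in>{s \<in> \<Lambda>. \<not> near t s}. Y t \<omega> * Y s \<omega>)" for \<omega>
    proof -
      have "(S \<omega>)\<^sup>2 = (\<Sum>t\<in>\<Lambda>. Y t \<omega> * S \<omega>)" by (simp add: S_def power2_eq_square sum_distrib_right)
      also have "\<dots> = (\<Sum>t\<in>\<Lambda>. Y t \<omega> * N t \<omega> + Y t \<omega> * F t \<omega>)"
      proof (intro sum.cong refl)
        fix t show "Y t \<omega> * S \<omega> = Y t \<omega> * N t \<omega> + Y t \<omega> * F t \<omega>"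
          using split[of \<omega> t] by (simp add: distrib_left)
      qed
      finally show ?thesis by (simp add: Q_def F_def sum.distrib sum_distrib_left)
    qed
    have "V = expectation Q + (\<Sum>t\<in>\<Lambda>. \<Sum>s\<in>{s \<in> \<Lambda>. \<not> near t s}. expectation (\<lambda>\<omega>. Y t \<omega> * Y s \<omega>))"
      unfolding V_def sq using Q_int YY_int by (simp add: Bochner_Integration.integral_sum)
    then have "\<bar>expectation Q - V\<bar> = \<bar>\<Sum>t\<in>\<Lambda>. \<Sum>s\<in>{s \<in> \<Lambda>. \<not> near t s}. expectation (\<lambda>\<omega>. Y t \<omega> * Y s \<omega>)\<bar>" by simp
    also have "\<dots> \<le> (\<Sum>t\<in>\<Lambda>. \<Sum>s\<in>{s \<in> \<Lambda>. \<not> near t s}. C * a t s)"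
      by (intro order_trans[OF sum_abs] sum_mono cov1) auto
    also have "\<dots> \<le> (\<Sum>t\<in>\<Lambda>. C * \<epsilon>)"
      unfolding sum_distrib_left[symmetric] using far C by (intro sum_mono mult_left_mono) auto
    finally show ?thesis by (simp add: n_def)
  qed
  have QV: "expectation (\<lambda>\<omega>. \<bar>Q \<omega> - V\<bar>) \<le> 2 * real b * sqrt (C * n * A) + n * (C * \<epsilon>)"
  proof -
    have "expectation (\<lambda>\<omega>. \<bar>Q \<omega> - V\<bar>) \<le> expectation (\<lambda>\<omega>. \<bar>Q \<omega> - expectation Q\<bar> + \<bar>expectation Q - V\<bar>)"
      using Q_int by (intro integral_mono) auto
    also have "\<dots> = expectation (\<lambda>\<omega>. \<bar>Q \<omega> - expectation Q\<bar>) + \<bar>expectation Q - V\<bar>"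
      using Q_int by (simp add: prob_space)
    finally show ?thesis using sd mean by linarith
  qed

  define \<psi> where "\<psi> x = expectation (\<lambda>\<omega>. iexp (x * S \<omega>))" for x
  define \<psi>' where "\<psi>' x = expectation (\<lambda>\<omega>. \<i> * complex_of_real (S \<omega>) * iexp (x * S \<omega>))" for x
  have err: "cmod (\<psi>' x + complex_of_real (V * x) * \<psi> x) \<le> 2 * (C * \<bar>x\<bar> * \<epsilon>) * n
       + \<bar>x\<bar> * (2 * real b * sqrt (C * n * A) + n * (C * \<epsilon>)) + n * (K * (x\<^sup>2 * (real b * K)\<^sup>2 / 2))" for x
  proof -
    define R where "R t \<omega> = iexp (- (x * N t \<omega>)) - 1 - \<i> * complex_of_real (- (x * N t \<omega>))" for t \<omega>
    have [measurable]: "R t \<in> borel_measurable M" for t unfolding R_def[abs_def] by measurable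
    have R: "cmod (R t \<omega>) \<le> x\<^sup>2 * (real b * K)\<^sup>2 / 2" if "t \<in> \<Lambda>" for t \<omega>
    proof -
      have "cmod (R t \<omega>) \<le> (- (x * N t \<omega>))\<^sup>2 / 2" unfolding R_def by (rule iexp_bounds(2))
      also have "\<dots> = x\<^sup>2 * \<bar>N t \<omega>\<bar>\<^sup>2 / 2" by (simp add: power_mult_distrib)
      also have "\<dots> \<le> x\<^sup>2 * (real b * K)\<^sup>2 / 2"
        using N_bound[OF that, of \<omega>] by (intro divide_right_mono mult_left_mono power_mono) auto
      finally show ?thesis .
    qed
    define T1 where "T1 \<omega> = (\<Sum>t\<in>\<Lambda>. \<i> * (complex_of_real (Y t \<omega>) * iexp (x * F t \<omega>)))" for \<omega>
    define T2 where "T2 \<omega> = complex_of_real x * (complex_of_real (Q \<omega> - V) * iexp (x * S \<omega>))" for \<omega>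
    define T3 where "T3 \<omega> = (\<Sum>t\<in>\<Lambda>. \<i> * complex_of_real (Y t \<omega>) * iexp (x * S \<omega>) * R t \<omega>)" for \<omega>
    \<comment> \<open>T1 carries the far sums, T2 the fluctuation of Q and T3 the Taylor remainders.
      The term with V, added on the left as the drift of the Gaussian equation, is what centres Q in
      T2.\<close>
    have decomp: "\<i> * complex_of_real (S \<omega>) * iexp (x * S \<omega>) + complex_of_real (V * x) * iexp (x * S \<omega>) = T1 \<omega> - T2 \<omega> - T3 \<omega>" for \<omega>
    proof -
      have one: "\<i> * complex_of_real (Y t \<omega>) * iexp (x * S \<omega>) = \<i> * (complex_of_real (Y t \<omega>) * iexp (x * F t \<omega>))
        - complex_of_real (x * (Y t \<omega> * N t \<omega>)) * iexp (x * S \<omega>) - \<i> * complex_of_real (Y t \<omega>) * iexp (x * S \<omega>) * R t \<omega>" for t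
      proof -
        have "iexp (x * F t \<omega>) = iexp (x * S \<omega>) * iexp (- (x * N t \<omega>))"
          unfolding split[of \<omega> t] by (simp add: exp_add[symmetric] algebra_simps)
        also have "iexp (- (x * N t \<omega>)) = R t \<omega> + 1 - \<i> * complex_of_real (x * N t \<omega>)" by (simp add: R_def)
        finally have "\<i> * (complex_of_real (Y t \<omega>) * iexp (x * F t \<omega>)) = \<i> * (complex_of_real (Y t \<omega>) * (iexp (x * S \<omega>) * (R t \<omega> + 1 - \<i> * complex_of_real (x * N t \<omega>))))"
          by simp
        also have "\<dots> = \<i> * complex_of_real (Y t \<omega>) * iexp (x * S \<omega>) * R t \<omega> + \<i> * complex_of_real (Y t \<omega>) * iexp (x * S \<omega>)
          - (\<i> * \<i>) * complex_of_real (x * (Y t \<omega> * N t \<omega>)) * iexp (x * S \<omega>)"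
          by (simp only: of_real_mult distrib_left right_diff_distrib mult_1_right) (simp only: mult_ac)
        finally show ?thesis by simp
      qed
      have "\<i> * complex_of_real (S \<omega>) * iexp (x * S \<omega>) = (\<Sum>t\<in>\<Lambda>. \<i> * complex_of_real (Y t \<omega>) * iexp (x * S \<omega>))"
        unfolding S_def of_real_sum sum_distrib_left sum_distrib_right ..
      also have "\<dots> = T1 \<omega> - complex_of_real (x * Q \<omega>) * iexp (x * S \<omega>) - T3 \<omega>"
        by (subst sum.cong[OF refl one]) (simp add: sum_subtractf T1_def T3_def Q_def sum_distrib_left sum_distrib_right mult_ac)
      finally show ?thesis by (simp add: T2_def algebra_simps)
    qed
    have T1t_int: "integrable M (\<lambda>\<omega>. \<i> * (complex_of_real (Y t \<omega>) * iexp (x * F t \<omega>)))" for t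
      by (rule integrable_bounded_complex[where B = K]) (auto simp: norm_mult K)
    have T1_int: "integrable M T1" unfolding T1_def[abs_def] by (intro Bochner_Integration.integrable_sum T1t_int)
    have "\<bar>Q \<omega> - V\<bar> \<le> n * (K * (real b * K)) + \<bar>V\<bar>" for \<omega> using Q_bound[of \<omega>] by linarith
    then have T2'_int: "integrable M (\<lambda>\<omega>. complex_of_real (Q \<omega> - V) * iexp (x * S \<omega>))"
      by (intro integrable_bounded_complex[where B = "n * (K * (real b * K)) + \<bar>V\<bar>"]) (auto simp: norm_mult simp del: of_real_diff)
    then have T2_int: "integrable M T2" unfolding T2_def[abs_def] by simp
    have T3_le: "cmod (T3 \<omega>) \<le> n * (K * (x\<^sup>2 * (real b * K)\<^sup>2 / 2))" for \<omega>
    proof -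
      have "cmod (T3 \<omega>) \<le> (\<Sum>t\<in>\<Lambda>. cmod (\<i> * complex_of_real (Y t \<omega>) * iexp (x * S \<omega>) * R t \<omega>))"
        unfolding T3_def by (rule norm_sum)
      also have "\<dots> \<le> (\<Sum>t\<in>\<Lambda>. K * (x\<^sup>2 * (real b * K)\<^sup>2 / 2))"
      proof (rule sum_mono)
        fix t assume t: "t \<in> \<Lambda>"
        have "cmod (\<i> * complex_of_real (Y t \<omega>) * iexp (x * S \<omega>) * R t \<omega>) = \<bar>Y t \<omega>\<bar> * cmod (R t \<omega>)"
          by (simp add: norm_mult)
        also have "\<dots> \<le> K * (x\<^sup>2 * (real b * K)\<^sup>2 / 2)"
          by (intro mult_mono K R[OF t] K0) simp
        finally show "cmod (\<i> * complex_of_real (Y t \<omega>) * iexp (x * S \<omega>) * R t \<omega>) \<le> K * (x\<^sup>2 * (real b * K)\<^sup>2 / 2)" .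
      qed
      finally show ?thesis by (simp add: n_def)
    qed
    have T3_meas: "T3 \<in> borel_measurable M" unfolding T3_def[abs_def] by measurable
    have T3_int: "integrable M T3" by (rule integrable_bounded_complex[OF T3_meas T3_le])
    have "integrable M (\<lambda>\<omega>. \<i> * complex_of_real (S \<omega>) * iexp (x * S \<omega>))" "integrable M (\<lambda>\<omega>. iexp (x * S \<omega>))"
      by (rule integrable_bounded_complex[where B = "n * K"], auto simp: norm_mult S_bound)
         (rule integrable_bounded_complex[where B = 1], auto)
    then have "\<psi>' x + complex_of_real (V * x) * \<psi> x
      = expectation (\<lambda>\<omega>. \<i> * complex_of_real (S \<omega>) * iexp (x * S \<omega>) + complex_of_real (V * x) * iexp (x * S \<omega>))"
      by (simp add: \<psi>_def \<psi>'_def)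
    also have "\<dots> = expectation T1 - expectation T2 - expectation T3"
      unfolding decomp using T1_int T2_int T3_int by simp
    finally have "cmod (\<psi>' x + complex_of_real (V * x) * \<psi> x) \<le> cmod (expectation T1) + cmod (expectation T2) + cmod (expectation T3)"
      by (smt (verit) norm_triangle_ineq4)
    moreover have "cmod (expectation T1) \<le> 2 * (C * \<bar>x\<bar> * \<epsilon>) * n"
    proof -
      \<comment> \<open>The covariance bounds are for real functionals, so the cosine and sine parts
        are estimated apart. They account for 2 of the 3 in \<open>3 * C * \<epsilon>\<close>, the
        bias of Q for the third.\<close>
      have one: "cmod (expectation (\<lambda>\<omega>. \<i> * (complex_of_real (Y t \<omega>) * iexp (x * F t \<omega>)))) \<le> 2 * (C * \<bar>x\<bar> * \<epsilon>)" if t: "t \<in> \<Lambda>" for t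
      proof -
        have i: "integrable M (\<lambda>\<omega>. Y t \<omega> * cos (x * F t \<omega>))" "integrable M (\<lambda>\<omega>. Y t \<omega> * sin (x * F t \<omega>))"
          using K mult_mono[OF K abs_cos_le_one] mult_mono[OF K abs_sin_le_one] K0
          by (auto intro!: integrable_bounded_real[where B = K] simp: abs_mult)
        have "(\<lambda>\<omega>. \<i> * (complex_of_real (Y t \<omega>) * iexp (x * F t \<omega>)))
          = (\<lambda>\<omega>. \<i> * complex_of_real (Y t \<omega> * cos (x * F t \<omega>)) - complex_of_real (Y t \<omega> * sin (x * F t \<omega>)))"
        proof
          fix \<omega>
          have "iexp (x * F t \<omega>) = complex_of_real (cos (x * F t \<omega>)) + \<i> * complex_of_real (sin (x * F t \<omega>))"
            by (simp only: cis_conv_exp[symmetric]) (simp add: complex_eq_iff)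
          then show "\<i> * (complex_of_real (Y t \<omega>) * iexp (x * F t \<omega>))
            = \<i> * complex_of_real (Y t \<omega> * cos (x * F t \<omega>)) - complex_of_real (Y t \<omega> * sin (x * F t \<omega>))"
            by (simp only:) (simp add: complex_eq_iff)
        qed
        then have "expectation (\<lambda>\<omega>. \<i> * (complex_of_real (Y t \<omega>) * iexp (x * F t \<omega>)))
          = \<i> * complex_of_real (expectation (\<lambda>\<omega>. Y t \<omega> * cos (x * F t \<omega>))) - complex_of_real (expectation (\<lambda>\<omega>. Y t \<omega> * sin (x * F t \<omega>)))"
        proof -
          have c: "integrable M (\<lambda>\<omega>. \<i> * complex_of_real (Y t \<omega> * cos (x * F t \<omega>)))"
            and s: "integrable M (\<lambda>\<omega>. complex_of_real (Y t \<omega> * sin (x * F t \<omega>)))"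
            using i by (simp_all only: integrable_mult_right integrable_of_real)
          assume "(\<lambda>\<omega>. \<i> * (complex_of_real (Y t \<omega>) * iexp (x * F t \<omega>)))
            = (\<lambda>\<omega>. \<i> * complex_of_real (Y t \<omega> * cos (x * F t \<omega>)) - complex_of_real (Y t \<omega> * sin (x * F t \<omega>)))"
          then show ?thesis
            by (simp only: Bochner_Integration.integral_diff[OF c s] integral_mult_right_zero integral_complex_of_real)
        qed
        also have "cmod \<dots> \<le> \<bar>expectation (\<lambda>\<omega>. Y t \<omega> * cos (x * F t \<omega>))\<bar> + \<bar>expectation (\<lambda>\<omega>. Y t \<omega> * sin (x * F t \<omega>))\<bar>"
          by (rule order_trans[OF norm_triangle_ineq4]) (simp add: norm_mult)
        also have "\<dots> \<le> C * \<bar>x\<bar> * \<epsilon> + C * \<bar>x\<bar> * \<epsilon>"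
        proof -
          have "C * \<bar>x\<bar> * (\<Sum>s\<in>{s \<in> \<Lambda>. \<not> near t s}. a t s) \<le> C * \<bar>x\<bar> * \<epsilon>"
            using far[OF t] C by (intro mult_left_mono) auto
          then show ?thesis using cov3[OF t, of x] unfolding F_def by linarith
        qed
        finally show ?thesis by (simp only: mult_2)
      qed
      have "cmod (expectation T1) = cmod (\<Sum>t\<in>\<Lambda>. expectation (\<lambda>\<omega>. \<i> * (complex_of_real (Y t \<omega>) * iexp (x * F t \<omega>))))"
        unfolding T1_def[abs_def] using T1t_int by (simp add: Bochner_Integration.integral_sum)
      also have "\<dots> \<le> (\<Sum>t\<in>\<Lambda>. 2 * (C * \<bar>x\<bar> * \<epsilon>))" by (intro order_trans[OF norm_sum] sum_mono one)
      finally show ?thesis by (simp add: n_def mult_ac)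
    qed
    moreover have "cmod (expectation T2) \<le> \<bar>x\<bar> * (2 * real b * sqrt (C * n * A) + n * (C * \<epsilon>))"
    proof -
      have "cmod (expectation T2) = \<bar>x\<bar> * cmod (expectation (\<lambda>\<omega>. complex_of_real (Q \<omega> - V) * iexp (x * S \<omega>)))"
        unfolding T2_def[abs_def] by (simp add: norm_mult)
      also have "\<dots> \<le> \<bar>x\<bar> * (2 * real b * sqrt (C * n * A) + n * (C * \<epsilon>))"
      proof (rule mult_left_mono[OF order_trans[OF _ QV]])
        show "cmod (expectation (\<lambda>\<omega>. complex_of_real (Q \<omega> - V) * iexp (x * S \<omega>))) \<le> expectation (\<lambda>\<omega>. \<bar>Q \<omega> - V\<bar>)"
          by (rule order_trans[OF integral_norm_bound]) (simp add: norm_mult del: of_real_diff)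
      qed simp
      finally show ?thesis .
    qed
    moreover have "cmod (expectation T3) \<le> n * (K * (x\<^sup>2 * (real b * K)\<^sup>2 / 2))"
      by (rule expectation_cmod_le[OF T3_meas T3_le])
    ultimately show ?thesis by linarith
  qed
  have "cmod (\<psi> \<theta> - complex_of_real (exp (- V * \<theta>\<^sup>2 / 2))) \<le>
     (3 * C * \<epsilon> * n * \<bar>\<theta>\<bar> + n * K * (real b * K)\<^sup>2 * \<theta>\<^sup>2 / 2 + 2 * real b * sqrt (C * n * A) * \<bar>\<theta>\<bar>) * \<bar>\<theta>\<bar>"
  proof (rule gaussian_ode_stability)
    show "(\<psi> has_vector_derivative \<psi>' x) (at x)" for x
      unfolding \<psi>_def[abs_def] \<psi>'_def by (rule char_function_derivative[OF _ S_bound]) simp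
    show "\<psi> 0 = 1" by (simp add: \<psi>_def prob_space)
    show "0 \<le> V" unfolding V_def by (intro Bochner_Integration.integral_nonneg) auto
    fix x assume x: "\<bar>x\<bar> \<le> \<bar>\<theta>\<bar>"
    have pos: "0 \<le> sqrt (C * n * A)" if ne: "\<Lambda> \<noteq> {}"
    proof -
      obtain t where "t \<in> \<Lambda>" using ne by blast
      then have "0 \<le> A" using A[of t] a by (meson order_trans sum_nonneg)
      then show ?thesis using C n0 by simp
    qed
    show "cmod (\<psi>' x + complex_of_real (V * x) * \<psi> x)
      \<le> 3 * C * \<epsilon> * n * \<bar>\<theta>\<bar> + n * K * (real b * K)\<^sup>2 * \<theta>\<^sup>2 / 2 + 2 * real b * sqrt (C * n * A) * \<bar>\<theta>\<bar>"
    proof (cases "\<Lambda> = {}")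
      case True
      then show ?thesis using err[of x] by (simp add: n_def)
    next
      case False
      then obtain t where t: "t \<in> \<Lambda>" by blast
      have e0: "0 \<le> \<epsilon>" using far[OF t] a by (meson order_trans sum_nonneg)
      have "2 * (C * \<bar>x\<bar> * \<epsilon>) * n + \<bar>x\<bar> * (2 * real b * sqrt (C * n * A) + n * (C * \<epsilon>)) + n * (K * (x\<^sup>2 * (real b * K)\<^sup>2 / 2))
        = \<bar>x\<bar> * (3 * C * \<epsilon> * n + 2 * real b * sqrt (C * n * A)) + x\<^sup>2 * (n * K * (real b * K)\<^sup>2 / 2)"
        by (simp add: algebra_simps)
      also have "\<dots> \<le> \<bar>\<theta>\<bar> * (3 * C * \<epsilon> * n + 2 * real b * sqrt (C * n * A)) + \<theta>\<^sup>2 * (n * K * (real b * K)\<^sup>2 / 2)"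
        using x pos[OF False] C n0 K0 e0
        by (intro add_mono mult_right_mono) (auto simp: abs_le_square_iff[symmetric])
      finally show ?thesis using err[of x] by (simp add: algebra_simps)
    qed
  qed
  then show ?thesis by (simp add: \<psi>_def V_def)
qed

section \<open>Covariances under a moment of order 2 + \<delta>\<close>

section \<open>Covariance bounds under moment conditions\<close>

lemma summable_on_finite_sum:
  fixes f :: "'i \<Rightarrow> 'a \<Rightarrow> real"
  assumes "finite I" "\<And>i. i \<in> I \<Longrightarrow> f i summable_on A"
  shows "(\<lambda>x. \<Sum>i\<in>I. f i x) summable_on A"
  using assms by (induction I rule: finite_induct) (auto intro: summable_on_add)

lemma lipschitz_coordinate: "lipschitz_on_cube {t} (\<lambda>_. 1) K (\<lambda>x. x t)"
  by (simp add: lipschitz_on_cube_def)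

lemma (in prob_space) covariance_trivial:
  fixes F G :: "'a \<Rightarrow> real"
  assumes [measurable]: "F \<in> borel_measurable M" "G \<in> borel_measurable M"
    and "\<And>\<omega>. \<bar>F \<omega>\<bar> \<le> B" "\<And>\<omega>. \<bar>G \<omega>\<bar> \<le> C"
  shows "\<bar>covar F G\<bar> \<le> 2 * (B * C)"
proof -
  have BC: "0 \<le> B" "0 \<le> C" using assms(3,4)[of undefined] by linarith+
  have i: "integrable M F" "integrable M G"
    using integrable_bounded_real[OF assms(1,3)] integrable_bounded_real[OF assms(2,4)] by auto
  have "\<bar>F \<omega> * G \<omega>\<bar> \<le> B * C" for \<omega> unfolding abs_mult using assms(3,4) BC by (intro mult_mono) auto
  then have ii: "integrable M (\<lambda>\<omega>. F \<omega> * G \<omega>)" "\<bar>expectation (\<lambda>\<omega>. F \<omega> * G \<omega>)\<bar> \<le> B * C"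
    by (auto intro!: integrable_bounded_real order_trans[OF integral_abs_bound] integral_le_const)
  have "\<bar>expectation F\<bar> \<le> B" "\<bar>expectation G\<bar> \<le> C"
    using i assms(3,4) by (auto intro!: order_trans[OF integral_abs_bound] integral_le_const)
  then have "\<bar>expectation F * expectation G\<bar> \<le> B * C" unfolding abs_mult using BC by (intro mult_mono) auto
  with ii(2) show ?thesis by linarith
qed

definition clip :: "real \<Rightarrow> real \<Rightarrow> real" where "clip K x = max (- K) (min K x)"

lemma clip_measurable [measurable]: "clip K \<in> borel_measurable borel"
  unfolding clip_def[abs_def] by measurable

lemma clip_bounds: "0 \<le> K \<Longrightarrow> \<bar>clip K x\<bar> \<le> K" "0 \<le> K \<Longrightarrow> \<bar>clip K x\<bar> \<le> \<bar>x\<bar>"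
    "0 \<le> K \<Longrightarrow> \<bar>x - clip K x\<bar> \<le> \<bar>x\<bar>" "\<bar>x\<bar> \<le> K \<Longrightarrow> clip K x = x"
  by (auto simp: clip_def max_def min_def)

context window_field begin

lemma clipped_gamma_powr_le:
  assumes "0 < q"
  shows "ennreal (clipped_gamma h powr q) \<le> ennreal_powr (gamma_coeff M \<mu> \<eta> h) q"
proof (cases "gamma_coeff M \<mu> \<eta> h = \<infinity>")
  case False
  then have "clipped_gamma h \<le> enn2real (gamma_coeff M \<mu> \<eta> h)"
    unfolding clipped_gamma_def by (intro enn2real_mono) (auto simp: less_top)
  then show ?thesis using False assms
    unfolding ennreal_powr_def by (auto intro!: ennreal_leI powr_mono2 clipped_gamma_nonneg)
qed (simp add: ennreal_powr_def)

text \<open>Subadditivity of the power reduces \<open>dep\<close> to finitely many translates of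
  \<open>clipped_gamma\<close>, each summable by radial grouping. The sum of \<open>dep\<close>
  itself converges because numbers in [0, 1] do not exceed their q-th powers for q \<le> 1.\<close>

lemma dep_powr_summable:
  assumes q: "0 < q" "q \<le> 1"
    and s: "(\<Sum>\<^sub>\<infinity>m\<in>{1..}. of_nat m ^ (CARD('d) - 1) *
            (SUP h\<in>{h. int m \<le> sup_norm h}. ennreal_powr (gamma_coeff M \<mu> \<eta> h) q)) < \<infinity>"
  shows "(\<lambda>h. dep h powr q) summable_on UNIV" "dep summable_on UNIV"
proof -
  have "(\<lambda>h. clipped_gamma h powr q) summable_on UNIV"
  proof (rule summable_on_lattice_radial[OF _ _ s])
    fix h :: "int ^ 'd"
    have "ennreal (clipped_gamma h powr q) \<le> ennreal_powr (gamma_coeff M \<mu> \<eta> h) q"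
      by (rule clipped_gamma_powr_le[OF q(1)])
    also have "\<dots> \<le> (SUP h\<in>{h'. int (nat (sup_norm h)) \<le> sup_norm h'}. ennreal_powr (gamma_coeff M \<mu> \<eta> h) q)"
      using sup_norm_nonneg[of h] by (intro SUP_upper) simp
    finally show "ennreal (clipped_gamma h powr q) \<le> \<dots>" .
  qed simp
  then have shifted: "(\<lambda>h. clipped_gamma (h + r) powr q) summable_on UNIV" for r
    by (subst summable_on_reindex_bij_betw[where g = "\<lambda>h. h + r"]) (auto simp: bij_betw_def inj_on_def intro!: surjI[of _ "\<lambda>h. h - r"])
  have le: "dep h powr q \<le> (\<Sum>i\<in>UNIV. \<Sum>j\<in>UNIV. clipped_gamma (h + (\<tau> j - \<tau> i)) powr q)" for h
  proof -
    have "dep h powr q \<le> (\<Sum>i\<in>UNIV. \<Sum>j\<in>UNIV. clipped_gamma (h + \<tau> j - \<tau> i)) powr q"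
      using q by (intro powr_mono2 dep_nonneg) (auto simp: dep_def)
    also have "\<dots> \<le> (\<Sum>i\<in>UNIV. (\<Sum>j\<in>UNIV. clipped_gamma (h + \<tau> j - \<tau> i)) powr q)"
      using q by (intro powr_sum_le sum_nonneg clipped_gamma_nonneg)
    also have "\<dots> \<le> (\<Sum>i\<in>UNIV. \<Sum>j\<in>UNIV. clipped_gamma (h + \<tau> j - \<tau> i) powr q)"
      using q by (intro sum_mono powr_sum_le clipped_gamma_nonneg)
    finally show ?thesis by (simp add: add_diff_eq)
  qed
  show q': "(\<lambda>h. dep h powr q) summable_on UNIV"
  proof (rule summable_on_comparison_test)
    show "(\<lambda>h. \<Sum>i\<in>UNIV. \<Sum>j\<in>UNIV. clipped_gamma (h + (\<tau> j - \<tau> i)) powr q) summable_on UNIV"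
      by (intro summable_on_finite_sum shifted) auto
  qed (use le in auto)
  show "dep summable_on UNIV"
  proof (rule summable_on_comparison_test[OF q'])
    fix h show "dep h \<le> dep h powr q"
      using powr_mono'[of q 1 "dep h"] q dep_nonneg[of h] dep_le_1[of h] by simp
  qed (rule dep_nonneg)
qed

text \<open>At a capped lag \<open>dep\<close> is 1, and the trivial bound
  \<open>2 * K\<^sup>2\<close> is good enough.\<close>

lemma covariance_two_sites:
  assumes u: "u \<in> borel_measurable borel" "\<And>x. \<bar>u x\<bar> \<le> K"
  shows "\<bar>covar (\<lambda>\<omega>. u (window s \<omega>)) (\<lambda>\<omega>. u (window t \<omega>))\<bar> \<le> 4 * K\<^sup>2 * dep (t - s)"
proof (cases "dep (t - s) < 1")
  case True
  note u(1)[measurable]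
  have "\<bar>covar (\<lambda>\<omega>. u (window s \<omega>)) (\<lambda>\<omega>. u (window t \<omega>))\<bar> \<le> 4 * K\<^sup>2 * (\<Sum>r\<in>{s}. \<Sum>r'\<in>{t}. 1 * 1 * dep (r' - r))"
    by (rule covariance_dep[OF lipschitz_coordinate lipschitz_coordinate u]) (use True in auto)
  then show ?thesis by simp
next
  case False
  then have "dep (t - s) = 1" using dep_le_1[of "t - s"] by simp
  moreover have "\<bar>covar (\<lambda>\<omega>. u (window s \<omega>)) (\<lambda>\<omega>. u (window t \<omega>))\<bar> \<le> 2 * (K * K)"
    using u by (intro covariance_trivial) auto
  moreover have "0 \<le> K * K" by simp
  ultimately show ?thesis by (simp add: power2_eq_square)
qed

text \<open>Each variable is split into its clipped part, to which
  \<open>covariance_two_sites\<close> applies, and a remainder \<open>R\<close>, from which the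
  moment gains a factor \<open>K powr (- \<delta>)\<close>. The 6 collects 2 + 2 from the two mixed
  expectations and 1 + 1 from products of means; the last term comes from the product of two
  remainder means.\<close>

lemma covariance_truncation:
  assumes w [measurable]: "w \<in> borel_measurable borel" and \<delta>: "0 < \<delta>" and K: "0 < K"
    and int: "integrable M (\<lambda>\<omega>. \<bar>w (window 0 \<omega>)\<bar> powr (2 + \<delta>))"
    and m: "expectation (\<lambda>\<omega>. \<bar>w (window 0 \<omega>)\<bar> powr (2 + \<delta>)) \<le> m"
  shows "\<bar>covar (\<lambda>\<omega>. w (window s \<omega>)) (\<lambda>\<omega>. w (window t \<omega>))\<bar>
    \<le> 4 * K\<^sup>2 * dep (t - s) + m * K powr (- \<delta>) * (6 + m * K powr (- 2 - \<delta>))"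
    and "integrable M (\<lambda>\<omega>. w (window s \<omega>) * w (window t \<omega>))" and "integrable M (\<lambda>\<omega>. w (window s \<omega>))"
proof -
  have p_meas: "(\<lambda>x. \<bar>w x\<bar> powr (2 + \<delta>)) \<in> borel_measurable borel" by measurable
  have pint: "integrable M (\<lambda>\<omega>. \<bar>w (window r \<omega>)\<bar> powr (2 + \<delta>))"
    and pm: "expectation (\<lambda>\<omega>. \<bar>w (window r \<omega>)\<bar> powr (2 + \<delta>)) \<le> m" for r
    using int m window_integral[OF p_meas, of r] by auto
  define Z where "Z r \<omega> = w (window r \<omega>)" for r \<omega>
  define Zc where "Zc r \<omega> = clip K (w (window r \<omega>))" for r \<omega>
  define R where "R r \<omega> = Z r \<omega> - Zc r \<omega>" for r \<omega>
  have [measurable]: "Z r \<in> borel_measurable M" "Zc r \<in> borel_measurable M" "R r \<in> borel_measurable M" for r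
    unfolding Z_def[abs_def] Zc_def[abs_def] R_def[abs_def] by measurable
  have Zc_le: "\<bar>Zc r \<omega>\<bar> \<le> K" "\<bar>Zc r \<omega>\<bar> \<le> \<bar>Z r \<omega>\<bar>" for r \<omega>
    using K clip_bounds by (auto simp: Zc_def Z_def)
  have R_le: "\<bar>R r \<omega>\<bar> \<le> \<bar>Z r \<omega>\<bar>" "\<bar>Z r \<omega>\<bar> \<le> K \<Longrightarrow> R r \<omega> = 0" for r \<omega>
    using K clip_bounds by (auto simp: R_def Zc_def Z_def)
  define e where "e = K powr (- \<delta>)"
  have e: "0 < e" using K by (simp add: e_def)
  have Kp: "K powr (-1 - \<delta>) * K = e" "K powr (- 1 - \<delta>) = e / K"
  proof -
    show "K powr (-1 - \<delta>) * K = e" using K powr_add[of K "-1 - \<delta>" 1] by (simp add: e_def)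
    then show "K powr (- 1 - \<delta>) = e / K" using K by (simp add: field_simps)
  qed
  \<comment> \<open>Since x / K exceeds 1, so does its power \<delta>; this trades the square for
    the moment of order 2 + \<delta>.\<close>
  have sq_le: "x\<^sup>2 \<le> e * x powr (2 + \<delta>)" if "K < x" for x
  proof -
    have x: "0 < x" using K that by simp
    have "1 \<le> (x / K) powr \<delta>" using that K \<delta> by (intro ge_one_powr_ge_zero) (auto simp: field_simps)
    also have "\<dots> = e * x powr \<delta>" using x K by (simp add: powr_divide e_def powr_minus field_simps)
    finally have "x\<^sup>2 * 1 \<le> x\<^sup>2 * (e * x powr \<delta>)" by (intro mult_left_mono) auto
    also have "\<dots> = e * x powr (2 + \<delta>)" using x by (simp add: powr_add powr_numeral)
    finally show ?thesis by simp
  qed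
  have prod_le: "\<bar>R r \<omega>\<bar> * \<bar>Z r' \<omega>\<bar> \<le> e * (\<bar>Z r \<omega>\<bar> powr (2 + \<delta>) + \<bar>Z r' \<omega>\<bar> powr (2 + \<delta>))" for r r' \<omega>
  proof (cases "\<bar>Z r \<omega>\<bar> \<le> K")
    case True
    then show ?thesis using R_le e by simp
  next
    case False
    \<comment> \<open>A nonzero \<open>R\<close> forces the variable at \<open>r\<close> above
      \<open>K\<close>, hence also the larger of the two variables, to which \<open>sq_le\<close>
      then applies whatever the size of the one at \<open>r'\<close>.\<close>
    define y where "y = max \<bar>Z r \<omega>\<bar> \<bar>Z r' \<omega>\<bar>"
    have "\<bar>R r \<omega>\<bar> * \<bar>Z r' \<omega>\<bar> \<le> y * y" using R_le(1)[of r \<omega>] unfolding y_def by (intro mult_mono) auto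
    also have "\<dots> \<le> e * y powr (2 + \<delta>)" using sq_le[of y] False by (auto simp: y_def power2_eq_square)
    also have "\<dots> \<le> e * (\<bar>Z r \<omega>\<bar> powr (2 + \<delta>) + \<bar>Z r' \<omega>\<bar> powr (2 + \<delta>))"
      using e by (intro mult_left_mono) (auto simp: y_def max_def)
    finally show ?thesis .
  qed
  have R_le_powr: "\<bar>R r \<omega>\<bar> \<le> e / K * \<bar>Z r \<omega>\<bar> powr (2 + \<delta>)" for r \<omega>
  proof (cases "\<bar>Z r \<omega>\<bar> \<le> K")
    case True
    then show ?thesis using R_le e K by simp
  next
    case False
    define z where "z = \<bar>Z r \<omega>\<bar>"
    have z: "K < z" using False by (simp add: z_def)
    have "\<bar>R r \<omega>\<bar> * K \<le> z * z" using R_le(1)[of r \<omega>] z K by (intro mult_mono) (auto simp: z_def)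
    also have "\<dots> \<le> e * z powr (2 + \<delta>)" using sq_le[OF z] by (simp add: power2_eq_square)
    finally show ?thesis using K by (simp add: z_def field_simps)
  qed
  have pint': "integrable M (\<lambda>\<omega>. \<bar>Z r \<omega>\<bar> powr (2 + \<delta>))" "expectation (\<lambda>\<omega>. \<bar>Z r \<omega>\<bar> powr (2 + \<delta>)) \<le> m" for r
    using pint pm by (simp_all add: Z_def)
  have m0: "0 \<le> m"
    by (rule order_trans[OF Bochner_Integration.integral_nonneg pint'(2)]) simp
  have R_int: "integrable M (R r)" for r
  proof (rule Bochner_Integration.integrable_bound)
    show "integrable M (\<lambda>\<omega>. e / K * \<bar>Z r \<omega>\<bar> powr (2 + \<delta>))" using pint' by simp
  qed (use R_le_powr e K in \<open>auto intro!: order_trans[OF R_le_powr]\<close>)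
  have Zc_int: "integrable M (Zc r)" for r by (rule integrable_bounded_real[OF _ Zc_le(1)]) simp
  have Z_eq: "Z r = (\<lambda>\<omega>. Zc r \<omega> + R r \<omega>)" for r by (simp add: R_def)
  have Z_int: "integrable M (Z r)" for r unfolding Z_eq using Zc_int R_int by simp
  then show "integrable M (\<lambda>\<omega>. w (window s \<omega>))" by (simp add: Z_def[abs_def])
  have RZ_int: "integrable M (\<lambda>\<omega>. R r \<omega> * Y \<omega>)" and RZ_le: "\<bar>expectation (\<lambda>\<omega>. R r \<omega> * Y \<omega>)\<bar> \<le> 2 * m * e"
    if [measurable]: "Y \<in> borel_measurable M" and Y: "\<And>\<omega>. \<bar>Y \<omega>\<bar> \<le> \<bar>Z r' \<omega>\<bar>" for r r' Y
  proof -
    have b: "\<bar>R r \<omega> * Y \<omega>\<bar> \<le> e * (\<bar>Z r \<omega>\<bar> powr (2 + \<delta>) + \<bar>Z r' \<omega>\<bar> powr (2 + \<delta>))" for \<omega>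
      using order_trans[OF mult_left_mono[OF Y abs_ge_zero] prod_le] by (simp add: abs_mult)
    have bi: "integrable M (\<lambda>\<omega>. e * (\<bar>Z r \<omega>\<bar> powr (2 + \<delta>) + \<bar>Z r' \<omega>\<bar> powr (2 + \<delta>)))" using pint' by simp
    show i: "integrable M (\<lambda>\<omega>. R r \<omega> * Y \<omega>)"
      by (rule Bochner_Integration.integrable_bound[OF bi]) (use b in \<open>auto intro!: order_trans[OF b]\<close>)
    have "\<bar>expectation (\<lambda>\<omega>. R r \<omega> * Y \<omega>)\<bar> \<le> expectation (\<lambda>\<omega>. \<bar>R r \<omega> * Y \<omega>\<bar>)" by (rule integral_abs_bound)
    also have "\<dots> \<le> expectation (\<lambda>\<omega>. e * (\<bar>Z r \<omega>\<bar> powr (2 + \<delta>) + \<bar>Z r' \<omega>\<bar> powr (2 + \<delta>)))"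
      using i bi b by (intro integral_mono) auto
    also have "\<dots> = e * (expectation (\<lambda>\<omega>. \<bar>Z r \<omega>\<bar> powr (2 + \<delta>)) + expectation (\<lambda>\<omega>. \<bar>Z r' \<omega>\<bar> powr (2 + \<delta>)))"
      using pint' by simp
    also have "\<dots> \<le> e * (m + m)" using e pint'(2) by (intro mult_left_mono add_mono) auto
    finally show "\<bar>expectation (\<lambda>\<omega>. R r \<omega> * Y \<omega>)\<bar> \<le> 2 * m * e" by (simp add: mult_ac)
  qed
  have ER: "\<bar>expectation (R r)\<bar> \<le> e / K * m" for r
  proof -
    have "\<bar>expectation (R r)\<bar> \<le> expectation (\<lambda>\<omega>. \<bar>R r \<omega>\<bar>)" by (rule integral_abs_bound)
    also have "\<dots> \<le> expectation (\<lambda>\<omega>. e / K * \<bar>Z r \<omega>\<bar> powr (2 + \<delta>))"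
      using R_int pint' R_le_powr by (intro integral_mono) auto
    also have "\<dots> \<le> e / K * m" using pint' e K by (auto intro!: mult_left_mono divide_right_mono)
    finally show ?thesis .
  qed
  have EZc: "\<bar>expectation (Zc r)\<bar> \<le> K" for r
    using Zc_int Zc_le by (auto intro!: order_trans[OF integral_abs_bound] integral_le_const)
  have EZ: "\<bar>expectation (Z r)\<bar> \<le> K + e / K * m" for r
  proof -
    have "expectation (Z r) = expectation (Zc r) + expectation (R r)" unfolding Z_eq using Zc_int R_int by simp
    then show ?thesis using ER[of r] EZc[of r] by linarith
  qed
  have cc_int: "integrable M (\<lambda>\<omega>. Zc s \<omega> * Zc t \<omega>)"
  proof (rule integrable_bounded_real)
    show "\<bar>Zc s \<omega> * Zc t \<omega>\<bar> \<le> K * K" for \<omega> unfolding abs_mult using Zc_le K by (intro mult_mono) auto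
  qed measurable
  have Rt: "integrable M (\<lambda>\<omega>. Zc s \<omega> * R t \<omega>)" "\<bar>expectation (\<lambda>\<omega>. Zc s \<omega> * R t \<omega>)\<bar> \<le> 2 * m * e"
    using RZ_int[of "Zc s" s t] RZ_le[of "Zc s" s t] Zc_le(2) by (simp_all add: mult.commute)
  have Rs: "integrable M (\<lambda>\<omega>. R s \<omega> * Z t \<omega>)" "\<bar>expectation (\<lambda>\<omega>. R s \<omega> * Z t \<omega>)\<bar> \<le> 2 * m * e"
    using RZ_int[of "Z t" t s] RZ_le[of "Z t" t s] by simp_all
  \<comment> \<open>Only one factor is split at a time; keeping \<open>Z t\<close> whole avoids a
    term with two remainders.\<close>
  have ZZ: "(\<lambda>\<omega>. Z s \<omega> * Z t \<omega>) = (\<lambda>\<omega>. Zc s \<omega> * Zc t \<omega> + Zc s \<omega> * R t \<omega> + R s \<omega> * Z t \<omega>)"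
    by (simp add: R_def algebra_simps)
  then have "integrable M (\<lambda>\<omega>. Z s \<omega> * Z t \<omega>)" using cc_int Rt Rs by simp
  then show "integrable M (\<lambda>\<omega>. w (window s \<omega>) * w (window t \<omega>))" by (simp add: Z_def)
  have EZs: "expectation (Z s) = expectation (Zc s) + expectation (R s)" "expectation (Z t) = expectation (Zc t) + expectation (R t)"
    unfolding Z_eq using Zc_int R_int by simp_all
  have cov: "covar (Z s) (Z t) = covar (Zc s) (Zc t) + expectation (\<lambda>\<omega>. Zc s \<omega> * R t \<omega>) + expectation (\<lambda>\<omega>. R s \<omega> * Z t \<omega>)
     - expectation (Zc s) * expectation (R t) - expectation (R s) * expectation (Z t)"
    unfolding ZZ using cc_int Rt Rs EZs by (simp add: algebra_simps)
  have "\<bar>covar (Zc s) (Zc t)\<bar> \<le> 4 * K\<^sup>2 * dep (t - s)"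
    unfolding Zc_def[abs_def]
    by (rule covariance_two_sites[where u = "\<lambda>x. clip K (w x)"]) (use K clip_bounds in auto)
  moreover have "\<bar>expectation (Zc s) * expectation (R t)\<bar> \<le> K * (e / K * m)"
    unfolding abs_mult using EZc ER K by (intro mult_mono) auto
  moreover have "\<bar>expectation (R s) * expectation (Z t)\<bar> \<le> (e / K * m) * (K + e / K * m)"
    unfolding abs_mult using EZ ER e K m0 by (intro mult_mono) auto
  ultimately have "\<bar>covar (Z s) (Z t)\<bar> \<le> 4 * K\<^sup>2 * dep (t - s) + 2 * m * e + 2 * m * e + K * (e / K * m) + (e / K * m) * (K + e / K * m)"
  proof -
    assume le: "\<bar>covar (Zc s) (Zc t)\<bar> \<le> 4 * K\<^sup>2 * dep (t - s)"
      "\<bar>expectation (Zc s) * expectation (R t)\<bar> \<le> K * (e / K * m)"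
      "\<bar>expectation (R s) * expectation (Z t)\<bar> \<le> (e / K * m) * (K + e / K * m)"
    have five: "\<bar>x1 + x2 + x3 - x4 - x5\<bar> \<le> \<bar>x1\<bar> + \<bar>x2\<bar> + \<bar>x3\<bar> + \<bar>x4\<bar> + \<bar>x5\<bar>" for x1 x2 x3 x4 x5 :: real
      by linarith
    show ?thesis unfolding cov
      by (rule order_trans[OF five]) (intro add_mono le Rt(2) Rs(2))
  qed
  also have "\<dots> = 4 * K\<^sup>2 * dep (t - s) + m * e * (6 + m * (e / K\<^sup>2))"
    using K by (simp add: field_simps power2_eq_square)
  also have "e / K\<^sup>2 = K powr (- 2 - \<delta>)"
  proof -
    have "K powr (- 2 - \<delta>) * K powr 2 = K powr (- 2 - \<delta> + 2)" by (rule powr_add[symmetric])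
    then have "K powr (- 2 - \<delta>) * K powr 2 = e" by (simp add: e_def)
    then show ?thesis using K by (simp add: powr_numeral field_simps)
  qed
  finally show "\<bar>covar (\<lambda>\<omega>. w (window s \<omega>)) (\<lambda>\<omega>. w (window t \<omega>))\<bar>
    \<le> 4 * K\<^sup>2 * dep (t - s) + m * K powr (- \<delta>) * (6 + m * K powr (- 2 - \<delta>))"
    by (simp add: e_def Z_def[abs_def])
qed

text \<open>The truncation level is balanced: with p = 2 + \<delta>, \<alpha> the value of
  \<open>dep\<close> and K = (m / \<alpha>)^(1/p), both K^2 \<alpha> and m K^(-\<delta>) equal
  m^(2/p) \<alpha>^(\<delta>/p), and m K^(-p) = \<alpha> \<le> 1. Thus 11 = 4 + 6 + 1. For \<alpha>
  = 0 this level would be infinite, and K tends to infinity instead.\<close>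

theorem covariance_davydov:
  assumes w: "w \<in> borel_measurable borel" and \<delta>: "0 < \<delta>" and m0: "0 < m"
    and int: "integrable M (\<lambda>\<omega>. \<bar>w (window 0 \<omega>)\<bar> powr (2 + \<delta>))"
    and m: "expectation (\<lambda>\<omega>. \<bar>w (window 0 \<omega>)\<bar> powr (2 + \<delta>)) \<le> m"
  shows "\<bar>covar (\<lambda>\<omega>. w (window s \<omega>)) (\<lambda>\<omega>. w (window t \<omega>))\<bar>
    \<le> 11 * m powr (2 / (2 + \<delta>)) * dep (t - s) powr (\<delta> / (2 + \<delta>))"
proof -
  define \<alpha> where "\<alpha> = dep (t - s)"
  have \<alpha>: "0 \<le> \<alpha>" "\<alpha> \<le> 1" using dep_nonneg dep_le_1 by (simp_all add: \<alpha>_def)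
  let ?C = "\<bar>covar (\<lambda>\<omega>. w (window s \<omega>)) (\<lambda>\<omega>. w (window t \<omega>))\<bar>"
  have bound: "?C \<le> 4 * K\<^sup>2 * \<alpha> + m * K powr (- \<delta>) * (6 + m * K powr (- 2 - \<delta>))" if "0 < K" for K
    unfolding \<alpha>_def by (rule covariance_truncation(1)[OF w \<delta> that int m])
  show ?thesis
  proof (cases "\<alpha> = 0")
    case True
    have "((\<lambda>K. m * K powr (- \<delta>) * (6 + m * K powr (- 2 - \<delta>))) \<longlongrightarrow> m * 0 * (6 + m * 0)) at_top"
      using \<delta> by (intro tendsto_intros tendsto_neg_powr filterlim_ident) auto
    moreover have "\<forall>\<^sub>F K in at_top. ?C \<le> m * K powr (- \<delta>) * (6 + m * K powr (- 2 - \<delta>))"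
      using eventually_gt_at_top[of 0] by eventually_elim (use bound True in auto)
    ultimately have "?C \<le> m * 0 * (6 + m * 0)"
      by (rule tendsto_lowerbound) (simp add: trivial_limit_at_top_linorder)
    then show ?thesis using True by (simp add: \<alpha>_def)
  next
    case False
    then have a: "0 < \<alpha>" using \<alpha> by simp
    define p where "p = 2 + \<delta>"
    have p: "2 < p" using \<delta> by (simp add: p_def)
    define K where "K = (m / \<alpha>) powr (1 / p)"
    have K: "0 < K" using a m0 by (simp add: K_def)
    have Kpow: "K powr x = m powr (x / p) * \<alpha> powr (- x / p)" for x
      using a m0 by (simp add: K_def powr_powr powr_divide powr_minus field_simps)
    have 1: "K\<^sup>2 * \<alpha> = m powr (2 / p) * \<alpha> powr (\<delta> / p)"
    proof -
      have "K\<^sup>2 * \<alpha> = K powr 2 * \<alpha> powr 1" using K a by (simp add: powr_numeral)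
      also have "\<dots> = m powr (2 / p) * \<alpha> powr (- 2 / p + 1)" unfolding Kpow powr_add[of \<alpha>] by (simp only: mult.assoc)
      also have "- 2 / p + 1 = \<delta> / p" using p by (simp add: p_def field_simps)
      finally show ?thesis .
    qed
    have 2: "m * K powr (- \<delta>) = m powr (2 / p) * \<alpha> powr (\<delta> / p)"
    proof -
      have "m * K powr (- \<delta>) = (m powr 1 * m powr (- \<delta> / p)) * \<alpha> powr (\<delta> / p)" unfolding Kpow using m0 by simp
      also have "m powr 1 * m powr (- \<delta> / p) = m powr (1 + - \<delta> / p)" by (rule powr_add[symmetric])
      also have "1 + - \<delta> / p = 2 / p" using p by (simp add: p_def field_simps)
      finally show ?thesis .
    qed
    have "m * K powr (- 2 - \<delta>) = \<alpha>"
    proof -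
      have e: "(- 2 - \<delta>) / p = -1" "- (- 2 - \<delta>) / p = 1" using p by (simp_all add: p_def field_simps)
      show ?thesis unfolding Kpow e using m0 a by (simp add: powr_minus)
    qed
    with bound[OF K] 2 have "?C \<le> 4 * (K\<^sup>2 * \<alpha>) + m powr (2 / p) * \<alpha> powr (\<delta> / p) * (6 + \<alpha>)" by simp
    also have "\<dots> = m powr (2 / p) * \<alpha> powr (\<delta> / p) * (10 + \<alpha>)" unfolding 1 by (simp add: algebra_simps)
    also have "\<dots> \<le> m powr (2 / p) * \<alpha> powr (\<delta> / p) * 11" using \<alpha> by (intro mult_left_mono) auto
    finally show ?thesis by (simp add: p_def \<alpha>_def mult_ac)
  qed
qed

end

section \<open>Bounded functionals\<close>

lemma abs_cos_diff_le: "\<bar>cos a - cos b\<bar> \<le> \<bar>a - b\<bar>" for a b :: real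
proof -
  have "\<bar>cos a - cos b\<bar> = 2 * (\<bar>sin ((a + b) / 2)\<bar> * \<bar>sin ((b - a) / 2)\<bar>)"
    by (simp add: cos_diff_cos abs_mult)
  also have "\<dots> \<le> 2 * (1 * \<bar>(b - a) / 2\<bar>)"
    by (intro mult_left_mono mult_mono abs_sin_le_one abs_sin_x_le_abs_x) auto
  finally show ?thesis by (simp add: abs_minus_commute)
qed

lemma abs_sin_diff_le: "\<bar>sin a - sin b\<bar> \<le> \<bar>a - b\<bar>" for a b :: real
proof -
  have "\<bar>sin a - sin b\<bar> = 2 * (\<bar>sin ((a - b) / 2)\<bar> * \<bar>cos ((a + b) / 2)\<bar>)"
    by (simp add: sin_diff_sin abs_mult)
  also have "\<dots> \<le> 2 * (\<bar>(a - b) / 2\<bar> * 1)"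
    by (intro mult_left_mono mult_mono abs_cos_le_one abs_sin_x_le_abs_x) auto
  finally show ?thesis by simp
qed

lemma lipschitz_trigonometric:
  assumes "finite B" "f = cos \<or> f = (sin :: real \<Rightarrow> real)"
  shows "lipschitz_on_cube B (\<lambda>_. \<bar>\<theta>\<bar>) K (\<lambda>x. f (\<theta> * (\<Sum>s\<in>B. x s)))"
  unfolding lipschitz_on_cube_def
proof (intro conjI allI impI assms(1))
  fix x y :: "'a \<Rightarrow> real"
  have "\<bar>f (\<theta> * (\<Sum>s\<in>B. x s)) - f (\<theta> * (\<Sum>s\<in>B. y s))\<bar> \<le> \<bar>\<theta> * (\<Sum>s\<in>B. x s) - \<theta> * (\<Sum>s\<in>B. y s)\<bar>"
    using assms(2) abs_cos_diff_le abs_sin_diff_le by blast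
  also have "\<dots> = \<bar>\<theta>\<bar> * \<bar>\<Sum>s\<in>B. x s - y s\<bar>" by (simp add: abs_mult[symmetric] right_diff_distrib sum_subtractf)
  also have "\<dots> \<le> \<bar>\<theta>\<bar> * (\<Sum>s\<in>B. \<bar>x s - y s\<bar>)" by (intro mult_left_mono sum_abs) simp
  finally show "\<bar>f (\<theta> * (\<Sum>s\<in>B. x s)) - f (\<theta> * (\<Sum>s\<in>B. y s))\<bar> \<le> (\<Sum>t\<in>B. \<bar>\<theta>\<bar> * \<bar>x t - y t\<bar>)"
    by (simp add: sum_distrib_left)
qed simp

text \<open>The constant is \<open>2 * K\<close> and not \<open>K\<close> because for s = t the set
  \<open>{s, t}\<close> has a single element, which then carries both partial increments.\<close>

lemma lipschitz_product:
  assumes "0 \<le> K"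
  shows "lipschitz_on_cube {s, t} (\<lambda>_. 2 * K) K (\<lambda>x. x s * x t)"
  unfolding lipschitz_on_cube_def
proof (intro conjI allI impI)
  fix x y :: "'a \<Rightarrow> real"
  assume x: "\<forall>t. \<bar>x t\<bar> \<le> K" and y: "\<forall>t. \<bar>y t\<bar> \<le> K"
  have "x s * x t - y s * y t = x t * (x s - y s) + y s * (x t - y t)" by (simp add: algebra_simps)
  also have "\<bar>\<dots>\<bar> \<le> \<bar>x t\<bar> * \<bar>x s - y s\<bar> + \<bar>y s\<bar> * \<bar>x t - y t\<bar>"
    unfolding abs_mult[symmetric] by (rule abs_triangle_ineq)
  also have "\<dots> \<le> K * \<bar>x s - y s\<bar> + K * \<bar>x t - y t\<bar>"
    using x y by (intro add_mono mult_right_mono) auto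
  also have "\<dots> \<le> (\<Sum>r\<in>{s, t}. 2 * K * \<bar>x r - y r\<bar>)"
    using assms by (cases "s = t") auto
  finally show "\<bar>x s * x t - y s * y t\<bar> \<le> (\<Sum>r\<in>{s, t}. 2 * K * \<bar>x r - y r\<bar>)" .
qed (use assms in auto)

context window_field begin

text \<open>Near means here that the lag lies in \<open>H\<close>. Symmetry of \<open>H\<close>
  makes this relation symmetric, and \<open>dep h < 1\<close> off \<open>H\<close> opens
  \<open>covariance_dep\<close> to far sites. \<open>C\<close> dominates
  \<open>4 * K\<^sup>2\<close>, for one site against another or against a sine or cosine, and
  \<open>16 * K ^ 4\<close>, which is \<open>4 * K\<^sup>2\<close> times the square of the Lipschitz
  constant \<open>2 * K\<close> of a product.\<close>

lemma field_clt_estimate: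
  fixes \<Lambda> H :: "(int ^ 'd) set" and K \<epsilon> \<theta> :: real
  assumes u: "u \<in> borel_measurable borel" "\<And>x. \<bar>u x\<bar> \<le> K" and mean: "expectation (\<lambda>\<omega>. u (window 0 \<omega>)) = 0"
    and fin: "finite \<Lambda>" and H: "finite H" "\<And>h. h \<in> H \<Longrightarrow> - h \<in> H" "\<And>h. h \<notin> H \<Longrightarrow> dep h < 1"
    and dep_sum: "dep summable_on UNIV" and eps: "(\<Sum>\<^sub>\<infinity>h\<in>-H. dep h) \<le> \<epsilon>"
  defines "S \<equiv> \<lambda>\<omega>. \<Sum>t\<in>\<Lambda>. u (window t \<omega>)" and "n \<equiv> real (card \<Lambda>)" and "C \<equiv> 4 * K\<^sup>2 + 16 * K ^ 4"
  shows "cmod (expectation (\<lambda>\<omega>. iexp (\<theta> * S \<omega>)) - complex_of_real (exp (- expectation (\<lambda>\<omega>. (S \<omega>)\<^sup>2) * \<theta>\<^sup>2 / 2)))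
    \<le> (3 * C * \<epsilon> * n * \<bar>\<theta>\<bar> + n * K * (real (card H) * K)\<^sup>2 * \<theta>\<^sup>2 / 2 + 2 * real (card H) * sqrt (C * n * (\<Sum>\<^sub>\<infinity>h. dep h)) * \<bar>\<theta>\<bar>) * \<bar>\<theta>\<bar>"
proof -
  note u(1)[measurable]
  have K: "0 \<le> K" using u(2)[of undefined] by linarith
  have mean': "expectation (\<lambda>\<omega>. u (window t \<omega>)) = 0" for t
    using window_integral(1)[OF u(1), of t] mean by simp
  have C: "0 \<le> C" "4 * K\<^sup>2 \<le> C" "16 * K ^ 4 \<le> C" by (simp_all add: C_def)
  have sub: "dep summable_on A" for A by (rule summable_on_subset_banach[OF dep_sum]) simp
  have row: "(\<Sum>s\<in>X. dep (s - t)) \<le> (\<Sum>\<^sub>\<infinity>h\<in>A. dep h)" if "finite X" "\<And>s. s \<in> X \<Longrightarrow> s - t \<in> A" for X t A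
  proof -
    have "(\<Sum>s\<in>X. dep (s - t)) = sum dep ((\<lambda>s. s - t) ` X)" by (subst sum.reindex) (auto simp: inj_on_def)
    also have "\<dots> \<le> (\<Sum>\<^sub>\<infinity>h\<in>A. dep h)"
      using that by (intro finite_sum_le_infsum sub dep_nonneg) auto
    finally show ?thesis .
  qed
  show ?thesis
    unfolding S_def n_def
  proof (rule bounded_clt_estimate[where near = "\<lambda>s t. t - s \<in> H" and a = "\<lambda>s t. dep (t - s)" and C = C])
    show "t - s \<in> H \<Longrightarrow> s - t \<in> H" for s t using H(2)[of "t - s"] by simp
    show "card {s \<in> \<Lambda>. s - t \<in> H} \<le> card H" for t
    proof (rule card_inj_on_le[of "\<lambda>s. s - t"])
      show "inj_on (\<lambda>s. s - t) {s \<in> \<Lambda>. s - t \<in> H}" by (simp add: inj_on_def)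
    qed (use H in auto)
    show "(\<Sum>s\<in>\<Lambda>. dep (s - t)) \<le> (\<Sum>\<^sub>\<infinity>h. dep h)" for t using row[OF fin, of t UNIV] by simp
    show "(\<Sum>s\<in>{s \<in> \<Lambda>. s - t \<notin> H}. dep (s - t)) \<le> \<epsilon>" for t
      using row[of "{s \<in> \<Lambda>. s - t \<notin> H}" t "- H"] fin eps by simp
    show "\<bar>expectation (\<lambda>\<omega>. u (window s \<omega>) * u (window t \<omega>))\<bar> \<le> C * dep (t - s)" for s t
    proof -
      have "\<bar>expectation (\<lambda>\<omega>. u (window s \<omega>) * u (window t \<omega>))\<bar> \<le> 4 * K\<^sup>2 * dep (t - s)"
        using covariance_two_sites[OF u, of s t] mean' by simp
      also have "\<dots> \<le> C * dep (t - s)" using C by (intro mult_right_mono dep_nonneg)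
      finally show ?thesis .
    qed
    have trig: "\<bar>expectation (\<lambda>\<omega>. u (window t \<omega>) * f (x * (\<Sum>s\<in>{s \<in> \<Lambda>. s - t \<notin> H}. u (window s \<omega>))))\<bar>
        \<le> C * \<bar>x\<bar> * (\<Sum>s\<in>{s \<in> \<Lambda>. s - t \<notin> H}. dep (s - t))" if f: "f = cos \<or> f = sin" for f t x
    proof -
      have fm [measurable]: "f \<in> borel_measurable borel" using f by auto
      have "\<bar>covar (\<lambda>\<omega>. u (window t \<omega>)) (\<lambda>\<omega>. f (x * (\<Sum>s\<in>{s \<in> \<Lambda>. s - t \<notin> H}. u (window s \<omega>))))\<bar>
        \<le> 4 * K\<^sup>2 * (\<Sum>r\<in>{t}. \<Sum>s\<in>{s \<in> \<Lambda>. s - t \<notin> H}. 1 * \<bar>x\<bar> * dep (s - r))"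
        by (rule covariance_dep[OF lipschitz_coordinate lipschitz_trigonometric u]) (use fin f H(3) in auto)
      also have "\<dots> = 4 * K\<^sup>2 * (\<bar>x\<bar> * (\<Sum>s\<in>{s \<in> \<Lambda>. s - t \<notin> H}. dep (s - t)))"
        by (simp add: sum_distrib_left)
      also have "\<dots> \<le> C * (\<bar>x\<bar> * (\<Sum>s\<in>{s \<in> \<Lambda>. s - t \<notin> H}. dep (s - t)))"
        using C by (intro mult_right_mono mult_nonneg_nonneg sum_nonneg dep_nonneg) auto
      finally show ?thesis using mean' by (simp add: mult.assoc)
    qed
    show "\<bar>expectation (\<lambda>\<omega>. u (window t \<omega>) * cos (x * (\<Sum>s\<in>{s \<in> \<Lambda>. s - t \<notin> H}. u (window s \<omega>))))\<bar>
        \<le> C * \<bar>x\<bar> * (\<Sum>s\<in>{s \<in> \<Lambda>. s - t \<notin> H}. dep (s - t))" for t x by (rule trig) simp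
    show "\<bar>expectation (\<lambda>\<omega>. u (window t \<omega>) * sin (x * (\<Sum>s\<in>{s \<in> \<Lambda>. s - t \<notin> H}. u (window s \<omega>))))\<bar>
        \<le> C * \<bar>x\<bar> * (\<Sum>s\<in>{s \<in> \<Lambda>. s - t \<notin> H}. dep (s - t))" for t x by (rule trig) simp
    fix s t s' t' :: "int ^ 'd"
    let ?D = "dep (s' - s) + dep (t' - s) + dep (s' - t) + dep (t' - t)"
    have D0: "0 \<le> ?D" by (intro add_nonneg_nonneg dep_nonneg)
    have "\<bar>covar (\<lambda>\<omega>. u (window s \<omega>) * u (window t \<omega>)) (\<lambda>\<omega>. u (window s' \<omega>) * u (window t' \<omega>))\<bar> \<le> 16 * K ^ 4 * ?D"
    proof (cases "\<forall>r\<in>{s, t}. \<forall>r'\<in>{s', t'}. dep (r' - r) < 1")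
      case True
      have "\<bar>covar (\<lambda>\<omega>. u (window s \<omega>) * u (window t \<omega>)) (\<lambda>\<omega>. u (window s' \<omega>) * u (window t' \<omega>))\<bar>
        \<le> 4 * K\<^sup>2 * (\<Sum>r\<in>{s, t}. \<Sum>r'\<in>{s', t'}. (2 * K) * (2 * K) * dep (r' - r))"
        by (rule covariance_dep[OF lipschitz_product[OF K] lipschitz_product[OF K] u]) (use True in auto)
      also have "\<dots> = 16 * K ^ 4 * (\<Sum>r\<in>{s, t}. \<Sum>r'\<in>{s', t'}. dep (r' - r))"
        by (simp add: sum_distrib_left[symmetric] power2_eq_square power4_eq_xxxx)
      also have "(\<Sum>r\<in>{s, t}. \<Sum>r'\<in>{s', t'}. dep (r' - r)) \<le> ?D"
      proof -
        have two: "(\<Sum>r\<in>{a, b}. f r) \<le> f a + f b" if "\<And>r. 0 \<le> f r" for f :: "int ^ 'd \<Rightarrow> real" and a b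
          using that[of a] by (cases "a = b") auto
        have "(\<Sum>r\<in>{s, t}. \<Sum>r'\<in>{s', t'}. dep (r' - r)) \<le> (\<Sum>r'\<in>{s', t'}. dep (r' - s)) + (\<Sum>r'\<in>{s', t'}. dep (r' - t))"
          by (intro two sum_nonneg dep_nonneg)
        also have "\<dots> \<le> (dep (s' - s) + dep (t' - s)) + (dep (s' - t) + dep (t' - t))"
          by (intro add_mono two dep_nonneg)
        finally show ?thesis by simp
      qed
      finally show ?thesis by (simp add: mult_left_mono)
    next
      case False
      \<comment> \<open>A capped pair makes \<open>?D\<close> at least 1. So the trivial bound
        covers the four-site covariance, for which the sites may be arbitrarily close.\<close>
      then have "1 \<le> ?D" using dep_nonneg[of "s' - s"] dep_nonneg[of "t' - s"] dep_nonneg[of "s' - t"] dep_nonneg[of "t' - t"]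
        by (auto simp: not_less)
      have uu: "\<bar>u x * u y\<bar> \<le> K * K" for x y unfolding abs_mult using u(2) K by (intro mult_mono) auto
      have "\<bar>covar (\<lambda>\<omega>. u (window s \<omega>) * u (window t \<omega>)) (\<lambda>\<omega>. u (window s' \<omega>) * u (window t' \<omega>))\<bar> \<le> 2 * ((K * K) * (K * K))"
        by (rule covariance_trivial) (use uu in auto)
      also have "\<dots> \<le> 16 * K ^ 4 * 1" using K by (simp add: power4_eq_xxxx mult.assoc)
      also have "\<dots> \<le> 16 * K ^ 4 * ?D" using \<open>1 \<le> ?D\<close> by (intro mult_left_mono) auto
      finally show ?thesis .
    qed
    also have "\<dots> \<le> C * ?D" using C D0 by (intro mult_right_mono) auto
    finally show "\<bar>covar (\<lambda>\<omega>. u (window s \<omega>) * u (window t \<omega>)) (\<lambda>\<omega>. u (window s' \<omega>) * u (window t' \<omega>))\<bar> \<le> C * ?D" .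
  qed (use fin u C dep_nonneg in auto)
qed

text \<open>The order of choices matters: first \<epsilon>, small against e, then a neighbourhood
  \<open>H\<close> with dependence below \<epsilon> outside it, and only then k. With \<theta> = x /
  sqrt n the terms without \<epsilon> are of order n^(-1/2), with constants that depend on the fixed
  \<open>H\<close>.\<close>

lemma bounded_field_char_limit:
  fixes \<Lambda> :: "nat \<Rightarrow> (int ^ 'd) set" and x :: real
  assumes u: "u \<in> borel_measurable borel" "\<And>x. \<bar>u x\<bar> \<le> K" and mean: "expectation (\<lambda>\<omega>. u (window 0 \<omega>)) = 0"
    and dep_sum: "dep summable_on UNIV"
    and fin: "\<And>k. finite (\<Lambda> k)" and card: "filterlim (\<lambda>k. real (card (\<Lambda> k))) at_top sequentially"
  shows "(\<lambda>k. cmod (expectation (\<lambda>\<omega>. iexp (x * ((\<Sum>t\<in>\<Lambda> k. u (window t \<omega>)) / sqrt (real (card (\<Lambda> k))))))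
      - complex_of_real (exp (- (expectation (\<lambda>\<omega>. (\<Sum>t\<in>\<Lambda> k. u (window t \<omega>))\<^sup>2) / real (card (\<Lambda> k))) * x\<^sup>2 / 2)))) \<longlonglongrightarrow> 0"
    (is "?D \<longlonglongrightarrow> 0")
proof (rule tendstoI)
  fix e :: real assume e: "0 < e"
  define C where "C = 4 * K\<^sup>2 + 16 * K ^ 4"
  have C: "0 \<le> C" by (simp add: C_def)
  \<comment> \<open>The \<open>1\<close> avoids a division by zero when \<open>x\<close> or
    \<open>C\<close> is 0.\<close>
  define \<epsilon> where "\<epsilon> = e / (2 * (3 * C * x\<^sup>2 + 1))"
  have \<epsilon>: "0 < \<epsilon>" unfolding \<epsilon>_def using e C by (intro divide_pos_pos mult_pos_pos add_nonneg_pos) auto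
  have \<epsilon>': "3 * C * x\<^sup>2 * \<epsilon> \<le> e / 2"
  proof -
    have "0 < 3 * C * x\<^sup>2 + 1" using C by (intro add_nonneg_pos) auto
    moreover have "3 * C * x\<^sup>2 * \<epsilon> \<le> (3 * C * x\<^sup>2 + 1) * \<epsilon>" using \<epsilon> by (simp add: distrib_right)
    moreover have "(3 * C * x\<^sup>2 + 1) * \<epsilon> = e / 2"
    proof -
      have "a * (e / (2 * a)) = e / 2" if "0 < a" for a :: real using that by simp
      from this[OF \<open>0 < 3 * C * x\<^sup>2 + 1\<close>] show ?thesis by (simp only: \<epsilon>_def)
    qed
    ultimately show ?thesis by linarith
  qed
  \<comment> \<open>The 1 in the minimum forces \<open>dep h < 1\<close> off \<open>H\<close>, as
    each single value is at most the tail sum.\<close>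
  obtain H0 where H0: "finite H0" "\<And>H'. H0 \<subseteq> H' \<Longrightarrow> finite H' \<Longrightarrow> (\<Sum>\<^sub>\<infinity>h\<in>-H'. dep h) < min \<epsilon> 1"
    using infsum_tail_small[OF dep_sum, of "min \<epsilon> 1"] \<epsilon> by auto
  define H where "H = H0 \<union> uminus ` H0"
  have "finite H" "H0 \<subseteq> H" using H0(1) by (auto simp: H_def)
  then have H: "finite H" "\<And>h. h \<in> H \<Longrightarrow> - h \<in> H" "(\<Sum>\<^sub>\<infinity>h\<in>-H. dep h) < min \<epsilon> 1"
    using H0(2)[of H] by (auto simp: H_def)
  have H1: "dep h < 1" if "h \<notin> H" for h
  proof -
    have "dep summable_on - H" by (rule summable_on_subset_banach[OF dep_sum]) simp
    then have "sum dep {h} \<le> (\<Sum>\<^sub>\<infinity>h\<in>-H. dep h)" using that by (intro finite_sum_le_infsum dep_nonneg) auto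
    then show ?thesis using H(3) by simp
  qed
  define b where "b = real (card H)"
  define A where "A = (\<Sum>\<^sub>\<infinity>h. dep h)"
  define N where "N k = real (card (\<Lambda> k))" for k
  define r where "r k = 1 / sqrt (N k)" for k
  have "filterlim (\<lambda>k. sqrt (N k)) at_top sequentially"
    unfolding N_def by (rule filterlim_compose[OF sqrt_at_top card])
  then have r0: "r \<longlonglongrightarrow> 0"
    unfolding r_def[abs_def] by (intro real_tendsto_divide_at_top[OF tendsto_const])
  have "(\<lambda>k. 3 * C * x\<^sup>2 * \<epsilon> + (K * (b * K)\<^sup>2 * \<bar>x\<bar> ^ 3 / 2 + 2 * b * sqrt (C * A) * x\<^sup>2) * r k) \<longlonglongrightarrow> 3 * C * x\<^sup>2 * \<epsilon> + (K * (b * K)\<^sup>2 * \<bar>x\<bar> ^ 3 / 2 + 2 * b * sqrt (C * A) * x\<^sup>2) * 0"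
    by (intro tendsto_intros r0)
  from order_tendstoD(2)[OF this, of e]
  have "\<forall>\<^sub>F k in sequentially. 3 * C * x\<^sup>2 * \<epsilon> + (K * (b * K)\<^sup>2 * \<bar>x\<bar> ^ 3 / 2 + 2 * b * sqrt (C * A) * x\<^sup>2) * r k < e"
    using \<epsilon>' e by simp
  moreover have "\<forall>\<^sub>F k in sequentially. 0 < N k"
    using card unfolding N_def filterlim_at_top_dense by blast
  ultimately show "\<forall>\<^sub>F k in sequentially. dist (?D k) 0 < e"
  proof eventually_elim
    case (elim k)
    define S where "S \<omega> = (\<Sum>t\<in>\<Lambda> k. u (window t \<omega>))" for \<omega>
    define \<theta> where "\<theta> = x * r k"
    have r: "0 < r k" "(r k)\<^sup>2 * N k = 1" "N k = (sqrt (N k))\<^sup>2" "r k * sqrt (N k) = 1" using elim(2) by (auto simp: r_def power_divide)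
    have "?D k = cmod (expectation (\<lambda>\<omega>. iexp (\<theta> * S \<omega>)) - complex_of_real (exp (- expectation (\<lambda>\<omega>. (S \<omega>)\<^sup>2) * \<theta>\<^sup>2 / 2)))"
    proof -
      have "x * (y / sqrt (N k)) = \<theta> * y" for y by (simp add: \<theta>_def r_def)
      moreover have "- (y / N k) * x\<^sup>2 / 2 = - y * \<theta>\<^sup>2 / 2" for y
        using elim(2) by (simp add: \<theta>_def r_def power_mult_distrib power_divide)
      ultimately show ?thesis unfolding S_def N_def[symmetric] by (simp only:)
    qed
    also have "\<dots> \<le> (3 * C * \<epsilon> * N k * \<bar>\<theta>\<bar> + N k * K * (b * K)\<^sup>2 * \<theta>\<^sup>2 / 2 + 2 * b * sqrt (C * N k * A) * \<bar>\<theta>\<bar>) * \<bar>\<theta>\<bar>"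
      unfolding S_def N_def b_def A_def C_def
      by (rule field_clt_estimate[OF u mean fin H(1,2) H1 dep_sum]) (use H(3) in auto)
    also have "\<dots> = 3 * C * x\<^sup>2 * \<epsilon> + (K * (b * K)\<^sup>2 * \<bar>x\<bar> ^ 3 / 2 + 2 * b * sqrt (C * A) * x\<^sup>2) * r k"
    proof -
      have t: "\<bar>\<theta>\<bar> = \<bar>x\<bar> * r k" "\<theta>\<^sup>2 = x\<^sup>2 * (r k)\<^sup>2" using r(1) by (simp_all add: \<theta>_def abs_mult power_mult_distrib)
      have "sqrt (C * N k * A) = sqrt (C * A) * sqrt (N k)" by (simp add: real_sqrt_mult mult_ac)
      then have "(3 * C * \<epsilon> * N k * \<bar>\<theta>\<bar> + N k * K * (b * K)\<^sup>2 * \<theta>\<^sup>2 / 2 + 2 * b * sqrt (C * N k * A) * \<bar>\<theta>\<bar>) * \<bar>\<theta>\<bar>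
        = 3 * C * \<epsilon> * (\<bar>x\<bar> * \<bar>x\<bar>) * ((r k)\<^sup>2 * N k) + K * (b * K)\<^sup>2 * (\<bar>x\<bar> * x\<^sup>2) / 2 * ((r k)\<^sup>2 * N k) * r k
          + 2 * b * sqrt (C * A) * (\<bar>x\<bar> * \<bar>x\<bar>) * (r k * sqrt (N k)) * r k"
        unfolding t by (simp add: power2_eq_square algebra_simps)
      also have "\<dots> = 3 * C * x\<^sup>2 * \<epsilon> + (K * (b * K)\<^sup>2 * \<bar>x\<bar> ^ 3 / 2 + 2 * b * sqrt (C * A) * x\<^sup>2) * r k"
        unfolding r(2,4) by (simp add: power3_eq_cube power2_eq_square algebra_simps)
      finally show ?thesis .
    qed
    finally show ?case using elim(1) by (simp add: dist_real_def)
  qed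
qed

end

section \<open>Removal of the truncation and passage to the limit law\<close>

section \<open>Truncation and the central limit theorem\<close>

lemma cmod_iexp_diff_le: "cmod (iexp a - iexp b) \<le> \<bar>a - b\<bar>"
proof -
  have "iexp a - iexp b = iexp b * (iexp (a - b) - 1)" by (simp add: exp_diff right_diff_distrib)
  then show ?thesis using iexp_bounds(1)[of "a - b"] by (simp add: norm_mult)
qed

lemma abs_exp_minus_diff_le:
  fixes a b :: real
  assumes "0 \<le> a" "0 \<le> b"
  shows "\<bar>exp (- a) - exp (- b)\<bar> \<le> \<bar>a - b\<bar>"
proof -
  have *: "\<bar>exp (- a) - exp (- b)\<bar> \<le> \<bar>a - b\<bar>" if "0 \<le> a" "a \<le> b" for a b :: real
  proof -
    have "exp (- a) - exp (- b) = exp (- a) * (1 - exp (- (b - a)))" by (simp add: right_diff_distrib flip: exp_add)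
    also have "\<dots> \<le> 1 * (b - a)"
    proof (rule mult_mono)
      show "1 - exp (- (b - a)) \<le> b - a" using exp_ge_add_one_self[of "- (b - a)"] by linarith
    qed (use that in auto)
    finally show ?thesis using that by simp
  qed
  show ?thesis using *[of a b] *[of b a] assms by (cases "a \<le> b") (auto simp: abs_minus_commute)
qed

lemma (in prob_space) covariance_eq_covar:
  fixes Y Z :: "'a \<Rightarrow> real"
  assumes "integrable M Y" "integrable M Z" "integrable M (\<lambda>\<omega>. Y \<omega> * Z \<omega>)"
  shows "covariance M Y Z = covar Y Z"
proof -
  have "(\<lambda>\<omega>. (Y \<omega> - expectation Y) * (Z \<omega> - expectation Z))
    = (\<lambda>\<omega>. Y \<omega> * Z \<omega> - expectation Z * Y \<omega> - expectation Y * Z \<omega> + expectation Y * expectation Z)"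
    by (simp add: algebra_simps)
  then show ?thesis unfolding covariance_def using assms by (simp add: prob_space)
qed

lemma filterlim_card_exhaustion:
  fixes \<Lambda> :: "nat \<Rightarrow> 'a set"
  assumes "infinite (UNIV :: 'a set)" "\<And>n. finite (\<Lambda> n)" "incseq \<Lambda>" "(\<Union>n. \<Lambda> n) = UNIV"
  shows "filterlim (\<lambda>n. real (card (\<Lambda> n))) at_top sequentially"
  unfolding filterlim_at_top
proof
  fix Z :: real
  obtain F :: "'a set" where F: "finite F" "card F = nat \<lceil>Z\<rceil>"
    using infinite_arbitrarily_large[OF assms(1)] by blast
  have "\<forall>x\<in>F. \<forall>\<^sub>F n in sequentially. x \<in> \<Lambda> n"
  proof
    fix x assume "x \<in> F"
    obtain n where "x \<in> \<Lambda> n" using assms(4) by blast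
    then show "\<forall>\<^sub>F n in sequentially. x \<in> \<Lambda> n"
      using assms(3) unfolding eventually_sequentially incseq_def by blast
  qed
  from eventually_ball_finite[OF F(1) this]
  show "\<forall>\<^sub>F n in sequentially. Z \<le> real (card (\<Lambda> n))"
  proof eventually_elim
    case (elim n)
    then have "card F \<le> card (\<Lambda> n)" using assms(2) by (intro card_mono) auto
    then show ?case using F(2) by linarith
  qed
qed

lemma infinite_lattice: "infinite (UNIV :: (int ^ 'd) set)"
proof
  assume "finite (UNIV :: (int ^ 'd) set)"
  then have "finite (range (\<lambda>k. (\<chi> i. k) :: int ^ 'd))" by (rule rev_finite_subset) simp
  then have "finite (UNIV :: int set)" by (rule finite_imageD) (simp add: inj_on_def vec_eq_iff)
  then show False by simp
qed

lemma char_normal_law: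
  assumes "0 \<le> v"
  shows "char (normal_law 0 v) x = complex_of_real (exp (- v * x\<^sup>2 / 2))" and "real_distribution (normal_law 0 v)"
proof -
  have "char (normal_law 0 v) x = complex_of_real (exp (- v * x\<^sup>2 / 2)) \<and> real_distribution (normal_law 0 v)"
  proof (cases "v = 0")
    case True
    have "real_distribution (return borel (0::real))"
      unfolding real_distribution_def real_distribution_axioms_def by (simp add: prob_space_return)
    then show ?thesis using True by (simp add: normal_law_def char_def integral_return)
  next
    case False
    define s where "s = sqrt v"
    have s: "0 < s" "s\<^sup>2 = v" using False assms by (simp_all add: s_def)
    define N where "N = density lborel (\<lambda>x. ennreal (normal_density 0 s x))"
    have law: "normal_law 0 v = N" using False by (simp add: normal_law_def N_def s_def)
    interpret N: prob_space N unfolding N_def by (rule prob_space_normal_density[OF s(1)])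
    have "distributed N lborel (\<lambda>x. x) (normal_density 0 s)"
      unfolding distributed_def N_def by (auto simp: distr_id2)
    then have "distributed N lborel (\<lambda>x. (x - 0) / s) std_normal_density"
      using N.normal_standard_normal_convert[OF s(1), of "\<lambda>x. x" 0] by simp
    then have d: "distr N lborel (\<lambda>x. x / s) = std_normal_distribution"
      unfolding distributed_def by simp
    have sN: "sets N = sets borel" by (simp add: N_def)
    have "(\<lambda>x::real. x / s) \<in> borel_measurable borel" by measurable
    then have scale: "(\<lambda>x. x / s) \<in> measurable N lborel"
      unfolding measurable_cong_sets[OF sN sets_lborel] .
    have "char N x = (CLINT y|N. iexp ((x * s) * (y / s)))" using s by (simp add: char_def)
    also have "\<dots> = (CLINT z|distr N lborel (\<lambda>x. x / s). iexp ((x * s) * z))"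
      by (rule integral_distr[symmetric, OF scale]) simp
    also have "\<dots> = char std_normal_distribution (x * s)" by (simp add: d char_def)
    also have "\<dots> = complex_of_real (exp (- (x * s)\<^sup>2 / 2))" by (simp add: char_std_normal_distribution)
    finally have "char N x = complex_of_real (exp (- v * x\<^sup>2 / 2))" using s by (simp add: power_mult_distrib mult.commute)
    moreover have "real_distribution N"
      unfolding real_distribution_def real_distribution_axioms_def using N.prob_space_axioms by (simp add: N_def)
    ultimately show ?thesis by (simp add: law)
  qed
  then show "char (normal_law 0 v) x = complex_of_real (exp (- v * x\<^sup>2 / 2))" "real_distribution (normal_law 0 v)" by auto
qed

context window_field begin

definition centred_sum :: "(real ^ 'p \<Rightarrow> real) \<Rightarrow> (int ^ 'd) set \<Rightarrow> 'w \<Rightarrow> real" where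
  "centred_sum w \<Lambda> \<omega> = (\<Sum>t\<in>\<Lambda>. w (window t \<omega>) - expectation (\<lambda>\<omega>. w (window 0 \<omega>)))"

lemma centred_sum_measurable [measurable]:
  "w \<in> borel_measurable borel \<Longrightarrow> centred_sum w \<Lambda> \<in> borel_measurable M"
  unfolding centred_sum_def[abs_def]
  by (intro borel_measurable_sum borel_measurable_diff borel_measurable_const measurable_compose[OF window_measurable])

lemma covar_shift:
  assumes [measurable]: "w \<in> borel_measurable borel"
  shows "covar (\<lambda>\<omega>. w (window s \<omega>)) (\<lambda>\<omega>. w (window t \<omega>)) = covar (\<lambda>\<omega>. w (window 0 \<omega>)) (\<lambda>\<omega>. w (window (t - s) \<omega>))"
proof -
  have "expectation (\<lambda>\<omega>. w (window a \<omega>) * w (window b \<omega>))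
    = (\<integral>z. w (fst z) * w (snd z) \<partial>distr M (borel \<Otimes>\<^sub>M borel) (\<lambda>\<omega>. (window a \<omega>, window b \<omega>)))" for a b
    by (subst integral_distr) auto
  then have "expectation (\<lambda>\<omega>. w (window s \<omega>) * w (window t \<omega>)) = expectation (\<lambda>\<omega>. w (window 0 \<omega>) * w (window (t - s) \<omega>))"
    by (simp only: window_pair_law[of s t])
  then show ?thesis
    using window_integral(1)[OF assms, of s] window_integral(1)[OF assms, of t] window_integral(1)[OF assms, of "t - s"] by simp
qed

lemma centred_sum_second_moment:
  assumes w [measurable]: "w \<in> borel_measurable borel"
    and i: "\<And>s. integrable M (\<lambda>\<omega>. w (window s \<omega>))" and ii: "\<And>s t. integrable M (\<lambda>\<omega>. w (window s \<omega>) * w (window t \<omega>))"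
  shows "integrable M (\<lambda>\<omega>. (centred_sum w \<Lambda> \<omega>)\<^sup>2)"
    and "expectation (\<lambda>\<omega>. (centred_sum w \<Lambda> \<omega>)\<^sup>2) = (\<Sum>s\<in>\<Lambda>. \<Sum>t\<in>\<Lambda>. covar (\<lambda>\<omega>. w (window 0 \<omega>)) (\<lambda>\<omega>. w (window (t - s) \<omega>)))"
proof -
  define m where "m = expectation (\<lambda>\<omega>. w (window 0 \<omega>))"
  have Em: "expectation (\<lambda>\<omega>. w (window t \<omega>)) = m" for t using window_integral(1)[OF w, of t] by (simp add: m_def)
  have eq: "(w (window s \<omega>) - m) * (w (window t \<omega>) - m) = w (window s \<omega>) * w (window t \<omega>) - m * w (window s \<omega>) - m * w (window t \<omega>) + m * m" for s t \<omega>
    by (simp add: algebra_simps)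
  have int: "integrable M (\<lambda>\<omega>. (w (window s \<omega>) - m) * (w (window t \<omega>) - m))" for s t
    unfolding eq using i ii by simp
  have cov: "expectation (\<lambda>\<omega>. (w (window s \<omega>) - m) * (w (window t \<omega>) - m)) = covar (\<lambda>\<omega>. w (window 0 \<omega>)) (\<lambda>\<omega>. w (window (t - s) \<omega>))" for s t
  proof -
    have "expectation (\<lambda>\<omega>. (w (window s \<omega>) - m) * (w (window t \<omega>) - m)) = covar (\<lambda>\<omega>. w (window s \<omega>)) (\<lambda>\<omega>. w (window t \<omega>))"
      unfolding eq using i ii by (simp add: prob_space Em)
    then show ?thesis by (simp only: covar_shift[OF w, of s t])
  qed
  have sq: "(centred_sum w \<Lambda> \<omega>)\<^sup>2 = (\<Sum>s\<in>\<Lambda>. \<Sum>t\<in>\<Lambda>. (w (window s \<omega>) - m) * (w (window t \<omega>) - m))" for \<omega>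
    unfolding centred_sum_def m_def power2_eq_square sum_product ..
  show "integrable M (\<lambda>\<omega>. (centred_sum w \<Lambda> \<omega>)\<^sup>2)"
    unfolding sq by (intro Bochner_Integration.integrable_sum int)
  show "expectation (\<lambda>\<omega>. (centred_sum w \<Lambda> \<omega>)\<^sup>2) = (\<Sum>s\<in>\<Lambda>. \<Sum>t\<in>\<Lambda>. covar (\<lambda>\<omega>. w (window 0 \<omega>)) (\<lambda>\<omega>. w (window (t - s) \<omega>)))"
    unfolding sq using int by (simp add: Bochner_Integration.integral_sum cov)
qed

text \<open>Each row of the covariance matrix is dominated by the full series of Davydov bounds,
  whence a variance of order \<open>card \<Lambda>\<close>. The summand 1 keeps the bound positive,
  as \<open>char_truncation_error\<close> requires of its \<rho>.\<close>

lemma centred_sum_variance_bound: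
  assumes w: "w \<in> borel_measurable borel" and \<delta>: "0 < \<delta>" and m0: "0 < m"
    and int: "integrable M (\<lambda>\<omega>. \<bar>w (window 0 \<omega>)\<bar> powr (2 + \<delta>))"
    and m: "expectation (\<lambda>\<omega>. \<bar>w (window 0 \<omega>)\<bar> powr (2 + \<delta>)) \<le> m"
    and sum: "(\<lambda>h. dep h powr (\<delta> / (2 + \<delta>))) summable_on UNIV" and fin: "finite \<Lambda>"
  shows "integrable M (\<lambda>\<omega>. (centred_sum w \<Lambda> \<omega>)\<^sup>2)"
    and "expectation (\<lambda>\<omega>. (centred_sum w \<Lambda> \<omega>)\<^sup>2)
      \<le> real (card \<Lambda>) * (11 * m powr (2 / (2 + \<delta>)) * (1 + (\<Sum>\<^sub>\<infinity>h. dep h powr (\<delta> / (2 + \<delta>)))))"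
proof -
  let ?q = "\<delta> / (2 + \<delta>)"
  have i: "integrable M (\<lambda>\<omega>. w (window s \<omega>))" "integrable M (\<lambda>\<omega>. w (window s \<omega>) * w (window t \<omega>))" for s t
    using covariance_truncation(2,3)[OF w \<delta> zero_less_one int m] by blast+
  show "integrable M (\<lambda>\<omega>. (centred_sum w \<Lambda> \<omega>)\<^sup>2)" by (rule centred_sum_second_moment(1)[OF w i])
  have "expectation (\<lambda>\<omega>. (centred_sum w \<Lambda> \<omega>)\<^sup>2) = (\<Sum>s\<in>\<Lambda>. \<Sum>t\<in>\<Lambda>. covar (\<lambda>\<omega>. w (window 0 \<omega>)) (\<lambda>\<omega>. w (window (t - s) \<omega>)))"
    by (rule centred_sum_second_moment(2)[OF w i])
  also have "\<dots> \<le> (\<Sum>s\<in>\<Lambda>. \<Sum>t\<in>\<Lambda>. 11 * m powr (2 / (2 + \<delta>)) * dep (t - s) powr ?q)"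
  proof (intro sum_mono)
    fix s t
    show "covar (\<lambda>\<omega>. w (window 0 \<omega>)) (\<lambda>\<omega>. w (window (t - s) \<omega>)) \<le> 11 * m powr (2 / (2 + \<delta>)) * dep (t - s) powr ?q"
      using order_trans[OF abs_ge_self covariance_davydov[OF w \<delta> m0 int m, of 0 "t - s"]] by (simp only: diff_zero)
  qed
  also have "\<dots> \<le> (\<Sum>s\<in>\<Lambda>. 11 * m powr (2 / (2 + \<delta>)) * (1 + (\<Sum>\<^sub>\<infinity>h. dep h powr ?q)))"
  proof (rule sum_mono)
    fix s
    have "(\<Sum>t\<in>\<Lambda>. dep (t - s) powr ?q) = sum (\<lambda>h. dep h powr ?q) ((\<lambda>t. t - s) ` \<Lambda>)"
      by (subst sum.reindex) (auto simp: inj_on_def)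
    also have "\<dots> \<le> (\<Sum>\<^sub>\<infinity>h. dep h powr ?q)" using fin sum by (intro finite_sum_le_infsum) auto
    finally show "(\<Sum>t\<in>\<Lambda>. 11 * m powr (2 / (2 + \<delta>)) * dep (t - s) powr ?q) \<le> 11 * m powr (2 / (2 + \<delta>)) * (1 + (\<Sum>\<^sub>\<infinity>h. dep h powr ?q))"
      unfolding sum_distrib_left[symmetric] by (intro mult_left_mono) auto
  qed
  finally show "expectation (\<lambda>\<omega>. (centred_sum w \<Lambda> \<omega>)\<^sup>2)
      \<le> real (card \<Lambda>) * (11 * m powr (2 / (2 + \<delta>)) * (1 + (\<Sum>\<^sub>\<infinity>h. dep h powr ?q)))" by simp
qed

text \<open>S = U + T, where T belongs to the part \<open>g - w\<close> that is cut off. The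
  characteristic functions differ by at most |x| E|T| / sqrt n \<le> |x| sqrt \<rho>. For the
  variances, 2 |S T| \<le> s S^2 + T^2 / s with s = sqrt \<rho> gives a difference of at most n (s
  (B + 1) + \<rho>), and exp (- a) is 1-Lipschitz for a \<ge> 0. The added error does not depend on
  \<Lambda>.\<close>

lemma char_truncation_error:
  fixes x :: real
  assumes g [measurable]: "g \<in> borel_measurable borel" and w [measurable]: "w \<in> borel_measurable borel"
    and i: "integrable M (\<lambda>\<omega>. g (window 0 \<omega>))" "integrable M (\<lambda>\<omega>. w (window 0 \<omega>))"
    and S: "integrable M (\<lambda>\<omega>. (centred_sum g \<Lambda> \<omega>)\<^sup>2)" "expectation (\<lambda>\<omega>. (centred_sum g \<Lambda> \<omega>)\<^sup>2) \<le> real (card \<Lambda>) * B"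
    and T: "integrable M (\<lambda>\<omega>. (centred_sum (\<lambda>z. g z - w z) \<Lambda> \<omega>)\<^sup>2)"
      "expectation (\<lambda>\<omega>. (centred_sum (\<lambda>z. g z - w z) \<Lambda> \<omega>)\<^sup>2) \<le> real (card \<Lambda>) * \<rho>"
    and \<rho>: "0 < \<rho>" and N: "0 < real (card \<Lambda>)"
  defines "err \<equiv> \<lambda>f. cmod (expectation (\<lambda>\<omega>. iexp (x * (centred_sum f \<Lambda> \<omega> / sqrt (real (card \<Lambda>)))))
      - complex_of_real (exp (- (expectation (\<lambda>\<omega>. (centred_sum f \<Lambda> \<omega>)\<^sup>2) / real (card \<Lambda>)) * x\<^sup>2 / 2)))"
  shows "err g \<le> err w + \<bar>x\<bar> * sqrt \<rho> + (sqrt \<rho> * (B + 1) + \<rho>) * x\<^sup>2 / 2"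
proof -
  define n where "n = real (card \<Lambda>)"
  define s where "s = sqrt \<rho>"
  have s: "0 < s" "s * s = \<rho>" using \<rho> by (simp_all add: s_def)
  have n: "0 < n" using N by (simp add: n_def)
  let ?S = "centred_sum g \<Lambda>" and ?T = "centred_sum (\<lambda>z. g z - w z) \<Lambda>" and ?U = "centred_sum w \<Lambda>"
  have ST: "?U \<omega> = ?S \<omega> - ?T \<omega>" for \<omega>
    unfolding centred_sum_def using i by (simp add: sum_subtractf[symmetric])
  have i1: "integrable M ?S" "integrable M ?T" using S T by (auto intro!: expectation_abs_le_sqrt(1))
  have ch: "cmod (expectation (\<lambda>\<omega>. iexp (x * (?S \<omega> / sqrt n))) - expectation (\<lambda>\<omega>. iexp (x * (?U \<omega> / sqrt n)))) \<le> \<bar>x\<bar> * s"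
  proof -
    have ie: "integrable M (\<lambda>\<omega>. iexp (x * (centred_sum f \<Lambda> \<omega> / sqrt n)))" if "f \<in> borel_measurable borel" for f
      using that by (intro integrable_bounded_complex[where B = 1]) auto
    have "cmod (expectation (\<lambda>\<omega>. iexp (x * (?S \<omega> / sqrt n))) - expectation (\<lambda>\<omega>. iexp (x * (?U \<omega> / sqrt n))))
      = cmod (expectation (\<lambda>\<omega>. iexp (x * (?S \<omega> / sqrt n)) - iexp (x * (?U \<omega> / sqrt n))))"
      by (subst Bochner_Integration.integral_diff) (use ie[OF g] ie[OF w] in auto)
    also have "\<dots> \<le> expectation (\<lambda>\<omega>. cmod (iexp (x * (?S \<omega> / sqrt n)) - iexp (x * (?U \<omega> / sqrt n))))"
      by (rule integral_norm_bound)
    also have "\<dots> \<le> expectation (\<lambda>\<omega>. \<bar>x\<bar> / sqrt n * \<bar>?T \<omega>\<bar>)"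
    proof (rule integral_mono)
      show "integrable M (\<lambda>\<omega>. cmod (iexp (x * (?S \<omega> / sqrt n)) - iexp (x * (?U \<omega> / sqrt n))))"
        by (intro integrable_norm Bochner_Integration.integrable_diff ie g w)
      show "integrable M (\<lambda>\<omega>. \<bar>x\<bar> / sqrt n * \<bar>?T \<omega>\<bar>)" using i1 by simp
      fix \<omega>
      have "x * (?S \<omega> / sqrt n) - x * (?U \<omega> / sqrt n) = x / sqrt n * ?T \<omega>"
        unfolding ST by (simp add: diff_divide_distrib right_diff_distrib)
      then show "cmod (iexp (x * (?S \<omega> / sqrt n)) - iexp (x * (?U \<omega> / sqrt n))) \<le> \<bar>x\<bar> / sqrt n * \<bar>?T \<omega>\<bar>"
        using cmod_iexp_diff_le[of "x * (?S \<omega> / sqrt n)" "x * (?U \<omega> / sqrt n)"] n by (simp only: abs_mult abs_divide) simp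
    qed
    also have "\<dots> = \<bar>x\<bar> / sqrt n * expectation (\<lambda>\<omega>. \<bar>?T \<omega>\<bar>)" by simp
    also have "\<dots> \<le> \<bar>x\<bar> / sqrt n * sqrt (n * \<rho>)"
    proof (intro mult_left_mono)
      have "expectation (\<lambda>\<omega>. \<bar>?T \<omega>\<bar>) \<le> sqrt (expectation (\<lambda>\<omega>. (?T \<omega>)\<^sup>2))" using T by (intro expectation_abs_le_sqrt(2)) auto
      also have "\<dots> \<le> sqrt (n * \<rho>)" using T by (simp add: n_def)
      finally show "expectation (\<lambda>\<omega>. \<bar>?T \<omega>\<bar>) \<le> sqrt (n * \<rho>)" .
    qed (use n in simp)
    also have "\<dots> = \<bar>x\<bar> * s" using n by (simp add: real_sqrt_mult s_def)
    finally show ?thesis .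
  qed
  have var: "\<bar>expectation (\<lambda>\<omega>. (?S \<omega>)\<^sup>2) - expectation (\<lambda>\<omega>. (?U \<omega>)\<^sup>2)\<bar> \<le> n * (s * (B + 1) + \<rho>)"
    and U: "integrable M (\<lambda>\<omega>. (?U \<omega>)\<^sup>2)"
  proof -
    have b: "\<bar>2 * ?S \<omega> * ?T \<omega>\<bar> \<le> s * (?S \<omega>)\<^sup>2 + (?T \<omega>)\<^sup>2 / s" for \<omega>
    proof -
      have "0 \<le> (s * \<bar>?S \<omega>\<bar> - \<bar>?T \<omega>\<bar>)\<^sup>2 / s" using s by simp
      also have "\<dots> = s * (?S \<omega>)\<^sup>2 + (?T \<omega>)\<^sup>2 / s - 2 * \<bar>?S \<omega>\<bar> * \<bar>?T \<omega>\<bar>"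
        using s by (simp add: power2_diff power_mult_distrib power2_eq_square field_simps)
      finally show ?thesis by (simp add: abs_mult)
    qed
    have bi: "integrable M (\<lambda>\<omega>. s * (?S \<omega>)\<^sup>2 + (?T \<omega>)\<^sup>2 / s)" using S T by simp
    have STi: "integrable M (\<lambda>\<omega>. 2 * ?S \<omega> * ?T \<omega>)"
      by (rule Bochner_Integration.integrable_bound[OF bi]) (use b in \<open>auto intro!: order_trans[OF b]\<close>)
    have Usq: "(?U \<omega>)\<^sup>2 = (?S \<omega>)\<^sup>2 - 2 * ?S \<omega> * ?T \<omega> + (?T \<omega>)\<^sup>2" for \<omega> unfolding ST by (simp add: power2_diff)
    show "integrable M (\<lambda>\<omega>. (?U \<omega>)\<^sup>2)" unfolding Usq using S(1) T(1) STi by simp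
    have "\<bar>expectation (\<lambda>\<omega>. (?S \<omega>)\<^sup>2) - expectation (\<lambda>\<omega>. (?U \<omega>)\<^sup>2)\<bar>
      = \<bar>expectation (\<lambda>\<omega>. 2 * ?S \<omega> * ?T \<omega>) - expectation (\<lambda>\<omega>. (?T \<omega>)\<^sup>2)\<bar>"
      unfolding Usq using S(1) T(1) STi by simp
    also have "\<dots> \<le> expectation (\<lambda>\<omega>. \<bar>2 * ?S \<omega> * ?T \<omega>\<bar>) + expectation (\<lambda>\<omega>. (?T \<omega>)\<^sup>2)"
    proof -
      have "\<bar>expectation (\<lambda>\<omega>. 2 * ?S \<omega> * ?T \<omega>)\<bar> \<le> expectation (\<lambda>\<omega>. \<bar>2 * ?S \<omega> * ?T \<omega>\<bar>)" by (rule integral_abs_bound)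
      moreover have "0 \<le> expectation (\<lambda>\<omega>. (?T \<omega>)\<^sup>2)" by (rule Bochner_Integration.integral_nonneg) simp
      ultimately show ?thesis by linarith
    qed
    also have "expectation (\<lambda>\<omega>. \<bar>2 * ?S \<omega> * ?T \<omega>\<bar>) \<le> expectation (\<lambda>\<omega>. s * (?S \<omega>)\<^sup>2 + (?T \<omega>)\<^sup>2 / s)"
      using STi bi b by (intro integral_mono) auto
    also have "\<dots> = s * expectation (\<lambda>\<omega>. (?S \<omega>)\<^sup>2) + expectation (\<lambda>\<omega>. (?T \<omega>)\<^sup>2) / s" using S(1) T(1) by simp
    also have "\<dots> \<le> s * (n * B) + (n * \<rho>) / s"
      using S(2) T(2) s by (intro add_mono mult_left_mono divide_right_mono) (auto simp: n_def)
    also have "(n * \<rho>) / s = n * s" using s by (simp add: field_simps)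
    finally have "\<bar>expectation (\<lambda>\<omega>. (?S \<omega>)\<^sup>2) - expectation (\<lambda>\<omega>. (?U \<omega>)\<^sup>2)\<bar> \<le> s * (n * B) + n * s + n * \<rho>"
      using T(2) by (simp add: n_def)
    then show "\<bar>expectation (\<lambda>\<omega>. (?S \<omega>)\<^sup>2) - expectation (\<lambda>\<omega>. (?U \<omega>)\<^sup>2)\<bar> \<le> n * (s * (B + 1) + \<rho>)"
      by (simp add: algebra_simps)
  qed
  define v where "v = expectation (\<lambda>\<omega>. (?S \<omega>)\<^sup>2) / n"
  define v' where "v' = expectation (\<lambda>\<omega>. (?U \<omega>)\<^sup>2) / n"
  have v0: "0 \<le> v" "0 \<le> v'" unfolding v_def v'_def using n by (auto intro!: divide_nonneg_pos Bochner_Integration.integral_nonneg)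
  have "\<bar>v - v'\<bar> \<le> s * (B + 1) + \<rho>"
    using var n unfolding v_def v'_def by (simp add: diff_divide_distrib[symmetric] divide_le_eq mult.commute)
  then have vd: "\<bar>v - v'\<bar> * (x\<^sup>2 / 2) \<le> (s * (B + 1) + \<rho>) * (x\<^sup>2 / 2)" by (rule mult_right_mono) simp
  have "\<bar>exp (- (v * x\<^sup>2 / 2)) - exp (- (v' * x\<^sup>2 / 2))\<bar> \<le> \<bar>v * x\<^sup>2 / 2 - v' * x\<^sup>2 / 2\<bar>"
    using v0 by (intro abs_exp_minus_diff_le) auto
  also have "v * x\<^sup>2 / 2 - v' * x\<^sup>2 / 2 = (v - v') * (x\<^sup>2 / 2)" by (simp add: left_diff_distrib diff_divide_distrib)
  also have "\<bar>\<dots>\<bar> = \<bar>v - v'\<bar> * (x\<^sup>2 / 2)" by (simp add: abs_mult)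
  finally have ex: "cmod (complex_of_real (exp (- v' * x\<^sup>2 / 2)) - complex_of_real (exp (- v * x\<^sup>2 / 2))) \<le> (s * (B + 1) + \<rho>) * x\<^sup>2 / 2"
    using vd by (simp add: abs_minus_commute flip: of_real_diff)
  let ?a = "expectation (\<lambda>\<omega>. iexp (x * (?S \<omega> / sqrt n)))" and ?a' = "expectation (\<lambda>\<omega>. iexp (x * (?U \<omega> / sqrt n)))"
  let ?b = "complex_of_real (exp (- v * x\<^sup>2 / 2))" and ?b' = "complex_of_real (exp (- v' * x\<^sup>2 / 2))"
  have "?a - ?b = (?a - ?a') + (?a' - ?b') + (?b' - ?b)" by simp
  then have "cmod (?a - ?b) \<le> cmod (?a - ?a') + cmod (?a' - ?b') + cmod (?b' - ?b)"
    by (metis norm_triangle_le order_refl add_mono norm_triangle_ineq)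
  also have "\<dots> \<le> \<bar>x\<bar> * s + cmod (?a' - ?b') + (s * (B + 1) + \<rho>) * x\<^sup>2 / 2"
    using ch ex by (intro add_mono) auto
  finally show ?thesis unfolding err_def v_def v'_def n_def s_def by (simp add: add_ac)
qed

end

context window_field begin

text \<open>The truncation level is fixed first, making the error of
  \<open>char_truncation_error\<close> smaller than e / 2 for all k at once; the bounded case then
  handles the clipped function. The Gaussian factor carries the variance of the actual sum and not
  its limit, so the shape of \<Lambda> does not enter yet.\<close>

lemma char_limit:
  fixes \<Lambda> :: "nat \<Rightarrow> (int ^ 'd) set" and x :: real
  assumes g [measurable]: "g \<in> borel_measurable borel" and \<delta>: "0 < \<delta>"
    and int: "integrable M (\<lambda>\<omega>. \<bar>g (window 0 \<omega>)\<bar> powr (2 + \<delta>))"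
    and sum: "(\<lambda>h. dep h powr (\<delta> / (2 + \<delta>))) summable_on UNIV" and dep_sum: "dep summable_on UNIV"
    and fin: "\<And>k. finite (\<Lambda> k)" and card: "filterlim (\<lambda>k. real (card (\<Lambda> k))) at_top sequentially"
  shows "(\<lambda>k. cmod (expectation (\<lambda>\<omega>. iexp (x * (centred_sum g (\<Lambda> k) \<omega> / sqrt (real (card (\<Lambda> k))))))
      - complex_of_real (exp (- (expectation (\<lambda>\<omega>. (centred_sum g (\<Lambda> k) \<omega>)\<^sup>2) / real (card (\<Lambda> k))) * x\<^sup>2 / 2)))) \<longlonglongrightarrow> 0"
    (is "?D \<longlonglongrightarrow> 0")
proof (rule tendstoI)
  fix e :: real assume e: "0 < e"
  define D where "D = 1 + (\<Sum>\<^sub>\<infinity>h. dep h powr (\<delta> / (2 + \<delta>)))"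
  have D: "0 < D" unfolding D_def by (intro add_pos_nonneg infsum_nonneg) auto
  define r where "r K z = g z - clip (real K) (g z)" for K :: nat and z
  have r_meas [measurable]: "r K \<in> borel_measurable borel" for K unfolding r_def[abs_def] by measurable
  have r_le: "\<bar>r K z\<bar> powr (2 + \<delta>) \<le> \<bar>g z\<bar> powr (2 + \<delta>)" for K z
    using \<delta> clip_bounds(3)[of "real K" "g z"] unfolding r_def by (intro powr_mono2) auto
  have r_int: "integrable M (\<lambda>\<omega>. \<bar>r K (window 0 \<omega>)\<bar> powr (2 + \<delta>))" for K
    by (rule Bochner_Integration.integrable_bound[OF int]) (use r_le in auto)
  \<comment> \<open>The moment of the remainder may be 0; adding 1 / (K + 1) makes the bound
    positive and still lets it tend to 0.\<close>
  define m where "m K = expectation (\<lambda>\<omega>. \<bar>r K (window 0 \<omega>)\<bar> powr (2 + \<delta>)) + 1 / real (Suc K)" for K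
  have m0: "0 < m K" for K unfolding m_def by (intro add_nonneg_pos Bochner_Integration.integral_nonneg) auto
  have "(\<lambda>K. expectation (\<lambda>\<omega>. \<bar>r K (window 0 \<omega>)\<bar> powr (2 + \<delta>))) \<longlonglongrightarrow> expectation (\<lambda>\<omega>. 0)"
  proof (rule integral_dominated_convergence[where w = "\<lambda>\<omega>. \<bar>g (window 0 \<omega>)\<bar> powr (2 + \<delta>)"])
    show "AE \<omega> in M. (\<lambda>K. \<bar>r K (window 0 \<omega>)\<bar> powr (2 + \<delta>)) \<longlonglongrightarrow> 0"
    proof (rule AE_I2)
      fix \<omega>
      obtain N where N: "\<bar>g (window 0 \<omega>)\<bar> \<le> real N" using real_arch_simple by blast
      have "\<forall>\<^sub>F K in sequentially. \<bar>g (window 0 \<omega>)\<bar> \<le> real K"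
        using N by (intro eventually_sequentiallyI[of N]) (meson of_nat_mono order_trans)
      then have "\<forall>\<^sub>F K in sequentially. \<bar>r K (window 0 \<omega>)\<bar> powr (2 + \<delta>) = 0"
        by eventually_elim (simp add: r_def clip_bounds(4))
      then show "(\<lambda>K. \<bar>r K (window 0 \<omega>)\<bar> powr (2 + \<delta>)) \<longlonglongrightarrow> 0" by (rule tendsto_eventually)
    qed
  qed (use int r_le in auto)
  from tendsto_add[OF this LIMSEQ_inverse_real_of_nat]
  have m_lim: "m \<longlonglongrightarrow> 0" by (simp add: m_def[abs_def] inverse_eq_divide)
  define \<rho> where "\<rho> K = 11 * m K powr (2 / (2 + \<delta>)) * D" for K
  have \<rho>0: "0 < \<rho> K" for K using m0[of K] D by (simp add: \<rho>_def)
  have "(\<lambda>K. m K powr (2 / (2 + \<delta>))) \<longlonglongrightarrow> 0 powr (2 / (2 + \<delta>))"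
    using m_lim \<delta> m0 by (intro tendsto_powr' tendsto_const) (auto simp: less_imp_le)
  then have "(\<lambda>K. 11 * m K powr (2 / (2 + \<delta>)) * D) \<longlonglongrightarrow> 11 * 0 * D" by (intro tendsto_intros) simp
  then have \<rho>_lim: "\<rho> \<longlonglongrightarrow> 0" by (simp add: \<rho>_def[abs_def])
  define m' where "m' = expectation (\<lambda>\<omega>. \<bar>g (window 0 \<omega>)\<bar> powr (2 + \<delta>)) + 1"
  have m': "0 < m'" unfolding m'_def by (intro add_nonneg_pos Bochner_Integration.integral_nonneg) auto
  define B where "B = 11 * m' powr (2 / (2 + \<delta>)) * D"
  have "(\<lambda>K. \<bar>x\<bar> * sqrt (\<rho> K) + (sqrt (\<rho> K) * (B + 1) + \<rho> K) * x\<^sup>2 / 2) \<longlonglongrightarrow> \<bar>x\<bar> * sqrt 0 + (sqrt 0 * (B + 1) + 0) * x\<^sup>2 / 2"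
    by (intro tendsto_intros \<rho>_lim) simp
  then have "(\<lambda>K. \<bar>x\<bar> * sqrt (\<rho> K) + (sqrt (\<rho> K) * (B + 1) + \<rho> K) * x\<^sup>2 / 2) \<longlonglongrightarrow> 0" by simp
  from order_tendstoD(2)[OF this, of "e / 2"] e
  obtain K where K: "\<bar>x\<bar> * sqrt (\<rho> K) + (sqrt (\<rho> K) * (B + 1) + \<rho> K) * x\<^sup>2 / 2 < e / 2"
    by (auto simp: eventually_sequentially)
  define c where "c = expectation (\<lambda>\<omega>. clip (real K) (g (window 0 \<omega>)))"
  have c_le: "\<bar>c\<bar> \<le> real K"
  proof -
    have "integrable M (\<lambda>\<omega>. clip (real K) (g (window 0 \<omega>)))"
      by (rule integrable_bounded_real[where B = "real K"]) (auto simp: clip_bounds)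
    then show ?thesis unfolding c_def
      by (intro order_trans[OF integral_abs_bound] integral_le_const) (auto simp: clip_bounds)
  qed
  define w where "w z = clip (real K) (g z)" for z
  have w_meas [measurable]: "w \<in> borel_measurable borel" unfolding w_def[abs_def] by measurable
  have w_int: "integrable M (\<lambda>\<omega>. w (window 0 \<omega>))"
    unfolding w_def by (rule integrable_bounded_real[where B = "real K"]) (auto simp: clip_bounds)
  \<comment> \<open>The estimate for bounded fields is for centred variables; subtracting the mean
    doubles the bound to \<open>2 * K\<close>.\<close>
  define u where "u z = w z - c" for z
  have u_meas: "u \<in> borel_measurable borel" unfolding u_def[abs_def] by measurable
  have u_le: "\<bar>u z\<bar> \<le> 2 * real K" for z
    using clip_bounds(1)[of "real K" "g z"] c_le unfolding u_def w_def by linarith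
  have u_mean: "expectation (\<lambda>\<omega>. u (window 0 \<omega>)) = 0"
    using w_int by (simp add: u_def prob_space) (simp add: w_def c_def)
  have cs: "(\<Sum>t\<in>\<Lambda> k. u (window t \<omega>)) = centred_sum w (\<Lambda> k) \<omega>" for k \<omega>
    by (simp add: centred_sum_def u_def w_def c_def)
  from bounded_field_char_limit[OF u_meas u_le u_mean dep_sum fin card, of x, unfolded cs]
  have "\<forall>\<^sub>F k in sequentially. cmod (expectation (\<lambda>\<omega>. iexp (x * (centred_sum w (\<Lambda> k) \<omega> / sqrt (real (card (\<Lambda> k))))))
      - complex_of_real (exp (- (expectation (\<lambda>\<omega>. (centred_sum w (\<Lambda> k) \<omega>)\<^sup>2) / real (card (\<Lambda> k))) * x\<^sup>2 / 2))) < e / 2"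
    using e by (intro order_tendstoD(2)) auto
  moreover have "\<forall>\<^sub>F k in sequentially. 0 < real (card (\<Lambda> k))"
    using card unfolding filterlim_at_top_dense by blast
  ultimately show "\<forall>\<^sub>F k in sequentially. dist (?D k) 0 < e"
  proof eventually_elim
    case (elim k)
    have rw: "r K = (\<lambda>z. g z - w z)" by (simp add: r_def[abs_def] w_def)
    have g_le: "expectation (\<lambda>\<omega>. \<bar>g (window 0 \<omega>)\<bar> powr (2 + \<delta>)) \<le> m'" by (simp add: m'_def)
    have r_le: "expectation (\<lambda>\<omega>. \<bar>r K (window 0 \<omega>)\<bar> powr (2 + \<delta>)) \<le> m K" by (simp add: m_def)
    have g_i: "integrable M (\<lambda>\<omega>. g (window 0 \<omega>))"
      by (rule covariance_truncation(3)[OF g \<delta> zero_less_one int g_le])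
    note S = centred_sum_variance_bound[OF g \<delta> m' int g_le sum fin[of k], folded D_def, folded B_def]
    note T = centred_sum_variance_bound[OF r_meas \<delta> m0 r_int r_le sum fin[of k], folded D_def, folded \<rho>_def, unfolded rw]
    have "?D k \<le> cmod (expectation (\<lambda>\<omega>. iexp (x * (centred_sum w (\<Lambda> k) \<omega> / sqrt (real (card (\<Lambda> k))))))
      - complex_of_real (exp (- (expectation (\<lambda>\<omega>. (centred_sum w (\<Lambda> k) \<omega>)\<^sup>2) / real (card (\<Lambda> k))) * x\<^sup>2 / 2)))
      + \<bar>x\<bar> * sqrt (\<rho> K) + (sqrt (\<rho> K) * (B + 1) + \<rho> K) * x\<^sup>2 / 2"
      by (rule char_truncation_error[OF g w_meas g_i w_int S T \<rho>0 elim(2)])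
    then show ?case using elim(1) K by (simp add: dist_real_def)
  qed
qed

text \<open>By \<open>char_limit\<close> the normalised sums are asymptotically Gaussian with their
  own variances, these converge to the covariance series by \<open>cesaro_covariance\<close>, and
  Levy's continuity theorem concludes. A vanishing limit variance needs no separate argument here:
  the Gaussian formula then gives the constant 1, the characteristic function of the Dirac mass at
  0.\<close>

theorem window_functional_CLT:
  assumes g [measurable]: "g \<in> borel_measurable borel" and \<delta>: "0 < \<delta>"
    and int: "integrable M (\<lambda>\<omega>. \<bar>g (window 0 \<omega>)\<bar> powr (2 + \<delta>))"
    and s: "(\<Sum>\<^sub>\<infinity>m\<in>{1..}. of_nat m ^ (CARD('d) - 1) *
            (SUP h\<in>{h. int m \<le> sup_norm h}. ennreal_powr (gamma_coeff M \<mu> \<eta> h) (\<delta> / (2 + \<delta>)))) < \<infinity>"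
  shows "satisfies_CLT M (\<lambda>t \<omega>. g (window t \<omega>))"
proof -
  define q where "q = \<delta> / (2 + \<delta>)"
  have q: "0 < q" "q \<le> 1" using \<delta> by (simp_all add: q_def)
  note dq = dep_powr_summable[OF q, unfolded q_def, OF s]
  define m where "m = expectation (\<lambda>\<omega>. \<bar>g (window 0 \<omega>)\<bar> powr (2 + \<delta>)) + 1"
  have m: "0 < m" "expectation (\<lambda>\<omega>. \<bar>g (window 0 \<omega>)\<bar> powr (2 + \<delta>)) \<le> m"
    unfolding m_def by (auto intro!: add_nonneg_pos Bochner_Integration.integral_nonneg)
  have i: "integrable M (\<lambda>\<omega>. g (window s \<omega>))" "integrable M (\<lambda>\<omega>. g (window s \<omega>) * g (window t \<omega>))" for s t
    using covariance_truncation(2,3)[OF g \<delta> zero_less_one int m(2)] by blast+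
  define c where "c t = covar (\<lambda>\<omega>. g (window 0 \<omega>)) (\<lambda>\<omega>. g (window t \<omega>))" for t
  have cov: "covariance M (\<lambda>\<omega>. g (window 0 \<omega>)) (\<lambda>\<omega>. g (window t \<omega>)) = c t" for t
    unfolding c_def by (rule covariance_eq_covar[OF i(1) i(1) i(2)])
  have c_sum: "(\<lambda>t. \<bar>c t\<bar>) summable_on UNIV"
  proof (rule summable_on_comparison_test)
    show "(\<lambda>h. 11 * m powr (2 / (2 + \<delta>)) * dep h powr (\<delta> / (2 + \<delta>))) summable_on UNIV"
      by (rule summable_on_cmult_right[OF dq(1)])
    show "\<bar>c t\<bar> \<le> 11 * m powr (2 / (2 + \<delta>)) * dep t powr (\<delta> / (2 + \<delta>))" for t
      using covariance_davydov[OF g \<delta> m(1) int m(2), of 0 t] by (simp only: c_def diff_zero)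
  qed simp
  define \<sigma>2 where "\<sigma>2 = (\<Sum>\<^sub>\<infinity>t. c t)"
  have var: "expectation (\<lambda>\<omega>. (centred_sum g \<Lambda> \<omega>)\<^sup>2) = (\<Sum>s\<in>\<Lambda>. \<Sum>t\<in>\<Lambda>. c (t - s))" for \<Lambda>
    unfolding c_def by (rule centred_sum_second_moment(2)[OF g i])
  have var_lim: "(\<lambda>n. expectation (\<lambda>\<omega>. (centred_sum g (\<Lambda> n) \<omega>)\<^sup>2) / real (card (\<Lambda> n))) \<longlonglongrightarrow> \<sigma>2"
    if "\<And>n. finite (\<Lambda> n)" "filterlim (\<lambda>n. real (card (\<Lambda> n))) at_top sequentially"
      "(\<lambda>n. real (card (lattice_boundary (\<Lambda> n))) / real (card (\<Lambda> n))) \<longlonglongrightarrow> 0" for \<Lambda>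
  proof -
    have "\<forall>\<^sub>F n in sequentially. 0 < real (card (\<Lambda> n))"
      using that(2) unfolding filterlim_at_top_dense by blast
    then have "\<forall>\<^sub>F n in sequentially. \<Lambda> n \<noteq> {}" by eventually_elim auto
    from cesaro_covariance[OF c_sum that(1) this that(3)] show ?thesis unfolding var \<sigma>2_def .
  qed
  \<comment> \<open>Nonnegativity is claimed before any sequence \<Lambda> is given, so it is read
    off from the normalised variances along the balls.\<close>
  have \<sigma>2: "0 \<le> \<sigma>2"
  proof -
    let ?L = "\<lambda>n. {h :: int ^ 'd. sup_norm h \<le> int n}"
    have "incseq ?L" by (auto simp: incseq_def)
    moreover have "(\<Union>n. ?L n) = UNIV"
    proof -
      have "h \<in> ?L (nat (sup_norm h))" for h using sup_norm_nonneg[of h] by simp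
      then show ?thesis by blast
    qed
    ultimately have "filterlim (\<lambda>n. real (card (?L n))) at_top sequentially"
      by (intro filterlim_card_exhaustion infinite_lattice card_sup_norm_ball)
    from var_lim[OF card_sup_norm_ball(1) this lattice_balls_van_hove] show ?thesis
      by (rule LIMSEQ_le_const) (auto intro!: divide_nonneg_nonneg Bochner_Integration.integral_nonneg)
  qed
  have stat: "stationary_field M (\<lambda>t \<omega>. g (window t \<omega>))"
    unfolding stationary_field_def random_field_def
  proof (intro conjI allI)
    define T where "T z = (\<lambda>t. g (\<chi> i. z (\<tau> i + t)))" for z :: "int ^ 'd \<Rightarrow> real"
    have T: "T \<in> measurable (Pi\<^sub>M UNIV (\<lambda>_. borel)) (Pi\<^sub>M UNIV (\<lambda>_. borel))"
    proof (rule measurable_PiM_single')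
      fix t
      have "(\<lambda>z. (\<chi> i. z (\<tau> i + t)) :: real ^ 'p) \<in> borel_measurable (Pi\<^sub>M UNIV (\<lambda>_. borel))"
        by (rule vec_measurable) simp
      from measurable_compose[OF this g] show "(\<lambda>z. T z t) \<in> borel_measurable (Pi\<^sub>M UNIV (\<lambda>_. borel))"
        by (simp add: T_def)
    qed simp
    have "T (\<lambda>r. \<eta> (r + s) \<omega>) = (\<lambda>t. g (window (t + s) \<omega>))" for s \<omega>
      by (simp add: T_def window_def add.assoc)
    then have "shifted_law M (\<lambda>t \<omega>. g (window t \<omega>)) s = distr M (Pi\<^sub>M UNIV (\<lambda>_. borel)) (\<lambda>\<omega>. T (\<lambda>r. \<eta> r \<omega>))" for s
      unfolding shifted_law_def using field_law_shift[OF T, of s] by simp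
    then show "shifted_law M (\<lambda>t \<omega>. g (window t \<omega>)) s = shifted_law M (\<lambda>t \<omega>. g (window t \<omega>)) s'" for s s' by simp
  qed measurable
  have conv: "weak_conv_m (\<lambda>n. distr M borel
      (\<lambda>\<omega>. (\<Sum>t\<in>\<Lambda> n. g (window t \<omega>) - expectation (\<lambda>\<omega>. g (window t \<omega>))) / sqrt (real (card (\<Lambda> n))))) (normal_law 0 \<sigma>2)"
    if \<Lambda>: "\<forall>n. finite (\<Lambda> n)" "incseq \<Lambda>" "(\<Union>n. \<Lambda> n) = UNIV"
      "(\<lambda>n. real (card (lattice_boundary (\<Lambda> n))) / real (card (\<Lambda> n))) \<longlonglongrightarrow> 0" for \<Lambda> :: "nat \<Rightarrow> (int ^ 'd) set"
  proof -
    have card: "filterlim (\<lambda>n. real (card (\<Lambda> n))) at_top sequentially"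
      using \<Lambda> by (intro filterlim_card_exhaustion infinite_lattice) auto
    have mean: "expectation (\<lambda>\<omega>. g (window t \<omega>)) = expectation (\<lambda>\<omega>. g (window 0 \<omega>))" for t
      by (rule window_integral(1)[OF g])
    have cs: "(\<Sum>t\<in>\<Lambda> n. g (window t \<omega>) - expectation (\<lambda>\<omega>. g (window t \<omega>))) = centred_sum g (\<Lambda> n) \<omega>" for n \<omega>
      unfolding centred_sum_def by (intro sum.cong refl arg_cong2[where f = minus] mean)
    have meas: "(\<lambda>\<omega>. centred_sum g (\<Lambda> n) \<omega> / sqrt (real (card (\<Lambda> n)))) \<in> borel_measurable M" for n
      using g by measurable
    show ?thesis unfolding cs
    proof (rule levy_continuity)
      show "real_distribution (distr M borel (\<lambda>\<omega>. centred_sum g (\<Lambda> n) \<omega> / sqrt (real (card (\<Lambda> n)))))" for n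
        by (rule real_distribution_distr[OF meas])
      show "real_distribution (normal_law 0 \<sigma>2)" by (rule char_normal_law(2)[OF \<sigma>2])
      fix x
      define v where "v n = expectation (\<lambda>\<omega>. (centred_sum g (\<Lambda> n) \<omega>)\<^sup>2) / real (card (\<Lambda> n))" for n
      define a where "a n = expectation (\<lambda>\<omega>. iexp (x * (centred_sum g (\<Lambda> n) \<omega> / sqrt (real (card (\<Lambda> n))))))" for n
      have ch: "char (distr M borel (\<lambda>\<omega>. centred_sum g (\<Lambda> n) \<omega> / sqrt (real (card (\<Lambda> n))))) x = a n" for n
        unfolding char_def a_def by (subst integral_distr[OF meas]) auto
      have "(\<lambda>n. cmod (a n - complex_of_real (exp (- v n * x\<^sup>2 / 2)))) \<longlonglongrightarrow> 0"
        unfolding a_def v_def using \<Lambda>(1) by (intro char_limit[OF g \<delta> int dq _ card]) auto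
      then have 1: "(\<lambda>n. a n - complex_of_real (exp (- v n * x\<^sup>2 / 2))) \<longlonglongrightarrow> 0"
        by (rule tendsto_norm_zero_cancel)
      have "v \<longlonglongrightarrow> \<sigma>2" unfolding v_def[abs_def] using \<Lambda>(1,4) by (intro var_lim card) auto
      then have 2: "(\<lambda>n. complex_of_real (exp (- v n * x\<^sup>2 / 2))) \<longlonglongrightarrow> complex_of_real (exp (- \<sigma>2 * x\<^sup>2 / 2))"
        by (intro tendsto_intros) auto
      from tendsto_add[OF 1 2]
      show "(\<lambda>n. char (distr M borel (\<lambda>\<omega>. centred_sum g (\<Lambda> n) \<omega> / sqrt (real (card (\<Lambda> n))))) x) \<longlonglongrightarrow> char (normal_law 0 \<sigma>2) x"
        unfolding ch char_normal_law(1)[OF \<sigma>2] by simp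
    qed
  qed
  have sq: "integrable M (\<lambda>\<omega>. (g (window t \<omega>))\<^sup>2)" for t
    using i(2)[of t t] by (simp add: power2_eq_square)
  show ?thesis
    unfolding satisfies_CLT_def Let_def cov \<sigma>2_def[symmetric]
    using stat sq c_sum \<sigma>2 conv by blast
qed

end

text \<open>The sites form a family \<tau> over the finite type \<open>'p\<close>, so that the
  arguments of \<open>g\<close> are vectors. As \<open>enn2real\<close> sends infinity to 0,
  eventual finiteness of the tails is stated apart from the little-o condition, and the weighted
  series of suprema is taken in the extended reals.\<close>

theorem theorem2p3:
  fixes M :: "'w measure"
    and \<mu> :: "(int ^ 'd \<Rightarrow> real) measure"
    and \<eta> :: "int ^ 'd \<Rightarrow> 'w \<Rightarrow> real"
    and g :: "real ^ 'p \<Rightarrow> real"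
    and \<tau> :: "'p \<Rightarrow> int ^ 'd"
    and \<delta> :: real
  assumes "prob_space M"
    and "max_id_field M \<mu> \<eta>"
    and "stationary_field M \<eta>"
    and "g \<in> borel_measurable borel"
    and "0 < \<delta>"
    and "integrable M (\<lambda>\<omega>. \<bar>g (\<chi> i. \<eta> (\<tau> i) \<omega>)\<bar> powr (2 + \<delta>))"
    and "\<forall>\<^sub>F m in sequentially. (\<Sum>\<^sub>\<infinity>h\<in>{h. int m \<le> sup_norm h}. gamma_coeff M \<mu> \<eta> h) < \<infinity>"
    and "(\<lambda>m. enn2real (\<Sum>\<^sub>\<infinity>h\<in>{h. int m \<le> sup_norm h}. gamma_coeff M \<mu> \<eta> h))
           \<in> o(\<lambda>m. 1 / real m ^ CARD('d))"
    and "(\<Sum>\<^sub>\<infinity>m\<in>{1..}. of_nat m ^ (CARD('d) - 1) *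
            (SUP h\<in>{h. int m \<le> sup_norm h}. ennreal_powr (gamma_coeff M \<mu> \<eta> h) (\<delta> / (2 + \<delta>))))
           < \<infinity>"
  shows "satisfies_CLT M (\<lambda>t \<omega>. g (\<chi> i. \<eta> (\<tau> i + t) \<omega>))"
proof -
  obtain \<Phi> where exponent: "exponent_measure \<mu>" and ppp: "poisson_point_process M \<mu> \<Phi>"
    and field: "\<forall>\<omega>\<in>space M. \<forall>t. \<eta> t \<omega> = max_field (\<Phi> \<omega>) t"
    using assms(2) by (auto simp: max_id_field_def)
  interpret P: prob_space M by (rule assms(1))
  interpret window_field M \<mu> \<eta> \<Phi> \<tau>
    by unfold_locales (use exponent ppp field assms(3) in auto)
  have "satisfies_CLT M (\<lambda>t \<omega>. g (window t \<omega>))"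
    using assms(6) by (intro window_functional_CLT[OF assms(4,5) _ assms(9)]) (simp add: window_def)
  then show ?thesis by (simp add: window_def)
qed

end
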